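(* Fix $q\in\{2,3,\ldots\}$ and let $S_n=\sum_{k=1}^n\cos(2\pi q^kU)$, $n\in\mathbb N$, where $U$ is uniformly distributed on $[0,1]$. Then the limit $$\Lambda_q(\theta):=\lim_{n\to\infty}\frac1n\log\mathbb E[e^{\theta S_n}]$$ exists, with the convergence holding uniformly for $\theta$ in compact subsets of an open set $\mathcal D\subset\mathbb C$ with $\mathbb R\subset\mathcal D$. Moreover, $(S_n/n)_{n\in\mathbb N}$ satisfies a large deviation principle with speed $n$ and rate function $$I_q(x)=\sup_{\theta\in\mathbb R}[\theta x-\Lambda_q(\theta)],\qquad x\in\mathbb R.$$ Furthermore, each $I_q$ satisfies $I_q(x)>0$ for $x\ne0$ and $I_q(x)=+\infty$ for $x\notin[-1,1]$, and the family $I_q$, $q\in\{2,3,\ldots\}$, has the following properties. (i) For every $q\in\{2,3,\ldots\}$, $I_q(1)\le\widetilde I(1)$ and $I_q(x)<\widetilde I(x)$ for all $x\in(0,1)$. In particular, $I_q$ and $\widetilde I$ are different. (ii) $\lim_{q\to\infty}I_q(x)=\widetilde I(x)$ uniformly on compact subsets of the interval $(-1,1)$. (iii) For all $m\in\{1,\ldots,q\}$, $$\Big(\frac{d}{d\theta}\Big)^m\Lambda_q(\theta)\Big|_{\theta=0}=\Big(\frac{d}{d\theta}\Big)^m\widetilde\Lambda(\theta)\Big|_{\theta=0}=\kappa_m(\widetilde X_1),$$ where $\kappa_m(\widetilde X_1)$ is the $m$-th cumulant of $\widetilde X_1$, and $$\Big(\frac{d}{dx}\Big)^mI_q(x)\Big|_{x=0}=\Big(\frac{d}{dx}\Big)^m\widetilde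 I(x)\Big|_{x=0};$$ in other words, the Taylor coefficients of orders $0,1,\ldots,q$ at the origin of $I_q$ and $\widetilde I$ coincide. (iv) For the derivative of order $q+1$, $$\Big(\frac{d}{d\theta}\Big)^{q+1}\Lambda_q(\theta)\Big|_{\theta=0}=\Big(\frac{d}{d\theta}\Big)^{q+1}\widetilde\Lambda(\theta)\Big|_{\theta=0}+\frac{q+1}{2^q}>\Big(\frac{d}{d\theta}\Big)^{q+1}\widetilde\Lambda(\theta)\Big|_{\theta=0}.$$
   Context: Large deviation principle (LDP): a sequence $(Z_n)_{n\in\mathbb N}$ of real random variables satisfies an LDP with speed $s_n\uparrow\infty$ and rate function $I:\mathbb R\to[0,\infty]$ if $I$ is lower semicontinuous and for every Borel set $A\subset\mathbb R$, $$-\inf_{x\in A^\circ}I(x)\le\liminf_{n\to\infty}\frac1{s_n}\log\mathbb P(Z_n\in A)\le\limsup_{n\to\infty}\frac1{s_n}\log\mathbb P(Z_n\in A)\le-\inf_{x\in\bar A}I(x),$$ where $A^\circ$ and $\bar A$ are the interior and closure of $A$. The functions $\widetilde\Lambda$ and $\widetilde I$: let $\widetilde X_1=\cos(2\pi U)$ with $U$ uniform on $[0,1]$ (so $\widetilde X_1$ has the arcsine law on $(-1,1)$ with density $1/(\pi\sqrt{1-x^2})$), and for $\theta\in\mathbb R$ let $$\widetilde\Lambda(\theta)=\log\mathbb E[e^{\theta\widetilde X_1}]=\log\sum_{m=0}^\infty\frac{\theta^{2m}}{2^{2m}(m!)^2},\qquad\widetilde I(x)=\sup_{\theta\in\mathbb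 R}[\theta x-\widetilde\Lambda(\theta)],\ x\in\mathbb R.$$ For complex $\theta$, $\log\mathbb E[e^{\theta S_n}]$ is understood as the analytic branch that is real on the real axis (defined on a given compact set for all sufficiently large $n$). *)

theory Defs
  imports "HOL-Probability.Probability"
begin

definition uniform_rv :: "'a measure \<Rightarrow> ('a \<Rightarrow> real) \<Rightarrow> bool" where
  "uniform_rv M U \<longleftrightarrow>
     distributed M lborel U (\<lambda>x. ennreal (indicator {0..1} x / measure lborel {0..1::real}))"

definition lacunary_sum :: "('a \<Rightarrow> real) \<Rightarrow> nat \<Rightarrow> nat \<Rightarrow> 'a \<Rightarrow> real" where
  "lacunary_sum U q n \<omega> = (\<Sum>k=1..n. cos (2 * pi * real q ^ k * U \<omega>))"

definition arcsine_rv :: "('a \<Rightarrow> real) \<Rightarrow> 'a \<Rightarrow> real" where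
  "arcsine_rv U \<omega> = cos (2 * pi * U \<omega>)"

definition cgf :: "'a measure \<Rightarrow> ('a \<Rightarrow> real) \<Rightarrow> real \<Rightarrow> real" where
  "cgf M X \<theta> = ln (\<integral>\<omega>. exp (\<theta> * X \<omega>) \<partial>M)"

definition complex_mgf :: "'a measure \<Rightarrow> ('a \<Rightarrow> real) \<Rightarrow> complex \<Rightarrow> complex" where
  "complex_mgf M X \<theta> = (\<integral>\<omega>. exp (\<theta> * complex_of_real (X \<omega>)) \<partial>M)"

definition cumulant :: "'a measure \<Rightarrow> ('a \<Rightarrow> real) \<Rightarrow> nat \<Rightarrow> real" where
  "cumulant M X m = (deriv ^^ m) (cgf M X) 0"

text \<open>
  If \<open>V\<close> is connected and meets the real axis, and \<open>F\<close> is positive on \<open>V \<inter> \<real>\<close>, then there is at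
  most one such \<open>L\<close> on \<open>V\<close>: two logarithms of \<open>F\<close> differ by a constant in \<open>2\<pi>i\<int>\<close>.
\<close>

definition real_log_branch_on :: "complex set \<Rightarrow> (complex \<Rightarrow> complex) \<Rightarrow> (complex \<Rightarrow> complex) \<Rightarrow> bool" where
  "real_log_branch_on V F L \<longleftrightarrow>
     L holomorphic_on V \<and> (\<forall>z\<in>V. exp (L z) = F z) \<and> (\<forall>z\<in>V \<inter> \<real>. L z \<in> \<real>)"

definition Lambda_q :: "'a measure \<Rightarrow> ('a \<Rightarrow> real) \<Rightarrow> nat \<Rightarrow> real \<Rightarrow> real" where
  "Lambda_q M U q \<theta> = lim (\<lambda>n. cgf M (lacunary_sum U q n) \<theta> / real n)"

definition Lambda_tilde :: "'a measure \<Rightarrow> ('a \<Rightarrow> real) \<Rightarrow> real \<Rightarrow> real" where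
  "Lambda_tilde M U = cgf M (arcsine_rv U)"

definition legendre_transform :: "(real \<Rightarrow> real) \<Rightarrow> real \<Rightarrow> ereal" where
  "legendre_transform f x = (SUP \<theta>::real. ereal (\<theta> * x - f \<theta>))"

definition I_q :: "'a measure \<Rightarrow> ('a \<Rightarrow> real) \<Rightarrow> nat \<Rightarrow> real \<Rightarrow> ereal" where
  "I_q M U q = legendre_transform (Lambda_q M U q)"

definition I_tilde :: "'a measure \<Rightarrow> ('a \<Rightarrow> real) \<Rightarrow> real \<Rightarrow> ereal" where
  "I_tilde M U = legendre_transform (Lambda_tilde M U)"

text \<open>Logarithm of a probability, with \<open>log 0 = -\<infinity>\<close>; the library has \<open>ln 0 = 0\<close>.\<close>

definition log_prob :: "real \<Rightarrow> ereal" where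
  "log_prob p = (if p = 0 then -\<infinity> else ereal (ln p))"

definition lower_semicontinuous :: "(real \<Rightarrow> ereal) \<Rightarrow> bool" where
  "lower_semicontinuous f \<longleftrightarrow> (\<forall>x. f x \<le> Liminf (at x) f)"

definition satisfies_LDP ::
    "'a measure \<Rightarrow> (nat \<Rightarrow> 'a \<Rightarrow> real) \<Rightarrow> (nat \<Rightarrow> real) \<Rightarrow> (real \<Rightarrow> ereal) \<Rightarrow> bool" where
  "satisfies_LDP M Z s I \<longleftrightarrow>
     (\<forall>n. Z n \<in> borel_measurable M) \<and>
     incseq s \<and> filterlim s at_top sequentially \<and>
     (\<forall>x. 0 \<le> I x) \<and> lower_semicontinuous I \<and>
     (\<forall>A\<in>sets borel.
        - (INF x\<in>interior A. I x)
          \<le> liminf (\<lambda>n. ereal (1 / s n) * log_prob (measure M {\<omega> \<in> space M. Z n \<omega> \<in> A})) \<and>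
        limsup (\<lambda>n. ereal (1 / s n) * log_prob (measure M {\<omega> \<in> space M. Z n \<omega> \<in> A}))
          \<le> - (INF x\<in>closure A. I x))"

text \<open>
  Existence of the \<open>m\<close>-th derivative at a point. It accompanies every statement about
  \<open>(deriv ^^ m) f a\<close>, since \<open>deriv\<close> returns an arbitrary value where \<open>f\<close> is not differentiable.
\<close>

primrec times_differentiable_at :: "nat \<Rightarrow> (real \<Rightarrow> real) \<Rightarrow> real \<Rightarrow> bool" where
  "times_differentiable_at 0 f a \<longleftrightarrow> True"
| "times_differentiable_at (Suc m) f a \<longleftrightarrow>
     (\<forall>\<^sub>F x in nhds a. times_differentiable_at m f x) \<and>
     (deriv ^^ m) f differentiable (at a)"

text \<open>
  The same for an extended real valued function, which is required to be finite near the point so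
  that \<open>real_of_ereal\<close> does not hide infinite values.
\<close>

definition ereal_times_differentiable_at :: "nat \<Rightarrow> (real \<Rightarrow> ereal) \<Rightarrow> real \<Rightarrow> bool" where
  "ereal_times_differentiable_at m f a \<longleftrightarrow>
     (\<forall>\<^sub>F x in nhds a. \<bar>f x\<bar> \<noteq> \<infinity>) \<and>
     times_differentiable_at m (\<lambda>x. real_of_ereal (f x)) a"

end

theory Submission
  imports Defs "HOL-Complex_Analysis.Complex_Analysis" "HOL-Real_Asymp.Real_Asymp"
begin

text \<open>
  With \<open>T x = q x mod 1\<close> and \<open>g x = cos (2 \<pi> x)\<close>, the sum \<open>S\<^sub>n\<close> is a Birkhoff sum of \<open>g\<close>, so that
  \<open>E exp (z S\<^sub>n)\<close> is the integral of the \<open>n\<close>-th iterate of the transfer operator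
  \<open>f \<mapsto> (1/q) \<Sum>\<^sub>j exp (z g(y\<^sub>j)) f(y\<^sub>j)\<close>, \<open>y\<^sub>j = (x + j) / q\<close>, applied to \<open>1\<close>.

  For real \<open>z = \<theta>\<close> the iterates have logarithms with Lipschitz constant at most \<open>2 \<pi> \<bar>\<theta>\<bar> / (q - 1)\<close>; hence
  \<open>log E exp (\<theta> S\<^sub>n)\<close> is additive in \<open>n\<close> up to this constant, its limit \<open>\<Lambda>\<^sub>q\<close> exists and differs from the
  function for \<open>n = 1\<close> by at most this constant, which yields (ii).
  For \<open>z = \<theta> + i \<eta>\<close> the quotient of the complex by the real iterate evolves under Markov operators
  that contract a suitable modulus of continuity, so for small \<open>\<eta>\<close> it stays almost constant and the
  moment generating functions have no zeros on a neighbourhood of the real line. Vitali's theorem then makes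
  \<open>\<Lambda>\<^sub>q\<close> analytic, and the Gaertner-Ellis theorem gives the large deviation principle.

  Part (i): for \<open>\<theta> > 0\<close> all functions involved have nonnegative Fourier coefficients, hence nonnegative
  covariances, so \<open>\<Lambda>\<^sub>q \<theta> \<ge> (1/2) log E exp (\<theta> S\<^sub>2)\<close>, which exceeds the function for \<open>n = 1\<close> since
  \<open>(g x)\<^sup>q\<close> and \<open>g (q x)\<close> are correlated.
  Parts (iii) and (iv): this correlation is also the first one visible in the expansion of the iterates in
  powers of \<open>\<theta>\<close>, at order \<open>q + 1\<close>; the Legendre transforms inherit the agreement because the maximising
  \<open>\<theta>\<close> is \<open>O(x)\<close>.
\<close>

section \<open>The transfer operator\<close>

text \<open>No spectral theory enters: the estimates are made for finite n. Two obstacles shape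
  them. Logarithms of the moment generating functions need one domain for all n, hence a strip free
  of zeros whose width depends on Re z only. And the bound on this strip that comes for free, |E exp
  (z S_n)| \<le> E exp (Re z S_n) \<le> exp (n |Re z|), controls the real part of log E exp (z S_n)
  / n from above only; hence a form of Vitali's theorem that works with reciprocals. The derivatives
  at 0 are found for finite n as well, from log E exp (\<theta> S_n) = n log E exp (\<theta> S_1) +
  (n - 1) \<theta>^(q+1) / (2^q q!) + O(\<theta>^(q+2)). The error may depend on n arbitrarily,
  because only derivatives of order at most q + 1 are read off before n tends to infinity; uniform
  convergence on complex discs carries them to the limit, and division by n turns n - 1 into 1. The
  excess (q + 1) / 2^q in (iv) is (q + 1)! / (2^q q!).\<close>

definition gcos :: "real \<Rightarrow> real" where
  "gcos x = cos (2 * pi * x)"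

definition transfer_op :: "nat \<Rightarrow> (real \<Rightarrow> 'b::real_vector) \<Rightarrow> real \<Rightarrow> 'b" where
  "transfer_op q h x = (1 / real q) *\<^sub>R (\<Sum>j<q. h ((x + real j) / real q))"

text \<open>Polymorphic in the field: the complex iterates are later divided by the real ones, and
  both obey one recursion.\<close>

primrec transfer_iter :: "nat \<Rightarrow> 'b::{real_normed_field,banach} \<Rightarrow> nat \<Rightarrow> real \<Rightarrow> 'b" where
  "transfer_iter q z 0 = (\<lambda>x. 1)"
| "transfer_iter q z (Suc n) = transfer_op q (\<lambda>y. exp (z * of_real (gcos y)) * transfer_iter q z n y)"

definition birkhoff_sum :: "nat \<Rightarrow> nat \<Rightarrow> real \<Rightarrow> real" where
  "birkhoff_sum q n x = (\<Sum>k<n. gcos (real q ^ k * x))"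

text \<open>The Birkhoff sum starts at k = 0 and S_n at k = 1. Lebesgue measure is invariant under x
  \<mapsto> q x modulo 1, so this is nevertheless the moment generating function of S_n.\<close>

definition mgf :: "nat \<Rightarrow> nat \<Rightarrow> 'b::{real_normed_field,banach} \<Rightarrow> 'b" where
  "mgf q n z = integral {0..1} (\<lambda>x. exp (z * of_real (birkhoff_sum q n x)))"

lemma continuous_on_gcos [continuous_intros]:
  fixes f :: "real \<Rightarrow> real"
  assumes "continuous_on A f" shows "continuous_on A (\<lambda>x. gcos (f x))"
  unfolding gcos_def by (intro continuous_intros assms)

lemma continuous_on_birkhoff_sum [continuous_intros]:
  fixes f :: "real \<Rightarrow> real"
  assumes "continuous_on A f" shows "continuous_on A (\<lambda>x. birkhoff_sum q n (f x))"
  unfolding birkhoff_sum_def by (intro continuous_intros assms)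

lemma gcos_le: "\<bar>gcos x\<bar> \<le> 1"
  by (simp add: gcos_def)

lemma gcos_add_nat [simp]: "gcos (x + real j) = gcos x"
  using cos.plus_of_nat[of "2 * pi * x" j] by (simp add: gcos_def algebra_simps)

lemma birkhoff_sum_le: "\<bar>birkhoff_sum q n x\<bar> \<le> real n"
proof -
  have "\<bar>birkhoff_sum q n x\<bar> \<le> (\<Sum>k<n. \<bar>gcos (real q ^ k * x)\<bar>)"
    unfolding birkhoff_sum_def by (rule sum_abs)
  also have "\<dots> \<le> (\<Sum>k<n. 1)" by (intro sum_mono gcos_le)
  finally show ?thesis by simp
qed

lemma birkhoff_sum_Suc: "birkhoff_sum q (Suc n) x = birkhoff_sum q n x + gcos (real q ^ n * x)"
  by (simp add: birkhoff_sum_def)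

lemma birkhoff_sum_add:
  "birkhoff_sum q (n + m) x = birkhoff_sum q n x + birkhoff_sum q m (real q ^ n * x)"
proof (induction m)
  case (Suc m)
  thus ?case by (simp add: birkhoff_sum_Suc power_add mult_ac)
qed (simp add: birkhoff_sum_def)

lemma gcos_pow_add_nat [simp]: "gcos (real q ^ k * (x + real j)) = gcos (real q ^ k * x)"
  using gcos_add_nat[of "real q ^ k * x" "q ^ k * j"] by (simp add: algebra_simps)

lemma birkhoff_sum_add_nat [simp]: "birkhoff_sum q n (x + real j) = birkhoff_sum q n x"
  by (simp add: birkhoff_sum_def)

lemma continuous_on_transfer_op:
  fixes h :: "real \<Rightarrow> 'b::real_normed_vector"
  assumes "continuous_on UNIV h"
  shows "continuous_on A (transfer_op q h)"
  unfolding transfer_op_def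
  by (intro continuous_intros continuous_on_compose2[OF assms]) auto

lemma continuous_on_transfer_iter:
  fixes z :: "'b::{real_normed_field,banach}"
  shows "continuous_on A (transfer_iter q z n)"
proof -
  have "continuous_on UNIV (transfer_iter q z n)"
  proof (induction n)
    case (Suc n)
    show ?case unfolding transfer_iter.simps
      by (intro continuous_on_transfer_op continuous_intros Suc)
  qed simp
  thus ?thesis using continuous_on_subset by blast
qed

text \<open>If H is an antiderivative of h, the sum over j of H ((x + j) / q) is one of
  \<open>transfer_op q h\<close>, and its increment over the unit interval telescopes to H 1 - H
  0.\<close>

lemma integral_transfer_op:
  fixes h :: "real \<Rightarrow> 'b::banach"
  assumes h: "continuous_on UNIV h" and q: "0 < q"
  shows "integral {0..1} (transfer_op q h) = integral {0..1} h"
proof -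
  define H where "H x = integral {0..x} h" for x
  have hi: "h integrable_on {a..b}" for a b
    using h continuous_on_subset by (intro integrable_continuous_real) blast
  have H: "(H has_vector_derivative h x) (at x within {0..1})" if "x \<in> {0..1}" for x
    unfolding H_def
    by (rule integral_has_vector_derivative) (use h that continuous_on_subset in blast)+
  define G where "G x = (\<Sum>j<q. H ((x + real j) / real q))" for x
  have inn: "(x + real j) / real q \<in> {0..1}" if "x \<in> {0..1}" "j < q" for x j
  proof -
    have "real j + 1 \<le> real q" using that(2) by linarith
    thus ?thesis using that q by (auto simp: field_simps)
  qed
  have G: "(G has_vector_derivative transfer_op q h x) (at x within {0..1})" if x: "x \<in> {0..1}" for x
  proof -
    have *: "((\<lambda>x. H ((x + real j) / real q)) has_vector_derivative (1 / real q) *\<^sub>R h ((x + real j) / real q))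
        (at x within {0..1})" if j: "j < q" for j
    proof -
      have 1: "((\<lambda>x. (x + real j) / real q) has_vector_derivative (1 / real q)) (at x within {0..1})"
        using q by (auto intro!: derivative_eq_intros simp: has_real_derivative_iff_has_vector_derivative[symmetric])
      have "((H \<circ> (\<lambda>x. (x + real j) / real q)) has_vector_derivative (1 / real q) *\<^sub>R h ((x + real j) / real q))
        (at x within {0..1})"
        by (rule vector_diff_chain_within[OF 1])
           (rule has_vector_derivative_within_subset[OF H[OF inn[OF x j]]], use inn j in auto)
      thus ?thesis by (simp add: o_def)
    qed
    show ?thesis unfolding G_def transfer_op_def scaleR_sum_right
      by (rule has_vector_derivative_sum) (use * in auto)
  qed
  have "(transfer_op q h has_integral (G 1 - G 0)) {0..1}"
    by (rule fundamental_theorem_of_calculus) (use G in auto)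
  also have "G 1 - G 0 = (\<Sum>j<q. H (real (Suc j) / real q) - H (real j / real q))"
    unfolding G_def by (simp add: sum_subtractf add.commute)
  also have "\<dots> = H 1 - H 0"
    by (subst sum_lessThan_telescope) (use q in simp)
  also have "\<dots> = integral {0..1} h" by (simp add: H_def)
  finally show ?thesis by blast
qed

text \<open>Invariance of Lebesgue measure on the circle: for periodic functions the transfer
  operator undoes composition with x \<mapsto> q x, and it preserves integrals.\<close>

lemma integral_dilation:
  fixes h :: "real \<Rightarrow> 'b::banach"
  assumes h: "continuous_on UNIV h" and q: "0 < q" and per: "\<And>x j. h (x + real j) = h x"
  shows "integral {0..1} (\<lambda>x. h (real q * x)) = integral {0..1} h"
proof -
  have "transfer_op q (\<lambda>x. h (real q * x)) = h"
    using q by (simp add: transfer_op_def per fun_eq_iff sum_constant_scaleR)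
  moreover have "continuous_on UNIV (\<lambda>x. h (real q * x))"
    by (intro continuous_on_compose2[OF h] continuous_intros) auto
  ultimately show ?thesis using integral_transfer_op[of "\<lambda>x. h (real q * x)" q] q by simp
qed

text \<open>Duality between the transfer operator and composition with x \<mapsto> q x, iterated.
  The test function \<phi> is arbitrary because the induction moves one factor exp (z g) into it;
  there it becomes the last term of the orbit.\<close>

lemma integral_transfer_iter:
  fixes z :: "'b::{real_normed_field,banach}"
  assumes q: "0 < q"
  assumes "continuous_on UNIV \<phi>" and "\<And>x j. \<phi> (x + real j) = \<phi> x"
  shows "integral {0..1} (\<lambda>x. transfer_iter q z n x * \<phi> x) =
         integral {0..1} (\<lambda>x. exp (z * of_real (birkhoff_sum q n x)) * \<phi> (real q ^ n * x))"
  using assms(2,3)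
proof (induction n arbitrary: \<phi>)
  case 0
  then show ?case by (simp add: birkhoff_sum_def)
next
  case (Suc n)
  define \<psi> where "\<psi> x = exp (z * of_real (gcos x)) * \<phi> (real q * x)" for x
  have c: "continuous_on UNIV (\<lambda>x. \<phi> (real q * x))"
    by (intro continuous_on_compose2[OF Suc.prems(1)] continuous_intros) auto
  have c\<psi>: "continuous_on UNIV \<psi>"
    unfolding \<psi>_def by (intro continuous_intros c)
  have p: "\<psi> (x + real j) = \<psi> x" for x j
    unfolding \<psi>_def using Suc.prems(2)[of "real q * x" "q * j"] by (simp add: algebra_simps)
  have "transfer_iter q z (Suc n) x * \<phi> x = transfer_op q (\<lambda>x. transfer_iter q z n x * \<psi> x) x" for x
    using q by (simp add: transfer_op_def \<psi>_def Suc.prems(2) sum_distrib_right mult_ac sum_distrib_left)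
  hence "integral {0..1} (\<lambda>x. transfer_iter q z (Suc n) x * \<phi> x)
     = integral {0..1} (transfer_op q (\<lambda>x. transfer_iter q z n x * \<psi> x))"
    by presburger
  also have "\<dots> = integral {0..1} (\<lambda>x. transfer_iter q z n x * \<psi> x)"
    by (intro integral_transfer_op continuous_intros continuous_on_transfer_iter c\<psi> q)
  also have "\<dots> = integral {0..1} (\<lambda>x. exp (z * of_real (birkhoff_sum q n x)) * \<psi> (real q ^ n * x))"
    by (rule Suc.IH[OF c\<psi> p])
  also have "\<dots> = integral {0..1} (\<lambda>x. exp (z * of_real (birkhoff_sum q (Suc n) x)) * \<phi> (real q ^ Suc n * x))"
    by (simp add: \<psi>_def birkhoff_sum_Suc algebra_simps exp_add)
  finally show ?case .
qed

lemma mgf_eq_integral: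
  assumes "0 < q"
  shows "mgf q n z = integral {0..1} (transfer_iter q z n)"
  unfolding mgf_def using integral_transfer_iter[OF assms, of "\<lambda>_. 1" z n] by simp

section \<open>From random variables to integrals over the unit interval\<close>

lemma integral_uniform_rv:
  fixes h :: "real \<Rightarrow> 'b::euclidean_space"
  assumes U: "uniform_rv M U" and h: "continuous_on UNIV h"
  shows "(\<integral>\<omega>. h (U \<omega>) \<partial>M) = integral {0..1} h"
proof -
  have d: "distributed M lborel U (\<lambda>x. ennreal (indicator {0..1} x))"
    using U unfolding uniform_rv_def by simp
  have hm: "h \<in> borel_measurable borel"
    by (rule borel_measurable_continuous_onI[OF h])
  have Um: "U \<in> measurable M lborel"
    by (rule distributed_measurable[OF d])
  have "(\<integral>\<omega>. h (U \<omega>) \<partial>M) = (\<integral>x. h x \<partial>distr M lborel U)"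
    using Um hm by (subst integral_distr) auto
  also have "distr M lborel U = density lborel (\<lambda>x. ennreal (indicator {0..1} x))"
    by (rule distributed_distr_eq_density[OF d])
  also have "(\<integral>x. h x \<partial>\<dots>) = (\<integral>x. indicator {0..1} x *\<^sub>R h x \<partial>lborel)"
    using hm by (subst integral_density) auto
  also have "\<dots> = integral {0..1} h"
  proof -
    have "set_integrable lborel {0..1} h"
      unfolding set_integrable_def
      by (rule borel_integrable_compact) (use h continuous_on_subset in \<open>blast+\<close>)
    from set_borel_integral_eq_integral(2)[OF this] show ?thesis
      unfolding set_lebesgue_integral_def .
  qed
  finally show ?thesis .
qed

lemma lacunary_sum_eq: "lacunary_sum U q n \<omega> = birkhoff_sum q n (real q * U \<omega>)"
proof -
  have "lacunary_sum U q n \<omega> = (\<Sum>k<n. cos (2 * pi * real q ^ Suc k * U \<omega>))"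
    unfolding lacunary_sum_def
    by (rule sum.reindex_bij_witness[of _ Suc "\<lambda>k. k - 1"]) auto
  also have "\<dots> = birkhoff_sum q n (real q * U \<omega>)"
    unfolding birkhoff_sum_def gcos_def by (intro sum.cong refl arg_cong[where f=cos]) simp
  finally show ?thesis .
qed

lemma mgf_lacunary_sum:
  fixes z :: "'b::{real_normed_field,banach,euclidean_space}"
  assumes U: "uniform_rv M U" and q: "0 < q"
  shows "(\<integral>\<omega>. exp (z * of_real (lacunary_sum U q n \<omega>)) \<partial>M) = mgf q n z"
proof -
  have "(\<integral>\<omega>. exp (z * of_real (lacunary_sum U q n \<omega>)) \<partial>M)
     = integral {0..1} (\<lambda>x. exp (z * of_real (birkhoff_sum q n (real q * x))))"
    unfolding lacunary_sum_eq by (rule integral_uniform_rv[OF U]) (intro continuous_intros)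
  also have "\<dots> = mgf q n z" unfolding mgf_def
  proof (rule integral_dilation[OF _ q])
    show "continuous_on UNIV (\<lambda>x. exp (z * of_real (birkhoff_sum q n x)))"
      by (intro continuous_intros)
  qed simp
  finally show ?thesis .
qed

text \<open>A Birkhoff sum of length one does not see the dilation, so \<open>q\<close> is free.
  This lets the arcsine law be compared with the lacunary sums for every \<open>q\<close>.\<close>

lemma mgf_arcsine:
  fixes z :: "'b::{real_normed_field,banach,euclidean_space}"
  assumes U: "uniform_rv M U"
  shows "(\<integral>\<omega>. exp (z * of_real (arcsine_rv U \<omega>)) \<partial>M) = mgf q 1 z"
proof -
  have "(\<integral>\<omega>. exp (z * of_real (gcos (U \<omega>))) \<partial>M) = integral {0..1} (\<lambda>x. exp (z * of_real (gcos x)))"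
    by (rule integral_uniform_rv[OF U]) (intro continuous_intros)
  thus ?thesis by (simp add: arcsine_rv_def mgf_def birkhoff_sum_def gcos_def)
qed

lemma cgf_lacunary_sum:
  assumes "uniform_rv M U" and "0 < q"
  shows "cgf M (lacunary_sum U q n) \<theta> = ln (mgf q n \<theta>)"
  unfolding cgf_def mgf_lacunary_sum[OF assms, symmetric] of_real_eq_id id_apply ..

lemma complex_mgf_lacunary_sum:
  assumes "uniform_rv M U" and "0 < q"
  shows "complex_mgf M (lacunary_sum U q n) z = mgf q n z"
  unfolding complex_mgf_def by (rule mgf_lacunary_sum[OF assms])

lemma Lambda_tilde_eq:
  assumes "uniform_rv M U"
  shows "Lambda_tilde M U \<theta> = ln (mgf q 1 \<theta>)"
  unfolding cgf_def Lambda_tilde_def mgf_arcsine[OF assms, symmetric] of_real_eq_id id_apply ..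

lemma mgf_of_real: "mgf q n (complex_of_real \<theta>) = complex_of_real (mgf q n \<theta>)"
proof -
  have "continuous_on {0..1} (\<lambda>x. exp (\<theta> * birkhoff_sum q n x))"
    by (intro continuous_intros)
  hence "((\<lambda>x. exp (\<theta> * birkhoff_sum q n x)) has_integral integral {0..1} (\<lambda>x. exp (\<theta> * birkhoff_sum q n x))) {0..1}"
    using integrable_continuous_real integrable_integral by blast
  from has_integral_linear[OF this bounded_linear_of_real[where 'a = complex]]
  have "((\<lambda>x. exp (complex_of_real \<theta> * complex_of_real (birkhoff_sum q n x))) has_integral
      complex_of_real (integral {0..1} (\<lambda>x. exp (\<theta> * birkhoff_sum q n x)))) {0..1}"
    by (simp only: o_def flip: exp_of_real of_real_mult)
  thus ?thesis
    unfolding mgf_def of_real_eq_id id_apply by (rule integral_unique)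
qed

section \<open>Bounds for real arguments\<close>

lemma gcos_lipschitz: "\<bar>gcos x - gcos y\<bar> \<le> 2 * pi * \<bar>x - y\<bar>"
proof -
  have "\<bar>cos a - cos b\<bar> \<le> \<bar>a - b\<bar>" for a b :: real
  proof -
    have "\<bar>cos a - cos b\<bar> = 2 * \<bar>sin ((a + b) / 2)\<bar> * \<bar>sin ((b - a) / 2)\<bar>"
      by (simp add: cos_diff_cos abs_mult)
    also have "\<dots> \<le> 2 * 1 * \<bar>(b - a) / 2\<bar>"
      by (intro mult_mono abs_sin_x_le_abs_x) auto
    finally show ?thesis by simp
  qed
  from this[of "2 * pi * x" "2 * pi * y"] show ?thesis
    by (simp add: gcos_def abs_mult flip: right_diff_distrib)
qed

lemma transfer_iter_pos:
  fixes \<theta> :: real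
  assumes "0 < q"
  shows "0 < transfer_iter q \<theta> n x"
proof (induction n arbitrary: x)
  case (Suc n)
  have "0 < (\<Sum>j<q. exp (\<theta> * of_real (gcos ((x + real j) / real q))) * transfer_iter q \<theta> n ((x + real j) / real q))"
    by (intro sum_pos mult_pos_pos Suc) (use assms in auto)
  thus ?case unfolding transfer_iter.simps transfer_op_def
    using assms by simp
qed simp

text \<open>The hypothesis on A is the fixed point inequality of the recursion: the weight exp
  (\<theta> g) adds 2 pi |\<theta>| to the Lipschitz constant of the logarithm, and the inverse
  branches divide the sum by q. A stays free because the limit needs the smallest value and the
  zero-free region a value bounded below. The second claim, for a single branch, will compare Markov
  weights.\<close>

lemma transfer_iter_distortion:
  fixes \<theta> A :: real
  assumes q: "0 < q" and A: "2 * pi * \<bar>\<theta>\<bar> + A \<le> A * real q" and A0: "0 \<le> A"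
  shows "transfer_iter q \<theta> n x \<le> exp (A * \<bar>x - y\<bar>) * transfer_iter q \<theta> n y"
    and "exp (\<theta> * gcos ((x + real j) / real q)) * transfer_iter q \<theta> n ((x + real j) / real q) \<le>
      exp (A * \<bar>x - y\<bar>) * (exp (\<theta> * gcos ((y + real j) / real q)) * transfer_iter q \<theta> n ((y + real j) / real q))"
proof -
  let ?f = "transfer_iter q \<theta>"
  have step: "exp (\<theta> * gcos ((x + real j) / real q)) * ?f n ((x + real j) / real q) \<le>
      exp (A * \<bar>x - y\<bar>) * (exp (\<theta> * gcos ((y + real j) / real q)) * ?f n ((y + real j) / real q))"
    if IH: "\<And>x y. ?f n x \<le> exp (A * \<bar>x - y\<bar>) * ?f n y" for n x y j
  proof -
    let ?x = "(x + real j) / real q" and ?y = "(y + real j) / real q"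
    have xy: "\<bar>?x - ?y\<bar> = \<bar>x - y\<bar> / real q"
      by (simp flip: diff_divide_distrib)
    have "\<theta> * (gcos ?x - gcos ?y) \<le> \<bar>\<theta>\<bar> * \<bar>gcos ?x - gcos ?y\<bar>"
      by (simp flip: abs_mult)
    also have "\<dots> \<le> \<bar>\<theta>\<bar> * (2 * pi * \<bar>?x - ?y\<bar>)"
      by (intro mult_left_mono gcos_lipschitz) auto
    finally have "\<theta> * gcos ?x + A * \<bar>?x - ?y\<bar> \<le> \<theta> * gcos ?y + (2 * pi * \<bar>\<theta>\<bar> + A) * \<bar>?x - ?y\<bar>"
      by (simp add: algebra_simps)
    also have "(2 * pi * \<bar>\<theta>\<bar> + A) * \<bar>?x - ?y\<bar> \<le> A * real q * \<bar>?x - ?y\<bar>"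
      by (intro mult_right_mono A) auto
    also have "A * real q * \<bar>?x - ?y\<bar> = A * \<bar>x - y\<bar>"
      unfolding xy using q by simp
    finally have le: "\<theta> * gcos ?x + A * \<bar>?x - ?y\<bar> \<le> A * \<bar>x - y\<bar> + \<theta> * gcos ?y" by simp
    have "exp (\<theta> * gcos ?x) * ?f n ?x \<le> exp (\<theta> * gcos ?x) * (exp (A * \<bar>?x - ?y\<bar>) * ?f n ?y)"
      by (intro mult_left_mono IH) auto
    also have "\<dots> = exp (\<theta> * gcos ?x + A * \<bar>?x - ?y\<bar>) * ?f n ?y"
      by (simp add: exp_add)
    also have "\<dots> \<le> exp (A * \<bar>x - y\<bar> + \<theta> * gcos ?y) * ?f n ?y"
      using le transfer_iter_pos[OF q, of \<theta> n ?y] by (intro mult_right_mono) auto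
    finally show ?thesis by (simp add: exp_add)
  qed
  have f: "?f n x \<le> exp (A * \<bar>x - y\<bar>) * ?f n y" for n x y
  proof (induction n arbitrary: x y)
    case 0
    show ?case using A0 by simp
  next
    case (Suc n)
    show ?case
      unfolding transfer_iter.simps transfer_op_def real_scaleR_def sum_distrib_left
      by (intro sum_mono) (use step[OF Suc, of x _ y] q in \<open>simp add: mult.left_commute divide_right_mono\<close>)
  qed
  show "?f n x \<le> exp (A * \<bar>x - y\<bar>) * ?f n y" by (rule f)
  show "exp (\<theta> * gcos ((x + real j) / real q)) * ?f n ((x + real j) / real q) \<le>
      exp (A * \<bar>x - y\<bar>) * (exp (\<theta> * gcos ((y + real j) / real q)) * ?f n ((y + real j) / real q))"
    by (rule step[OF f])
qed

lemma mgf_bounds: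
  fixes \<theta> :: real
  shows "mgf q n \<theta> \<le> exp (\<bar>\<theta>\<bar> * real n)" and "0 < mgf q n \<theta>"
proof -
  have b: "\<bar>\<theta> * birkhoff_sum q n x\<bar> \<le> \<bar>\<theta>\<bar> * real n" for x
    using birkhoff_sum_le[of q n x] by (simp add: abs_mult mult_left_mono)
  have i: "(\<lambda>x. exp (\<theta> * of_real (birkhoff_sum q n x))) integrable_on {0..1}"
    by (intro integrable_continuous_real continuous_intros)
  have "integral {0..1} (\<lambda>x. exp (\<theta> * of_real (birkhoff_sum q n x))) \<le> integral {0..1::real} (\<lambda>x. exp (\<bar>\<theta>\<bar> * real n))"
    by (intro integral_le i) (use b in \<open>auto simp: abs_le_iff\<close>)
  thus "mgf q n \<theta> \<le> exp (\<bar>\<theta>\<bar> * real n)" by (simp add: mgf_def)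
  have "exp (- (\<bar>\<theta>\<bar> * real n)) = integral {0..1::real} (\<lambda>x. exp (- (\<bar>\<theta>\<bar> * real n)))" by simp
  also have "\<dots> \<le> mgf q n \<theta>"
    unfolding mgf_def by (intro integral_le i) (use b in \<open>auto simp: abs_le_iff minus_le_iff\<close>)
  finally show "0 < mgf q n \<theta>" using exp_gt_zero[of "- (\<bar>\<theta>\<bar> * real n)"] by linarith
qed

section \<open>Almost additivity and existence of the limit\<close>

lemma transfer_iter_mgf_le:
  fixes \<theta> A :: real
  assumes q: "0 < q" and A: "2 * pi * \<bar>\<theta>\<bar> + A \<le> A * real q" "0 \<le> A" and x: "x \<in> {0..1}"
  shows "transfer_iter q \<theta> n x \<le> exp A * mgf q n \<theta>" and "mgf q n \<theta> \<le> exp A * transfer_iter q \<theta> n x"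
proof -
  let ?f = "transfer_iter q \<theta> n"
  have i: "?f integrable_on {0..1}"
    by (intro integrable_continuous_real continuous_on_transfer_iter)
  have le: "?f x \<le> exp A * ?f y" if "x \<in> {0..1}" "y \<in> {0..1}" for x y
  proof -
    have "A * \<bar>x - y\<bar> \<le> A * 1"
      using that A(2) by (intro mult_left_mono) auto
    have "?f x \<le> exp (A * \<bar>x - y\<bar>) * ?f y" by (rule transfer_iter_distortion[OF q A])
    also have "\<dots> \<le> exp A * ?f y"
      using \<open>A * \<bar>x - y\<bar> \<le> A * 1\<close> transfer_iter_pos[OF q, of \<theta> n y] by (intro mult_right_mono) auto
    finally show ?thesis .
  qed
  have "?f x = integral {0..1::real} (\<lambda>y. ?f x)" by simp
  also have "\<dots> \<le> integral {0..1} (\<lambda>y. exp A * ?f y)"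
    by (intro integral_le integrable_on_mult_right i) (use le x in auto)
  finally show "?f x \<le> exp A * mgf q n \<theta>" by (simp add: mgf_eq_integral[OF q])
  have "integral {0..1} ?f \<le> integral {0..1::real} (\<lambda>y. exp A * ?f x)"
    by (intro integral_le i) (use le x in auto)
  thus "mgf q n \<theta> \<le> exp A * ?f x" by (simp add: mgf_eq_integral[OF q])
qed

text \<open>By duality E exp (\<theta> S_(n+m)) is the integral of the n-th iterate times exp
  (\<theta> S_m), and the iterate stays within factors exp (-A) and exp A of its mean E exp
  (\<theta> S_n).\<close>

lemma ln_mgf_almost_additive:
  fixes \<theta> A :: real
  assumes q: "0 < q" and A: "2 * pi * \<bar>\<theta>\<bar> + A \<le> A * real q" "0 \<le> A"
  shows "\<bar>ln (mgf q (n + m) \<theta>) - ln (mgf q n \<theta>) - ln (mgf q m \<theta>)\<bar> \<le> A"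
proof -
  let ?f = "transfer_iter q \<theta> n" and ?F = "\<lambda>n. mgf q n \<theta>" and ?e = "\<lambda>x. exp (\<theta> * birkhoff_sum q m x)"
  have i: "(\<lambda>x. ?f x * ?e x) integrable_on {0..1}" "?e integrable_on {0..1}"
    by (intro integrable_continuous_real continuous_on_transfer_iter continuous_intros)+
  have "?F (n + m) = integral {0..1} (\<lambda>x. exp (\<theta> * birkhoff_sum q n x) * ?e (real q ^ n * x))"
    by (simp add: mgf_def birkhoff_sum_add distrib_left exp_add)
  also have "\<dots> = integral {0..1} (\<lambda>x. ?f x * ?e x)"
    using integral_transfer_iter[OF q, of ?e \<theta> n] by (simp add: continuous_intros)
  finally have F: "?F (n + m) = integral {0..1} (\<lambda>x. ?f x * ?e x)" .
  have Fm: "?F m = integral {0..1} ?e" by (simp add: mgf_def)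
  have "?F (n + m) \<le> integral {0..1} (\<lambda>x. exp A * ?F n * ?e x)"
    unfolding F by (intro integral_le i integrable_on_mult_right)
      (use transfer_iter_mgf_le(1)[OF q A] in \<open>auto intro!: mult_right_mono\<close>)
  hence 1: "?F (n + m) \<le> exp A * ?F n * ?F m" by (simp add: Fm)
  have "integral {0..1} (\<lambda>x. ?F n * ?e x) \<le> integral {0..1} (\<lambda>x. exp A * (?f x * ?e x))"
    by (intro integral_le i integrable_on_mult_right)
      (use transfer_iter_mgf_le(2)[OF q A] in \<open>auto intro!: mult_right_mono simp flip: mult.assoc\<close>)
  hence 2: "?F n * ?F m \<le> exp A * ?F (n + m)" by (simp add: F Fm)
  have pos: "0 < ?F n" for n by (rule mgf_bounds)
  have "ln (?F (n + m)) \<le> ln (exp A * ?F n * ?F m)" "ln (?F n * ?F m) \<le> ln (exp A * ?F (n + m))"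
    using 1 2 pos by (subst ln_le_cancel_iff; simp)+
  moreover have "?F n \<noteq> 0" for n using pos[of n] by simp
  ultimately show ?thesis by (simp add: ln_mult abs_le_iff)
qed

text \<open>This is the topological pressure of \<theta> g under x \<mapsto> q x modulo 1, minus log
  q, which the factor 1 / q in \<open>transfer_op\<close> subtracts.\<close>

definition pressure :: "nat \<Rightarrow> real \<Rightarrow> real" where
  "pressure q \<theta> = lim (\<lambda>n. ln (mgf q n \<theta>) / real n)"

text \<open>Iterating the hypothesis gives |a (n m) - m a n| \<le> (m + 1) A. Comparing a n and a m
  through a (n m) yields the Cauchy property, and letting m tend to infinity yields the rate A /
  n.\<close>

lemma almost_additive_limit:
  fixes a :: "nat \<Rightarrow> real"
  assumes "\<And>n m. \<bar>a (n + m) - a n - a m\<bar> \<le> A"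
  shows "convergent (\<lambda>n. a n / real n)" and "0 < n \<Longrightarrow> \<bar>lim (\<lambda>n. a n / real n) - a n / real n\<bar> \<le> A / real n"
proof -
  have A0: "0 \<le> A" using assms[of 0 0] by linarith
  have mult: "\<bar>a (n * m) - real m * a n\<bar> \<le> real m * A + A" for n m
  proof (induction m)
    case 0
    show ?case using assms[of 0 0] by simp
  next
    case (Suc m)
    show ?case using assms[of n "n * m"] Suc by (simp add: algebra_simps)
  qed
  have diff: "\<bar>a n / real n - a m / real m\<bar> \<le> 2 * A / real n + 2 * A / real m" if "0 < n" "0 < m" for n m
  proof -
    have "\<bar>real m * a n - real n * a m\<bar> \<le> real m * A + A + (real n * A + A)"
      using mult[of n m] mult[of m n] by (simp add: mult.commute abs_le_iff)
    also have "\<dots> \<le> 2 * A * real m + 2 * A * real n"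
      using that A0 mult_right_mono[of 1 "real m" A] mult_right_mono[of 1 "real n" A] by (simp add: algebra_simps)
    finally have "\<bar>real m * a n - real n * a m\<bar> / (real n * real m) \<le> (2 * A * real m + 2 * A * real n) / (real n * real m)"
      by (intro divide_right_mono) auto
    also have "(2 * A * real m + 2 * A * real n) / (real n * real m) = 2 * A / real n + 2 * A / real m"
      using that by (simp add: field_simps)
    also have "\<bar>real m * a n - real n * a m\<bar> / (real n * real m) = \<bar>(real m * a n - real n * a m) / (real n * real m)\<bar>"
      by simp
    also have "(real m * a n - real n * a m) / (real n * real m) = a n / real n - a m / real m"
      using that by (simp add: field_simps)
    finally show ?thesis .
  qed
  have "Cauchy (\<lambda>n. a n / real n)"
  proof (rule metric_CauchyI)
    fix e :: real assume e: "0 < e"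
    obtain N where N: "real N > 4 * A / e" using reals_Archimedean2 by blast
    have "dist (a m / real m) (a n / real n) < e" if "m \<ge> Suc N" "n \<ge> Suc N" for m n
    proof -
      have *: "2 * A / real n < e / 2" if "n \<ge> Suc N" for n
      proof -
        have "4 * A / e < real n" using N that by linarith
        thus ?thesis using e that by (simp add: field_simps)
      qed
      show ?thesis using diff[of m n] *[OF that(1)] *[OF that(2)] that by (simp add: dist_real_def)
    qed
    thus "\<exists>M. \<forall>m\<ge>M. \<forall>n\<ge>M. dist (a m / real m) (a n / real n) < e" by blast
  qed
  thus conv: "convergent (\<lambda>n. a n / real n)" by (simp add: Cauchy_convergent_iff)
  hence lim: "(\<lambda>n. a n / real n) \<longlonglongrightarrow> lim (\<lambda>n. a n / real n)" by (simp add: convergent_LIMSEQ_iff)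
  assume n: "0 < n"
  have sub: "strict_mono (\<lambda>m. n * Suc m)" using n by (auto simp: strict_mono_def)
  have "(\<lambda>m. a (n * Suc m) / real (n * Suc m) - a n / real n) \<longlonglongrightarrow> lim (\<lambda>n. a n / real n) - a n / real n"
    using LIMSEQ_subseq_LIMSEQ[OF lim sub] by (intro tendsto_diff) (auto simp: o_def)
  hence l1: "(\<lambda>m. \<bar>a (n * Suc m) / real (n * Suc m) - a n / real n\<bar>) \<longlonglongrightarrow> \<bar>lim (\<lambda>n. a n / real n) - a n / real n\<bar>"
    by (rule tendsto_rabs)
  have l2: "(\<lambda>m. A / real n + A / real n * (1 / real (Suc m))) \<longlonglongrightarrow> A / real n + A / real n * 0"
    using LIMSEQ_Suc[OF lim_inverse_n'] by (intro tendsto_intros)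
  have "\<bar>a (n * Suc m) / real (n * Suc m) - a n / real n\<bar> \<le> A / real n + A / real n * (1 / real (Suc m))" for m
  proof -
    have "a (n * Suc m) / real (n * Suc m) - a n / real n = (a (n * Suc m) - real (Suc m) * a n) / real (n * Suc m)"
      using n by (simp add: diff_divide_distrib del: of_nat_Suc mult_Suc_right)
    hence "\<bar>a (n * Suc m) / real (n * Suc m) - a n / real n\<bar> = \<bar>a (n * Suc m) - real (Suc m) * a n\<bar> / real (n * Suc m)"
      by (simp only: abs_divide abs_of_nat)
    also have "\<dots> \<le> (real (Suc m) * A + A) / real (n * Suc m)"
      by (intro divide_right_mono mult) auto
    also have "\<dots> = A / real n + A / real n * (1 / real (Suc m))"
    proof -
      have "(M * A + A) / (real n * M) = A / real n + A / real n * (1 / M)" if "0 < M" for M :: real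
        using n that by (simp add: field_simps)
      thus ?thesis unfolding of_nat_mult by simp
    qed
    finally show ?thesis .
  qed
  with LIMSEQ_le[OF l1 l2] show "\<bar>lim (\<lambda>n. a n / real n) - a n / real n\<bar> \<le> A / real n" by auto
qed

text \<open>The smallest admissible A: the first inequality is an equality.\<close>

lemma distortion_constant:
  assumes "2 \<le> q" and "A = 2 * pi * \<bar>\<theta>\<bar> / (real q - 1)"
  shows "2 * pi * \<bar>\<theta>\<bar> + A \<le> A * real q" and "0 \<le> A"
proof -
  have "A * (real q - 1) = 2 * pi * \<bar>\<theta>\<bar>" using assms by simp
  thus "2 * pi * \<bar>\<theta>\<bar> + A \<le> A * real q" by (simp add: algebra_simps)
  show "0 \<le> A" using assms by simp
qed

lemma pressure_limit:
  assumes q: "2 \<le> q"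
  shows "(\<lambda>n. ln (mgf q n \<theta>) / real n) \<longlonglongrightarrow> pressure q \<theta>"
proof -
  have "0 < q" using q by simp
  from almost_additive_limit(1)[of "\<lambda>n. ln (mgf q n \<theta>)", OF ln_mgf_almost_additive[OF this distortion_constant[OF q refl]]]
  show ?thesis by (simp add: pressure_def convergent_LIMSEQ_iff)
qed

text \<open>The rate A / n at n = 1. For (ii) it matters that the bound is linear in |\<theta>| with
  a factor tending to 0 as q grows, so that linear growth of log E exp (\<theta> S_1) absorbs
  it.\<close>

lemma pressure_bound:
  assumes q: "2 \<le> q"
  shows "\<bar>pressure q \<theta> - ln (mgf q 1 \<theta>)\<bar> \<le> 2 * pi * \<bar>\<theta>\<bar> / (real q - 1)"
proof -
  have "0 < q" using q by simp
  from almost_additive_limit(2)[of "\<lambda>n. ln (mgf q n \<theta>)", OF ln_mgf_almost_additive[OF this distortion_constant[OF q refl]], of 1]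
  show ?thesis by (simp add: pressure_def)
qed

lemma integral_gcos: "integral {0..1} gcos = 0"
proof -
  have "(gcos has_integral (sin (2 * pi * 1) / (2 * pi) - sin (2 * pi * 0) / (2 * pi))) {0..1}"
    unfolding gcos_def[abs_def]
    by (rule fundamental_theorem_of_calculus)
       (auto intro!: derivative_eq_intros simp flip: has_real_derivative_iff_has_vector_derivative)
  thus ?thesis by (simp add: integral_unique)
qed

lemma integral_birkhoff_sum:
  assumes "0 < q"
  shows "integral {0..1} (birkhoff_sum q n) = 0"
proof -
  have "integral {0..1} (\<lambda>x. gcos (real q ^ k * x)) = 0" for k
    using integral_dilation[of gcos "q ^ k"] assms integral_gcos
    by (simp add: continuous_on_gcos[OF continuous_on_id])
  thus ?thesis unfolding birkhoff_sum_def[abs_def]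
    by (subst integral_sum) (auto intro!: integrable_continuous_real continuous_on_gcos continuous_intros)
qed

text \<open>From exp y \<ge> 1 + y, since Birkhoff sums have mean zero.\<close>

lemma mgf_ge_1:
  fixes \<theta> :: real
  assumes "0 < q"
  shows "1 \<le> mgf q n \<theta>"
proof -
  have i: "birkhoff_sum q n integrable_on {0..1}"
    by (intro integrable_continuous_real continuous_on_birkhoff_sum[OF continuous_on_id])
  have "integral {0..1} (\<lambda>x. 1 + \<theta> * birkhoff_sum q n x) \<le> mgf q n \<theta>"
    unfolding mgf_def
    by (intro integral_le integrable_continuous_real continuous_intros) simp
  also have "integral {0..1} (\<lambda>x. 1 + \<theta> * birkhoff_sum q n x) = 1 + \<theta> * integral {0..1} (birkhoff_sum q n)"
    using i by (subst integral_add) (auto intro!: integrable_on_mult_right)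
  finally show ?thesis using integral_birkhoff_sum[OF assms] by simp
qed

lemma mgf_0 [simp]: "mgf q n 0 = 1"
  by (simp add: mgf_def)

text \<open>Hoelder's inequality: with each exponential divided by its integral, pointwise convexity
  of exp integrates to the bound 1.\<close>

lemma convex_ln_mgf: "convex_on UNIV (\<lambda>\<theta>. ln (mgf q n \<theta>))"
proof (rule convex_onI)
  fix t a b :: real assume t: "0 < t" "t < 1"
  define F where "F \<theta> = mgf q n \<theta>" for \<theta> :: real
  define L where "L = (1 - t) * ln (F a) + t * ln (F b)"
  have pos: "0 < F \<theta>" for \<theta> by (simp add: F_def mgf_bounds)
  have i: "(\<lambda>x. exp (\<theta> * birkhoff_sum q n x) / c) integrable_on {0..1}" for \<theta> c
    by (intro integrable_continuous_real) (auto simp: divide_inverse intro!: continuous_intros)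
  have F: "F \<theta> = integral {0..1} (\<lambda>x. exp (\<theta> * birkhoff_sum q n x))" for \<theta>
    by (simp add: F_def mgf_def)
  have "integral {0..1} (\<lambda>x. exp (((1 - t) * a + t * b) * birkhoff_sum q n x) / exp L)
     \<le> integral {0..1} (\<lambda>x. (1 - t) * (exp (a * birkhoff_sum q n x) / F a) + t * (exp (b * birkhoff_sum q n x) / F b))"
  proof (intro integral_le i integrable_add integrable_on_mult_right)
    fix x
    let ?S = "birkhoff_sum q n x"
    have "exp (((1 - t) * a + t * b) * ?S) / exp L = exp ((1 - t) * (a * ?S - ln (F a)) + t * (b * ?S - ln (F b)))"
      by (simp add: L_def algebra_simps flip: exp_diff)
    also have "\<dots> \<le> (1 - t) * exp (a * ?S - ln (F a)) + t * exp (b * ?S - ln (F b))"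
      using convex_onD[OF exp_convex, of t "a * ?S - ln (F a)" "b * ?S - ln (F b)"] t by simp
    also have "\<dots> = (1 - t) * (exp (a * ?S) / F a) + t * (exp (b * ?S) / F b)"
      using pos by (simp add: exp_diff)
    finally show "exp (((1 - t) * a + t * b) * ?S) / exp L \<le> \<dots>" .
  qed
  also have "\<dots> = (1 - t) * (F a / F a) + t * (F b / F b)"
    using i[of a "F a"] i[of b "F b"]
    by (subst integral_add) (auto intro!: integrable_on_mult_right simp: F simp del: times_divide_eq_right)
  also have "\<dots> = 1" using pos[of a] pos[of b] by simp
  also have "integral {0..1} (\<lambda>x. exp (((1 - t) * a + t * b) * birkhoff_sum q n x) / exp L) = F ((1 - t) * a + t * b) / exp L"
    by (simp add: F)
  finally have "F ((1 - t) * a + t * b) \<le> exp L" by simp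
  hence "ln (F ((1 - t) * a + t * b)) \<le> L"
    using pos by (metis ln_exp ln_le_cancel_iff exp_gt_zero)
  thus "ln (mgf q n ((1 - t) *\<^sub>R a + t *\<^sub>R b)) \<le> (1 - t) * ln (mgf q n a) + t * ln (mgf q n b)"
    by (simp add: L_def F_def)
qed simp

lemma convex_pressure:
  assumes q: "2 \<le> q"
  shows "convex_on UNIV (pressure q)"
proof (rule convex_onI)
  fix t a b :: real assume t: "0 < t" "t < 1"
  note lim = pressure_limit[OF q]
  have "ln (mgf q n ((1 - t) * a + t * b)) / real n \<le> (1 - t) * (ln (mgf q n a) / real n) + t * (ln (mgf q n b) / real n)" for n
  proof -
    have "ln (mgf q n ((1 - t) * a + t * b)) / real n \<le> ((1 - t) * ln (mgf q n a) + t * ln (mgf q n b)) / real n"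
      using convex_onD[OF convex_ln_mgf, of t a b q n] t by (intro divide_right_mono) auto
    thus ?thesis by (simp add: add_divide_distrib)
  qed
  hence "pressure q ((1 - t) * a + t * b) \<le> (1 - t) * pressure q a + t * pressure q b"
    by (intro LIMSEQ_le[OF lim tendsto_add[OF tendsto_mult[OF tendsto_const lim] tendsto_mult[OF tendsto_const lim]]]) auto
  thus "pressure q ((1 - t) *\<^sub>R a + t *\<^sub>R b) \<le> (1 - t) * pressure q a + t * pressure q b" by simp
qed simp

lemma pressure_simple_bounds:
  assumes q: "2 \<le> q"
  shows "0 \<le> pressure q \<theta>" and "pressure q \<theta> \<le> \<bar>\<theta>\<bar>" and "pressure q 0 = 0"
proof -
  note lim = pressure_limit[OF q]
  show "0 \<le> pressure q \<theta>"
    by (rule LIMSEQ_le_const[OF lim]) (use mgf_ge_1[of q] q in auto)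
  have "ln (mgf q n \<theta>) / real n \<le> \<bar>\<theta>\<bar>" if "n \<ge> 1" for n
  proof -
    have "ln (mgf q n \<theta>) \<le> ln (exp (\<bar>\<theta>\<bar> * real n))"
      using mgf_bounds[of q n \<theta>] by (subst ln_le_cancel_iff) auto
    thus ?thesis using that by (simp add: field_simps)
  qed
  thus "pressure q \<theta> \<le> \<bar>\<theta>\<bar>" by (intro LIMSEQ_le_const2[OF lim]) auto
  show "pressure q 0 = 0" by (simp add: pressure_def)
qed

section \<open>Zero-free region\<close>

lemma norm_cis_diff_le: "cmod (cis a - cis b) \<le> \<bar>a - b\<bar>"
proof -
  have "cis a - cis b = cis b * (cis (a - b) - 1)"
    by (simp add: algebra_simps cis_mult)
  hence "cmod (cis a - cis b) = cmod (exp (\<i> * of_real (a - b)) - 1)"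
    by (simp add: norm_mult cis_conv_exp)
  also have "\<dots> = 2 * \<bar>sin ((a - b) / 2)\<bar>"
    using dist_exp_i_1[of "a - b"] by simp
  also have "\<dots> \<le> 2 * \<bar>(a - b) / 2\<bar>"
    by (intro mult_left_mono abs_sin_x_le_abs_x) auto
  finally show ?thesis by simp
qed

text \<open>A coupling argument in the manner of Doeblin. The common part t r of the weights p and r
  is matched index by index at cost d; the remaining mass 1 - t of p is compared with the whole
  average of v at cost H.\<close>

lemma norm_weighted_average_diff_le:
  fixes p r :: "nat \<Rightarrow> real" and u v :: "nat \<Rightarrow> complex"
  assumes p: "(\<Sum>j<q. p j) = 1" and r: "(\<Sum>j<q. r j) = 1" "\<And>j. 0 \<le> r j"
    and pr: "\<And>j. t * r j \<le> p j" and t: "0 \<le> t"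
    and d: "\<And>j. j < q \<Longrightarrow> cmod (u j - v j) \<le> d"
    and H: "\<And>i j. i < q \<Longrightarrow> j < q \<Longrightarrow> cmod (u i - v j) \<le> H"
  shows "cmod ((\<Sum>j<q. of_real (p j) * u j) - (\<Sum>j<q. of_real (r j) * v j)) \<le> t * d + (1 - t) * H"
proof -
  define c where "c = (\<Sum>j<q. of_real (r j) * v j)"
  have uc: "cmod (u j - c) \<le> H" if "j < q" for j
  proof -
    have "u j - c = (\<Sum>i<q. of_real (r i) * (u j - v i))"
      using r(1) by (simp add: c_def right_diff_distrib sum_subtractf flip: sum_distrib_right of_real_sum)
    also have "cmod \<dots> \<le> (\<Sum>i<q. r i * H)"
      by (rule sum_norm_le) (use r(2) H that in \<open>auto simp: norm_mult intro!: mult_left_mono\<close>)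
    finally show ?thesis using r(1) by (simp flip: sum_distrib_right)
  qed
  have "(\<Sum>j<q. of_real (p j) * u j) - c =
      of_real t * (\<Sum>j<q. of_real (r j) * (u j - v j)) + (\<Sum>j<q. of_real (p j - t * r j) * (u j - c))"
  proof -
    have "(\<Sum>j<q. of_real (p j - t * r j) * (u j - c)) =
      (\<Sum>j<q. of_real (p j) * u j) - of_real t * (\<Sum>j<q. of_real (r j) * u j) - (\<Sum>j<q. of_real (p j - t * r j)) * c"
      by (simp add: algebra_simps sum_subtractf sum.distrib sum_distrib_left)
    also have "(\<Sum>j<q. complex_of_real (p j - t * r j)) = of_real (1 - t)"
      using p r(1) by (simp add: sum_subtractf flip: sum_distrib_left of_real_sum)
    finally show ?thesis by (simp add: c_def algebra_simps sum_subtractf)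
  qed
  also have "cmod \<dots> \<le> t * d + (1 - t) * H"
  proof (rule norm_triangle_le, rule add_mono)
    have "cmod (\<Sum>j<q. of_real (r j) * (u j - v j)) \<le> (\<Sum>j<q. r j * d)"
      by (rule sum_norm_le) (use r(2) d in \<open>auto simp: norm_mult intro!: mult_left_mono\<close>)
    thus "cmod (of_real t * (\<Sum>j<q. of_real (r j) * (u j - v j))) \<le> t * d"
      using t r(1) by (simp add: norm_mult mult_left_mono flip: sum_distrib_right)
    have "cmod (\<Sum>j<q. of_real (p j - t * r j) * (u j - c)) \<le> (\<Sum>j<q. (p j - t * r j) * H)"
    proof (rule sum_norm_le)
      fix j assume "j \<in> {..<q}"
      thus "cmod (of_real (p j - t * r j) * (u j - c)) \<le> (p j - t * r j) * H"
        unfolding norm_mult norm_of_real using pr[of j] uc[of j] by (intro mult_mono) auto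
    qed
    also have "(\<Sum>j<q. (p j - t * r j) * H) = (1 - t) * H"
      using p r(1) by (simp add: sum_subtractf flip: sum_distrib_right sum_distrib_left)
    finally show "cmod (\<Sum>j<q. of_real (p j - t * r j) * (u j - c)) \<le> (1 - t) * H" .
  qed
  finally show ?thesis by (simp add: c_def)
qed

text \<open>
  The Markov weights at points of distance \<open>s\<close> agree up to a factor \<open>exp (- C s)\<close>, and preimages have
  distance at most \<open>s / 2\<close>. So this inequality says that one step contracts the seminorm belonging to the
  modulus of continuity \<open>1 - exp (- 4 C s)\<close>, which is adapted to \<open>C\<close> to avoid passing to iterates.
\<close>

lemma contraction_rate:
  fixes C s :: real
  assumes s: "0 \<le> s" "s \<le> 1" and C: "0 \<le> C"
  shows "exp (- C * s) * (1 - exp (- 4 * C * (s / 2))) + (1 - exp (- C * s))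
    \<le> (1 - exp (- 3 * C) / 4) * (1 - exp (- 4 * C * s))"
proof -
  \<comment> \<open>In terms of \<open>v\<close> the claim is polynomial: 1 - v^4 exceeds the left
    hand side by v^3 (1 - v). As s \<le> 1 gives v^3 \<ge> exp (- 3 C), this excess pays for the
    term with exp (- 3 C).\<close>
  define v where "v = exp (- C * s)"
  have v: "0 < v" "v \<le> 1" using s C by (auto simp: v_def)
  have e: "exp (- 4 * C * (s / 2)) = v ^ 2" "exp (- 4 * C * s) = v ^ 4"
    unfolding v_def by (simp_all add: algebra_simps flip: exp_of_nat_mult)
  have c: "exp (- 3 * C) \<le> v ^ 3"
    unfolding v_def using mult_left_mono[OF s(2), of "3 * C"] C by (simp add: algebra_simps flip: exp_of_nat_mult)
  have "exp (- 3 * C) / 4 * (1 - v ^ 4) \<le> v ^ 3 / 4 * (4 * (1 - v))"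
  proof (rule mult_mono)
    have "1 - v ^ 4 = (1 + v + v ^ 2 + v ^ 3) * (1 - v)" by algebra
    also have "\<dots> \<le> 4 * (1 - v)"
      using v power_le_one[of v 2] power_le_one[of v 3] by (intro mult_right_mono) linarith+
    finally show "1 - v ^ 4 \<le> 4 * (1 - v)" .
    show "0 \<le> 1 - v ^ 4" using v power_le_one[of v 4] by simp
  qed (use c v in auto)
  hence "v * (1 - v ^ 2) + (1 - v) \<le> (1 - exp (- 3 * C) / 4) * (1 - v ^ 4)"
    by (simp add: algebra_simps power2_eq_square power3_eq_cube power4_eq_xxxx)
  thus ?thesis by (simp only: e flip: v_def)
qed

text \<open>This is \<open>\<delta>\<^sup>2 / (8 \<pi>)\<close> with \<open>\<delta> = exp (- 3 C) / 16\<close> a quarter of the contraction gap and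
  \<open>C = 4 \<pi> (1 + \<bar>\<theta>\<bar>)\<close>.\<close>

definition zero_free_width :: "real \<Rightarrow> real" where
  "zero_free_width \<theta> = exp (- 24 * pi * (1 + \<bar>\<theta>\<bar>)) / (2048 * pi)"

text \<open>Let u be the quotient of the complex by the real iterate. The invariant
  \<open>inv\<close> bounds its oscillation, measured by \<phi>, by \<delta> |u 0|. Passing to n +
  1, the twist cis (\<eta> g) raises the factor \<delta> to \<delta> + \<delta>^2, the Markov
  average multiplies it by 1 - 4 \<delta>, and |u 0| shrinks at most by the factor 1 - \<delta> -
  \<delta>^2. Hence the complex iterate is u 0 times the positive real iterate up to a relative
  error \<delta> < 1, and its integral cannot vanish.\<close>

lemma mgf_nonzero:
  assumes q: "2 \<le> q" and Im: "\<bar>Im z\<bar> \<le> zero_free_width (Re z)"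
  shows "mgf q n z \<noteq> 0"
proof -
  define \<theta> \<eta> where "\<theta> = Re z" and "\<eta> = Im z"
  \<comment> \<open>This A is admissible for the distortion bound for every q \<ge> 2, and 1 +
    |\<theta>| in place of |\<theta>| keeps it at least 1. C is doubled because numerator and
    denominator of a Markov weight are each distorted by exp (A s).\<close>
  define A C where "A = 2 * pi * (1 + \<bar>\<theta>\<bar>)" and "C = 2 * A"
  define \<delta> where "\<delta> = exp (- 3 * C) / 16"
  define \<phi> where "\<phi> s = 1 - exp (- 4 * C * s)" for s
  have q0: "0 < q" and q2: "2 \<le> real q" using q by auto
  have A1: "1 \<le> A"
  proof -
    have "1 * 1 \<le> 2 * pi * (1 + \<bar>\<theta>\<bar>)" using pi_gt3 by (intro mult_mono) auto
    thus ?thesis by (simp add: A_def)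
  qed
  have A: "2 * pi * \<bar>\<theta>\<bar> + A \<le> A * real q" "0 \<le> A"
  proof -
    have "2 * pi * \<bar>\<theta>\<bar> + A \<le> A * 2" by (simp add: A_def algebra_simps)
    also have "\<dots> \<le> A * real q" using q2 A1 by (intro mult_left_mono) auto
    finally show "2 * pi * \<bar>\<theta>\<bar> + A \<le> A * real q" .
  qed (use A1 in auto)
  have C: "2 \<le> C" using A1 by (simp add: C_def)
  have \<delta>: "0 < \<delta>" "\<delta> \<le> 1 / 16"
    using C by (auto simp: \<delta>_def)
  have \<eta>: "8 * pi * \<bar>\<eta>\<bar> \<le> \<delta>\<^sup>2"
  proof -
    have "8 * pi * \<bar>\<eta>\<bar> \<le> 8 * pi * zero_free_width \<theta>"
      using Im by (intro mult_left_mono) (auto simp: \<theta>_def \<eta>_def)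
    also have "\<dots> = exp (- 6 * C) / 256"
      by (simp add: zero_free_width_def C_def A_def algebra_simps)
    also have "\<dots> = \<delta>\<^sup>2"
      by (simp add: \<delta>_def power_divide flip: exp_of_nat_mult)
    finally show ?thesis .
  qed
  let ?f = "transfer_iter q \<theta>"
  let ?x = "\<lambda>x j. (x + real j) / real q"
  define u where "u n x = transfer_iter q z n x / of_real (?f n x)" for n x
  \<comment> \<open>Dividing by the next real iterate turns the weights of the transfer operator
    into transition probabilities, which depend on n.\<close>
  define p where "p n x j = exp (\<theta> * gcos (?x x j)) * ?f n (?x x j) / (real q * ?f (Suc n) x)" for n x j
  define w where "w n y = cis (\<eta> * gcos y) * u n y" for n y
  have fpos: "0 < ?f n x" for n x by (rule transfer_iter_pos[OF q0])
  have \<phi>: "0 \<le> \<phi> s" "\<phi> s \<le> 1" if "0 \<le> s" for s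
    using that C by (auto simp: \<phi>_def)
  have inn: "?x x j \<in> {0..1}" if "x \<in> {0..1}" "j < q" for x j
  proof -
    have "real j + 1 \<le> real q" using that(2) by linarith
    thus ?thesis using that q0 by (auto simp: field_simps)
  qed
  have zero_in: "0 \<in> {0..1::real}" by simp
  have psum: "(\<Sum>j<q. p n x j) = 1" for n x
  proof -
    have "(\<Sum>j<q. p n x j) = (\<Sum>j<q. exp (\<theta> * gcos (?x x j)) * ?f n (?x x j)) / (real q * ?f (Suc n) x)"
      by (simp add: p_def sum_divide_distrib)
    also have "(\<Sum>j<q. exp (\<theta> * gcos (?x x j)) * ?f n (?x x j)) = real q * ?f (Suc n) x"
      using q0 by (simp add: transfer_op_def)
    finally show ?thesis using fpos[of "Suc n" x] q0 by simp
  qed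
  have ppos: "0 \<le> p n x j" for n x j
    unfolding p_def using fpos[of n "?x x j"] fpos[of "Suc n" x] by (intro divide_nonneg_nonneg mult_nonneg_nonneg) auto
  have pratio: "exp (- C * \<bar>x - y\<bar>) * p n y j \<le> p n x j" for n x y j
  proof -
    let ?E = "exp (A * \<bar>x - y\<bar>)"
    let ?a = "\<lambda>x. exp (\<theta> * gcos (?x x j)) * ?f n (?x x j)"
    have a: "?a y \<le> ?E * ?a x"
      using transfer_iter_distortion(2)[OF q0 A, of y j n x] by (simp add: abs_minus_commute)
    have b: "?f (Suc n) x \<le> ?E * ?f (Suc n) y"
      by (rule transfer_iter_distortion(1)[OF q0 A])
    have a0: "0 < ?a x" "0 < ?a y" using fpos by auto
    have "?a y * ?f (Suc n) x \<le> (?E * ?a x) * (?E * ?f (Suc n) y)"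
      by (intro mult_mono a b) (use a0 fpos[of "Suc n" x] in \<open>auto simp del: transfer_iter.simps\<close>)
    also have "\<dots> = exp (C * \<bar>x - y\<bar>) * (?a x * ?f (Suc n) y)"
    proof -
      have "?E * ?E = exp (C * \<bar>x - y\<bar>)"
        by (simp add: C_def flip: exp_add)
      moreover have "(?E * ?a x) * (?E * ?f (Suc n) y) = (?E * ?E) * (?a x * ?f (Suc n) y)"
        by (simp only: mult_ac)
      ultimately show ?thesis by (simp only:)
    qed
    finally have "?a y / ?f (Suc n) y \<le> exp (C * \<bar>x - y\<bar>) * (?a x / ?f (Suc n) x)"
      using fpos[of "Suc n" x] fpos[of "Suc n" y] by (simp add: field_simps del: transfer_iter.simps)
    hence "?a y / ?f (Suc n) y / real q \<le> exp (C * \<bar>x - y\<bar>) * (?a x / ?f (Suc n) x) / real q"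
      by (rule divide_right_mono) auto
    hence "p n y j \<le> exp (C * \<bar>x - y\<bar>) * p n x j"
      by (simp add: p_def mult.commute del: transfer_iter.simps)
    hence "exp (- C * \<bar>x - y\<bar>) * p n y j \<le> exp (- C * \<bar>x - y\<bar>) * (exp (C * \<bar>x - y\<bar>) * p n x j)"
      by (rule mult_left_mono) auto
    thus ?thesis by (simp add: mult.assoc[symmetric] flip: exp_add)
  qed
  have uSuc: "u (Suc n) x = (\<Sum>j<q. of_real (p n x j) * w n (?x x j))" for n x
  proof -
    have "of_real (p n x j) * w n (?x x j) = exp (z * of_real (gcos (?x x j))) * transfer_iter q z n (?x x j) /
       (of_nat q * of_real (?f (Suc n) x))" for j
    proof -
      have "exp (z * of_real (gcos (?x x j))) = of_real (exp (\<theta> * gcos (?x x j))) * cis (\<eta> * gcos (?x x j))"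
        by (simp add: exp_eq_polar \<theta>_def \<eta>_def)
      thus ?thesis using fpos[of n "?x x j"] by (simp add: p_def w_def u_def del: transfer_iter.simps)
    qed
    thus ?thesis unfolding u_def
      by (simp add: transfer_op_def scaleR_conv_of_real sum_divide_distrib divide_divide_eq_left)
  qed
  have inv: "u n 0 \<noteq> 0 \<and> (\<forall>x\<in>{0..1}. \<forall>y\<in>{0..1}. cmod (u n x - u n y) \<le> \<delta> * cmod (u n 0) * \<phi> \<bar>x - y\<bar>)" for n
  proof (induction n)
    case 0
    show ?case using \<phi> \<delta> by (auto simp: u_def)
  next
    case (Suc n)
    define m where "m = cmod (u n 0)"
    have m: "0 < m" using Suc by (simp add: m_def)
    have u_le: "cmod (u n x) \<le> 2 * m" if "x \<in> {0..1}" for x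
    proof -
      have "cmod (u n x - u n 0) \<le> \<delta> * m * \<phi> \<bar>x - 0\<bar>"
        using Suc that unfolding m_def by (metis atLeastAtMost_iff order_refl zero_le_one)
      also have "\<dots> \<le> 1 * m * 1" using \<phi>[of x] that \<delta> m by (intro mult_mono) auto
      finally show ?thesis using norm_triangle_sub[of "u n x" "u n 0"] by (simp add: m_def)
    qed
    \<comment> \<open>The twist has Lipschitz constant 2 pi |\<eta>|, and |u| \<le> 2 m and s \<le>
      2 \<phi> s on the unit interval. The product 8 pi |\<eta>| is at most \<delta>^2 by the choice
      of the width.\<close>
    have wdiff: "cmod (w n x - w n y) \<le> (\<delta> + \<delta>\<^sup>2) * m * \<phi> \<bar>x - y\<bar>" if "x \<in> {0..1}" "y \<in> {0..1}" for x y
    proof -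
      let ?s = "\<bar>x - y\<bar>"
      have s: "0 \<le> ?s" "?s \<le> 1" using that by auto
      have "?s \<le> 2 * \<phi> ?s"
      proof -
        have "exp (- 4 * C * ?s) \<le> exp (- ?s)"
          using mult_right_mono[of 1 "4 * C" ?s] C by simp
        also have "\<dots> \<le> 1 / (1 + ?s)"
          using exp_ge_add_one_self[of ?s] s unfolding exp_minus inverse_eq_divide by (intro divide_left_mono) auto
        also have "\<dots> \<le> 1 - ?s / 2"
        proof -
          have "?s * ?s \<le> ?s * 1" using s by (intro mult_left_mono)
          thus ?thesis using s by (simp add: field_simps)
        qed
        finally show ?thesis by (simp add: \<phi>_def)
      qed
      have "w n x - w n y = cis (\<eta> * gcos x) * (u n x - u n y) + (cis (\<eta> * gcos x) - cis (\<eta> * gcos y)) * u n y"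
        by (simp add: w_def algebra_simps)
      also have "cmod \<dots> \<le> cmod (u n x - u n y) + \<bar>\<eta> * gcos x - \<eta> * gcos y\<bar> * (2 * m)"
        by (rule norm_triangle_le, rule add_mono)
           (auto simp: norm_mult intro!: mult_mono norm_cis_diff_le u_le that)
      also have "\<bar>\<eta> * gcos x - \<eta> * gcos y\<bar> = \<bar>\<eta>\<bar> * \<bar>gcos x - gcos y\<bar>"
        by (simp add: abs_mult flip: right_diff_distrib)
      also have "\<bar>\<eta>\<bar> * \<bar>gcos x - gcos y\<bar> * (2 * m) \<le> \<bar>\<eta>\<bar> * (2 * pi * (2 * \<phi> ?s)) * (2 * m)"
        using gcos_lipschitz[of x y] \<open>?s \<le> 2 * \<phi> ?s\<close> m
        by (intro mult_right_mono mult_left_mono order.trans[OF gcos_lipschitz]) auto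
      also have "\<dots> = (8 * pi * \<bar>\<eta>\<bar>) * (m * \<phi> ?s)" by simp
      also have "\<dots> \<le> \<delta>\<^sup>2 * (m * \<phi> ?s)"
        using \<eta> m \<phi>[of ?s] by (intro mult_right_mono) auto
      also have "cmod (u n x - u n y) \<le> \<delta> * m * \<phi> ?s" using Suc that by (simp add: m_def)
      finally show ?thesis by (simp add: algebra_simps)
    qed
    define H where "H = (\<delta> + \<delta>\<^sup>2) * m"
    have H0: "0 \<le> H" using m \<delta> by (simp add: H_def)
    have wH: "cmod (w n x - w n y) \<le> H" if "x \<in> {0..1}" "y \<in> {0..1}" for x y
    proof -
      have "cmod (w n x - w n y) \<le> H * \<phi> \<bar>x - y\<bar>" using wdiff[OF that] by (simp add: H_def)
      also have "\<dots> \<le> H * 1" using \<phi> H0 by (intro mult_left_mono) auto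
      finally show ?thesis by simp
    qed
    have contr: "cmod (u (Suc n) x - u (Suc n) y) \<le> (1 - 4 * \<delta>) * H * \<phi> \<bar>x - y\<bar>" if "x \<in> {0..1}" "y \<in> {0..1}" for x y
    proof -
      let ?s = "\<bar>x - y\<bar>" let ?t = "exp (- C * ?s)"
      have s: "0 \<le> ?s" "?s \<le> 1" using that by auto
      have "cmod (u (Suc n) x - u (Suc n) y) \<le> ?t * (H * \<phi> (?s / 2)) + (1 - ?t) * H"
        unfolding uSuc
      proof (rule norm_weighted_average_diff_le[OF psum psum ppos pratio])
        fix j assume j: "j < q"
        have d: "\<bar>?x x j - ?x y j\<bar> = ?s / real q"
          by (simp flip: diff_divide_distrib)
        have "cmod (w n (?x x j) - w n (?x y j)) \<le> H * \<phi> (?s / real q)"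
          using wdiff[OF inn[OF that(1) j] inn[OF that(2) j]] unfolding d H_def .
        also have "\<dots> \<le> H * \<phi> (?s / 2)"
        proof (rule mult_left_mono[OF _ H0])
          have "?s / real q \<le> ?s / 2" using q2 s by (intro divide_left_mono) auto
          hence "4 * C * (?s / real q) \<le> 4 * C * (?s / 2)" using C by (intro mult_left_mono) auto
          thus "\<phi> (?s / real q) \<le> \<phi> (?s / 2)" unfolding \<phi>_def by simp
        qed
        finally show "cmod (w n (?x x j) - w n (?x y j)) \<le> H * \<phi> (?s / 2)" .
      qed (use wH inn that in auto)
      also have "\<dots> = H * (?t * \<phi> (?s / 2) + (1 - ?t))" by (simp add: algebra_simps)
      also have "\<dots> \<le> H * ((1 - 4 * \<delta>) * \<phi> ?s)"
        using contraction_rate[OF s, of C] C H0 unfolding \<phi>_def \<delta>_def by (intro mult_left_mono) auto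
      finally show ?thesis by (simp add: mult_ac)
    qed
    \<comment> \<open>The twist preserves the modulus at 0, and an average of values of w differs
      from w n 0 by at most the oscillation H.\<close>
    have low: "(1 - \<delta> - \<delta>\<^sup>2) * m \<le> cmod (u (Suc n) 0)"
    proof -
      have "u (Suc n) 0 - w n 0 = (\<Sum>j<q. of_real (p n 0 j) * (w n (?x 0 j) - w n 0))"
        using psum[of n 0] by (simp add: uSuc right_diff_distrib sum_subtractf flip: sum_distrib_right of_real_sum)
      also have "cmod \<dots> \<le> (\<Sum>j<q. p n 0 j * H)"
        by (rule sum_norm_le) (use ppos wH inn[of 0] in \<open>auto simp: norm_mult intro!: mult_left_mono\<close>)
      finally have "cmod (u (Suc n) 0 - w n 0) \<le> H" using psum by (simp flip: sum_distrib_right)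
      moreover have "cmod (w n 0) = m" by (simp add: w_def m_def norm_mult)
      ultimately show ?thesis
        using norm_triangle_sub[of "w n 0" "u (Suc n) 0"] by (simp add: norm_minus_commute H_def algebra_simps)
    qed
    have d2: "\<delta>\<^sup>2 \<le> \<delta>" using \<delta> by (simp add: power2_eq_square mult_left_le)
    have "0 < (1 - \<delta> - \<delta>\<^sup>2) * m" using \<delta> d2 m by (intro mult_pos_pos) linarith+
    hence "u (Suc n) 0 \<noteq> 0" using low by auto
    moreover have "cmod (u (Suc n) x - u (Suc n) y) \<le> \<delta> * cmod (u (Suc n) 0) * \<phi> \<bar>x - y\<bar>"
      if "x \<in> {0..1}" "y \<in> {0..1}" for x y
    proof -
      \<comment> \<open>To first order, the contraction 4 \<delta> outweighs the growth \<delta>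
        from the twist plus the relative loss \<delta> of the value at 0.\<close>
      have "(1 - 4 * \<delta>) * H = \<delta> * (1 - 3 * \<delta> - 4 * \<delta>\<^sup>2) * m"
        unfolding H_def by (simp add: algebra_simps power2_eq_square)
      also have "\<dots> \<le> \<delta> * (1 - \<delta> - \<delta>\<^sup>2) * m"
        using \<delta> m by (intro mult_right_mono mult_left_mono) auto
      also have "\<dots> \<le> \<delta> * cmod (u (Suc n) 0)"
        using low \<delta> by (simp add: mult.assoc)
      finally have "(1 - 4 * \<delta>) * H * \<phi> \<bar>x - y\<bar> \<le> \<delta> * cmod (u (Suc n) 0) * \<phi> \<bar>x - y\<bar>"
        using \<phi> by (intro mult_right_mono) auto
      thus ?thesis using contr[OF that] by linarith
    qed
    ultimately show ?case by blast
  qed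
  have i: "?f n integrable_on {0..1}"
    by (intro integrable_continuous_real continuous_on_transfer_iter)
  have i': "transfer_iter q z n integrable_on {0..1}"
    by (intro integrable_continuous_real continuous_on_transfer_iter)
  have le: "cmod (transfer_iter q z n x - u n 0 * of_real (?f n x)) \<le> \<delta> * cmod (u n 0) * ?f n x" if "x \<in> {0..1}" for x
  proof -
    have "transfer_iter q z n x - u n 0 * of_real (?f n x) = (u n x - u n 0) * of_real (?f n x)"
      using fpos[of n x] by (simp add: u_def algebra_simps)
    also have "cmod \<dots> \<le> \<delta> * cmod (u n 0) * \<phi> \<bar>x - 0\<bar> * ?f n x"
    proof -
      have "cmod (u n x - u n 0) \<le> \<delta> * cmod (u n 0) * \<phi> \<bar>x - 0\<bar>"
        using inv[of n] that zero_in by blast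
      thus ?thesis using fpos[of n x] by (simp add: norm_mult mult_right_mono)
    qed
    also have "\<dots> \<le> \<delta> * cmod (u n 0) * 1 * ?f n x"
      using \<phi>[of x] that fpos[of n x] \<delta> by (intro mult_right_mono mult_left_mono) auto
    finally show ?thesis by simp
  qed
  have ic: "(\<lambda>x. complex_of_real (?f n x)) integrable_on {0..1}"
    using integrable_linear[OF i bounded_linear_of_real] by (simp add: o_def)
  have "cmod (integral {0..1} (\<lambda>x. transfer_iter q z n x - u n 0 * of_real (?f n x))) \<le>
     integral {0..1} (\<lambda>x. \<delta> * cmod (u n 0) * ?f n x)"
    by (intro integral_norm_bound_integral integrable_diff i' ic integrable_on_mult_right i le)
  also have "\<dots> = \<delta> * cmod (u n 0) * mgf q n \<theta>"
    by (simp add: mgf_eq_integral[OF q0])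
  also have "integral {0..1} (\<lambda>x. transfer_iter q z n x - u n 0 * of_real (?f n x)) = mgf q n z - u n 0 * of_real (mgf q n \<theta>)"
  proof -
    have "integral {0..1} (\<lambda>x. complex_of_real (?f n x)) = of_real (mgf q n \<theta>)"
      using integral_linear[OF i bounded_linear_of_real[where 'a = complex]] by (simp add: o_def mgf_eq_integral[OF q0])
    thus ?thesis using i' ic
      by (subst integral_diff) (auto intro!: integrable_on_mult_right simp: mgf_eq_integral[OF q0])
  qed
  finally have fin: "cmod (mgf q n z - u n 0 * of_real (mgf q n \<theta>)) \<le> \<delta> * cmod (u n 0) * mgf q n \<theta>" .
  show ?thesis
  proof
    assume "mgf q n z = 0"
    with fin have "1 * (cmod (u n 0) * mgf q n \<theta>) \<le> \<delta> * (cmod (u n 0) * mgf q n \<theta>)"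
      using mgf_bounds(2)[of q n \<theta>] by (simp add: norm_mult)
    moreover have "0 < cmod (u n 0) * mgf q n \<theta>" using inv[of n] mgf_bounds(2)[of q n \<theta>] by simp
    ultimately show False using \<delta> by (simp only: mult_le_cancel_right) auto
  qed
qed

section \<open>Analyticity of the limit\<close>

lemma mgf_holomorphic: "(\<lambda>z. mgf q n z) holomorphic_on A"
proof -
  have "(\<lambda>z. integral (cbox 0 1) (\<lambda>x. exp (z * of_real (birkhoff_sum q n x)))) holomorphic_on UNIV"
  proof (rule leibniz_rule_holomorphic)
    fix z :: complex and t :: real
    show "((\<lambda>z. exp (z * of_real (birkhoff_sum q n t))) has_field_derivative
       of_real (birkhoff_sum q n t) * exp (z * of_real (birkhoff_sum q n t))) (at z within UNIV)"
      by (auto intro!: derivative_eq_intros)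
    show "(\<lambda>x. exp (z * of_real (birkhoff_sum q n x))) integrable_on cbox 0 1"
      unfolding cbox_interval by (intro integrable_continuous_real continuous_intros)
    show "continuous_on (UNIV \<times> cbox 0 1)
        (\<lambda>(z, t). complex_of_real (birkhoff_sum q n t) * exp (z * of_real (birkhoff_sum q n t)))"
    proof -
      have "continuous_on UNIV (birkhoff_sum q n)" by (intro continuous_on_birkhoff_sum continuous_on_id)
      hence *: "continuous_on (UNIV \<times> cbox 0 1) (\<lambda>p :: complex \<times> real. birkhoff_sum q n (snd p))"
        by (rule continuous_on_compose2) (auto intro: continuous_on_snd continuous_on_id)
      show ?thesis unfolding case_prod_unfold by (intro continuous_intros *)
    qed
  qed auto
  thus ?thesis unfolding mgf_def cbox_interval using holomorphic_on_subset by blast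
qed

definition zero_free_strip :: "complex set" where
  "zero_free_strip = {z. \<bar>Im z\<bar> < zero_free_width (Re z)}"

lemma zero_free_width_pos: "0 < zero_free_width \<theta>"
  by (simp add: zero_free_width_def)

lemma open_zero_free_strip: "open zero_free_strip"
  unfolding zero_free_strip_def zero_free_width_def
  by (intro open_Collect_less continuous_intros) auto

lemma of_real_in_zero_free_strip: "of_real x \<in> zero_free_strip"
  by (simp add: zero_free_strip_def zero_free_width_pos)

text \<open>The width decreases in |Re z|, so shrinking z towards 0 stays inside. Starlikeness
  yields both connectedness, for the identity theorem, and contractibility, for logarithms.\<close>

lemma starlike_zero_free_strip: "starlike zero_free_strip"
  unfolding starlike_def
proof (intro bexI ballI subsetI)
  show "0 \<in> zero_free_strip" using of_real_in_zero_free_strip[of 0] by simp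
  fix z w assume z: "z \<in> zero_free_strip" and "w \<in> closed_segment 0 z"
  then obtain t where t: "0 \<le> t" "t \<le> 1" and w: "w = t *\<^sub>R z"
    by (auto simp: closed_segment_def)
  have le: "zero_free_width (Re z) \<le> zero_free_width (t * Re z)"
  proof -
    have "\<bar>t * Re z\<bar> \<le> \<bar>Re z\<bar>" using t by (simp add: abs_mult mult_left_le_one_le)
    hence "- 24 * pi * (1 + \<bar>Re z\<bar>) \<le> - 24 * pi * (1 + \<bar>t * Re z\<bar>)" by simp
    thus ?thesis unfolding zero_free_width_def by (intro divide_right_mono) auto
  qed
  have "\<bar>t * Im z\<bar> \<le> \<bar>Im z\<bar>" using t by (simp add: abs_mult mult_left_le_one_le)
  also have "\<dots> < zero_free_width (Re z)" using z by (simp add: zero_free_strip_def)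
  finally show "w \<in> zero_free_strip" using le by (simp add: w zero_free_strip_def)
qed

lemma connected_zero_free_strip: "connected zero_free_strip"
  using starlike_imp_connected[OF starlike_zero_free_strip] .

text \<open>Some holomorphic logarithm exists on a contractible domain. On the real axis it differs
  from the real logarithm by a continuous function with values in 2 pi i times the integers, hence
  by a constant, which is subtracted.\<close>

lemma log_branch_exists:
  assumes hol: "F holomorphic_on S" and S: "starlike S" "range complex_of_real \<subseteq> S"
    and nz: "\<And>z. z \<in> S \<Longrightarrow> F z \<noteq> 0"
    and real: "\<And>x::real. F (of_real x) = of_real (f x)" "\<And>x. 0 < f x"
  obtains L where "L holomorphic_on S" "\<And>z. z \<in> S \<Longrightarrow> exp (L z) = F z"
    "\<And>x::real. L (of_real x) = of_real (ln (f x))"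
proof -
  obtain g where g: "g holomorphic_on S" "\<And>z. z \<in> S \<Longrightarrow> F z = exp (g z)"
    using contractible_imp_holomorphic_log[OF hol starlike_imp_contractible[OF S(1)] nz] by metis
  define h where "h x = g (of_real x) - of_real (ln (f x))" for x :: real
  have inS: "of_real x \<in> S" for x using S(2) by blast
  have contof: "continuous_on UNIV (\<lambda>x::real. G (complex_of_real x))" if "continuous_on S G" for G :: "complex \<Rightarrow> complex"
    by (rule continuous_on_compose2[OF that]) (use inS in \<open>auto intro!: continuous_intros\<close>)
  have f_eq: "f x = Re (F (of_real x))" for x by (simp add: real)
  have contf: "continuous_on UNIV f"
    unfolding f_eq[abs_def] by (intro continuous_intros contof holomorphic_on_imp_continuous_on hol)
  have exph: "exp (h x) = 1" for x
    using real(2)[of x] g(2)[OF inS, of x] real(1)[of x]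
    by (simp add: h_def exp_diff exp_of_real exp_minus)
  have "h constant_on UNIV"
  proof (rule continuous_discrete_range_constant)
    show "continuous_on UNIV h" unfolding h_def[abs_def]
      using contf real(2) by (intro continuous_intros contof holomorphic_on_imp_continuous_on g) (auto simp: less_imp_neq[symmetric])
    fix x
    show "\<exists>e>0. \<forall>y. y \<in> UNIV \<and> h y \<noteq> h x \<longrightarrow> e \<le> cmod (h y - h x)"
    proof (intro exI[of _ "2 * pi"] conjI allI impI)
      fix y assume y: "y \<in> UNIV \<and> h y \<noteq> h x"
      have "exp (h y - h x) = 1" by (simp add: exp_diff exph)
      then obtain n :: int where n: "Re (h y - h x) = 0" "Im (h y - h x) = of_int (2 * n) * pi"
        unfolding exp_eq_1 by blast
      have "n \<noteq> 0" using n y by (auto simp: complex_eq_iff)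
      hence "1 \<le> \<bar>real_of_int n\<bar>" by linarith
      hence "2 * pi * 1 \<le> 2 * pi * \<bar>real_of_int n\<bar>" by (intro mult_left_mono) auto
      also have "\<dots> = \<bar>Im (h y - h x)\<bar>" unfolding n(2) by (simp add: abs_mult)
      also have "\<dots> \<le> cmod (h y - h x)" by (rule abs_Im_le_cmod)
      finally show "2 * pi \<le> cmod (h y - h x)" by simp
    qed simp
  qed simp
  then obtain c where c: "\<And>x. h x = c" by (auto simp: constant_on_def)
  have "exp c = 1" using exph[of 0] c by simp
  show thesis
  proof
    show "(\<lambda>z. g z - c) holomorphic_on S" by (intro holomorphic_intros g)
    show "exp (g z - c) = F z" if "z \<in> S" for z
      using g(2)[OF that] \<open>exp c = 1\<close> by (simp add: exp_diff)
    show "g (of_real x) - c = of_real (ln (f x))" for x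
      using c[of x] by (simp add: h_def algebra_simps)
  qed
qed

text \<open>Vitali's theorem for functions whose real parts are bounded on one side only: the functions
  \<open>1 / (B - h n)\<close> form a normal family.\<close>

lemma holomorphic_limit_from_reals:
  fixes h :: "nat \<Rightarrow> complex \<Rightarrow> complex" and l :: "real \<Rightarrow> real"
  assumes S: "open S" "connected S" "range complex_of_real \<subseteq> S"
    and h: "\<And>n. h n holomorphic_on S" and B: "B holomorphic_on S"
    and Re: "\<And>n z. z \<in> S \<Longrightarrow> Re (h n z) + 1 \<le> Re (B z)"
    and lim: "\<And>x. (\<lambda>n. h n (of_real x)) \<longlonglongrightarrow> of_real (l x)"
  obtains g where "g holomorphic_on S" "\<And>x. g (of_real x) = of_real (l x)"
    "\<And>K. compact K \<Longrightarrow> K \<subseteq> S \<Longrightarrow> uniform_limit K h g sequentially"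
proof -
  define k where "k n z = inverse (B z - h n z)" for n z
  have nz: "1 \<le> cmod (B z - h n z)" if "z \<in> S" for n z
    using Re[OF that, of n] complex_Re_le_cmod[of "B z - h n z"] by simp
  have nz': "B z - h n z \<noteq> 0" if "z \<in> S" for n z
    using nz[OF that, of n] by auto
  have k_hol: "k n holomorphic_on S" for n
    unfolding k_def[abs_def] by (intro holomorphic_intros h B) (use nz' in auto)
  have k_le: "cmod (k n z) \<le> 1" if "z \<in> S" for n z
    using nz[OF that, of n] unfolding k_def norm_inverse by (rule inverse_le_1_iff[THEN iffD2, OF disjI2])
  have inS: "of_real x \<in> S" for x using S(3) by blast
  define kr where "kr x = inverse (B (of_real x) - of_real (l x))" for x :: real
  have Bl: "B (of_real x) - of_real (l x) \<noteq> 0" for x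
  proof -
    have "(\<lambda>n. Re (h n (of_real x))) \<longlonglongrightarrow> Re (of_real (l x))" by (intro tendsto_Re lim)
    hence "Re (of_real (l x)) \<le> Re (B (of_real x)) - 1"
      by (rule LIMSEQ_le_const2) (use Re[OF inS] in \<open>auto simp: le_diff_eq\<close>)
    thus ?thesis by (auto simp: complex_eq_iff)
  qed
  have k_lim: "(\<lambda>n. k n (of_real x)) \<longlonglongrightarrow> kr x" for x
    unfolding k_def kr_def by (intro tendsto_intros lim Bl)
  \<comment> \<open>Stated for arbitrary subsequences \<open>k \<circ> s\<close>, in order to
    upgrade convergence of one subsequence to convergence of the whole sequence.\<close>
  have montel: "\<exists>g r. g holomorphic_on S \<and> strict_mono (r :: nat \<Rightarrow> nat) \<and>
     (\<forall>K. compact K \<and> K \<subseteq> S \<longrightarrow> uniform_limit K (k \<circ> s \<circ> r) g sequentially) \<and> (\<forall>x. g (of_real x) = kr x)"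
    if s: "strict_mono s" for s :: "nat \<Rightarrow> nat"
  proof -
    obtain g r where g: "g holomorphic_on S" "strict_mono (r :: nat \<Rightarrow> nat)"
       "\<And>x. x \<in> S \<Longrightarrow> (\<lambda>n. (k \<circ> s) (r n) x) \<longlonglongrightarrow> g x"
       "\<And>K. compact K \<Longrightarrow> K \<subseteq> S \<Longrightarrow> uniform_limit K ((k \<circ> s) \<circ> r) g sequentially"
    proof (rule Montel[OF S(1), of "range k" "k \<circ> s"])
      show "\<And>K. compact K \<Longrightarrow> K \<subseteq> S \<Longrightarrow> \<exists>B. \<forall>h\<in>range k. \<forall>z\<in>K. cmod (h z) \<le> B"
        using k_le by (intro exI[of _ 1]) blast
    qed (use k_hol in auto)
    have "g (of_real x) = kr x" for x
    proof (rule LIMSEQ_unique[OF g(3)[OF inS]])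
      show "(\<lambda>n. (k \<circ> s) (r n) (of_real x)) \<longlonglongrightarrow> kr x"
        using LIMSEQ_subseq_LIMSEQ[OF k_lim strict_mono_o[OF s g(2)]] by (simp add: o_def)
    qed
    thus ?thesis using g by blast
  qed
  have uniq: "g z = g' z" if "g holomorphic_on S" "g' holomorphic_on S" "\<And>x::real. g (of_real x) = g' (of_real x)" "z \<in> S" for g g' z
  proof -
    have "g z - g' z = 0"
    proof (rule analytic_continuation[where f = "\<lambda>z. g z - g' z" and U = "range complex_of_real" and \<xi> = 0])
      show "(\<lambda>z. g z - g' z) holomorphic_on S" by (intro holomorphic_intros that)
      show "(0::complex) islimpt range complex_of_real"
        unfolding islimpt_approachable
      proof safe
        fix e :: real assume "0 < e"
        thus "\<exists>x'\<in>range complex_of_real. x' \<noteq> 0 \<and> dist x' 0 < e"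
          by (intro bexI[OF _ rangeI[of complex_of_real "e / 2"]]) auto
      qed
    qed (use S inS[of 0] that in auto)
    thus ?thesis by simp
  qed
  obtain \<kappa> r where \<kappa>: "\<kappa> holomorphic_on S" "strict_mono (r :: nat \<Rightarrow> nat)"
      "\<And>K. compact K \<Longrightarrow> K \<subseteq> S \<Longrightarrow> uniform_limit K (k \<circ> r) \<kappa> sequentially" "\<And>x. \<kappa> (of_real x) = kr x"
    using montel[of id] by (auto simp: strict_mono_def)
  \<comment> \<open>A subsequence staying away from \<kappa> on K would have a convergent further
    subsequence, whose limit agrees with \<kappa> on the real axis and therefore everywhere.\<close>
  have k_unif: "uniform_limit K k \<kappa> sequentially" if K: "compact K" "K \<subseteq> S" for K
  proof (rule ccontr)
    assume "\<not> uniform_limit K k \<kappa> sequentially"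
    then obtain e where e: "e > 0" "\<not> (\<forall>\<^sub>F n in sequentially. \<forall>x\<in>K. dist (k n x) (\<kappa> x) < e)"
      unfolding uniform_limit_iff by blast
    hence inf: "infinite {n. \<not> (\<forall>x\<in>K. dist (k n x) (\<kappa> x) < e)}" (is "infinite ?N")
      unfolding eventually_cofinite[symmetric] cofinite_eq_sequentially by blast
    define s where "s = enumerate ?N"
    have s: "strict_mono s" unfolding s_def by (rule strict_mono_enumerate[OF inf])
    have sN: "\<not> (\<forall>x\<in>K. dist (k (s n) x) (\<kappa> x) < e)" for n
      using enumerate_in_set[OF inf, of n] by (simp add: s_def)
    obtain g r' where g: "g holomorphic_on S" "strict_mono (r' :: nat \<Rightarrow> nat)"
      "\<forall>K. compact K \<and> K \<subseteq> S \<longrightarrow> uniform_limit K (k \<circ> s \<circ> r') g sequentially"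
      "\<forall>x. g (of_real x) = kr x"
      using montel[OF s] by (elim exE conjE)
    have g3: "uniform_limit K (k \<circ> s \<circ> r') g sequentially" using g(3) K by blast
    have geq: "g z = \<kappa> z" if "z \<in> K" for z
    proof (rule uniq[OF g(1) \<kappa>(1)])
      show "g (of_real x) = \<kappa> (of_real x)" for x using g(4) \<kappa>(4) by simp
    qed (use K(2) that in blast)
    obtain n where "\<forall>x\<in>K. dist ((k \<circ> s \<circ> r') n x) (g x) < e"
      using eventually_happens'[OF sequentially_bot uniform_limitD[OF g3 e(1)]] ..
    hence "\<forall>x\<in>K. dist (k (s (r' n)) x) (\<kappa> x) < e" by (simp add: geq)
    with sN[of "r' n"] show False by simp
  qed
  \<comment> \<open>The reciprocal can be undone only where the limit has no zeros. Hurwitz's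
    theorem excludes them for a nonconstant limit; a constant limit equals \<open>kr 0\<close>, the
    inverse of a nonzero number.\<close>
  have \<kappa>_nz: "\<kappa> z \<noteq> 0" if z: "z \<in> S" for z
  proof (cases "\<kappa> constant_on S")
    case True
    then obtain c where "\<And>z. z \<in> S \<Longrightarrow> \<kappa> z = c" by (auto simp: constant_on_def)
    hence "\<kappa> z = kr 0" using z inS[of 0] \<kappa>(4)[of 0] by metis
    thus ?thesis using Bl[of 0] by (simp add: kr_def)
  next
    case False
    show ?thesis
      by (rule Hurwitz_no_zeros[OF S(1,2) k_hol \<kappa>(1) k_unif False _ z]) (use nz' in \<open>auto simp: k_def\<close>)
  qed
  show thesis
  proof
    show "(\<lambda>z. B z - inverse (\<kappa> z)) holomorphic_on S"
      by (intro holomorphic_intros B \<kappa>(1) \<kappa>_nz)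
    show "B (of_real x) - inverse (\<kappa> (of_real x)) = of_real (l x)" for x
      using Bl[of x] by (simp add: \<kappa>(4) kr_def)
    fix K assume K: "compact K" "K \<subseteq> S"
    show "uniform_limit K h (\<lambda>z. B z - inverse (\<kappa> z)) sequentially"
    proof (cases "K = {}")
      case False
      have "continuous_on K (\<lambda>z. cmod (\<kappa> z))"
        using \<kappa>(1) K(2) by (intro continuous_intros holomorphic_on_imp_continuous_on) (rule holomorphic_on_subset)
      then obtain z0 where z0: "z0 \<in> K" "\<And>z. z \<in> K \<Longrightarrow> cmod (\<kappa> z0) \<le> cmod (\<kappa> z)"
        using continuous_attains_inf[OF K(1) False] by blast
      have "uniform_limit K (\<lambda>n z. inverse (k n z)) (inverse \<circ> \<kappa>) sequentially"
        by (rule uniform_lim_inverse[OF k_unif[OF K], of "cmod (\<kappa> z0)"]) (use z0 \<kappa>_nz K(2) in auto)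
      hence "uniform_limit K (\<lambda>n z. B z - inverse (k n z)) (\<lambda>z. B z - inverse (\<kappa> z)) sequentially"
        unfolding o_def by (intro uniform_limit_intros)
      thus ?thesis by (simp add: k_def)
    qed auto
  qed
qed

lemma complex_pressure:
  assumes q: "2 \<le> q"
  obtains L \<Lambda> where
    "\<And>n. L n holomorphic_on zero_free_strip" "\<And>n z. z \<in> zero_free_strip \<Longrightarrow> exp (L n z) = mgf q n z"
    "\<And>n x. L n (complex_of_real x) = of_real (ln (mgf q n x))"
    "\<Lambda> holomorphic_on zero_free_strip" "\<And>x. \<Lambda> (complex_of_real x) = of_real (pressure q x)"
    "\<And>K. compact K \<Longrightarrow> K \<subseteq> zero_free_strip \<Longrightarrow> uniform_limit K (\<lambda>n z. L n z / of_nat n) \<Lambda> sequentially"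
proof -
  note S = open_zero_free_strip connected_zero_free_strip
  have R: "range complex_of_real \<subseteq> zero_free_strip" using of_real_in_zero_free_strip by blast
  have "\<exists>L. L holomorphic_on zero_free_strip \<and> (\<forall>z\<in>zero_free_strip. exp (L z) = mgf q n z) \<and>
     (\<forall>x. L (complex_of_real x) = of_real (ln (mgf q n x)))" for n
  proof (rule log_branch_exists[OF mgf_holomorphic starlike_zero_free_strip R])
    show "mgf q n z \<noteq> 0" if "z \<in> zero_free_strip" for z
      using mgf_nonzero[OF q] that by (simp add: zero_free_strip_def)
  qed (use mgf_of_real mgf_bounds in auto)
  then obtain L where L: "\<And>n. L n holomorphic_on zero_free_strip" "\<And>n z. z \<in> zero_free_strip \<Longrightarrow> exp (L n z) = mgf q n z"
    "\<And>n x. L n (complex_of_real x) = of_real (ln (mgf q n x))" by metis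
  have Re_le: "Re (L n z / of_nat n) \<le> \<bar>Re z\<bar>" if z: "z \<in> zero_free_strip" for n z
  proof (cases "n = 0")
    case False
    have "cmod (mgf q n z) \<le> mgf q n (Re z)"
      unfolding mgf_def
    proof (rule integral_norm_bound_integral)
      show "cmod (exp (z * of_real (birkhoff_sum q n x))) \<le> exp (Re z * of_real (birkhoff_sum q n x))" for x
        by (simp add: norm_exp_eq_Re)
    qed (intro integrable_continuous_real continuous_intros)+
    also have "\<dots> \<le> exp (\<bar>Re z\<bar> * real n)" by (rule mgf_bounds)
    finally have "exp (Re (L n z)) \<le> exp (\<bar>Re z\<bar> * real n)"
      using L(2)[OF z, of n] by (simp flip: norm_exp_eq_Re)
    thus ?thesis using False by (simp add: field_simps)
  qed simp
  have width: "zero_free_width x \<le> 1" for x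
  proof -
    have "exp (- 24 * pi * (1 + \<bar>x\<bar>)) \<le> exp 0" unfolding exp_le_cancel_iff by simp
    moreover have "1 \<le> 2048 * pi" using pi_gt3 by simp
    ultimately have "exp (- 24 * pi * (1 + \<bar>x\<bar>)) \<le> 2048 * pi" unfolding exp_zero by linarith
    thus ?thesis unfolding zero_free_width_def by (subst divide_le_eq_1_pos) auto
  qed
  obtain \<Lambda> where "\<Lambda> holomorphic_on zero_free_strip" "\<And>x. \<Lambda> (complex_of_real x) = of_real (pressure q x)"
    "\<And>K. compact K \<Longrightarrow> K \<subseteq> zero_free_strip \<Longrightarrow> uniform_limit K (\<lambda>n z. L n z / of_nat n) \<Lambda> sequentially"
  \<comment> \<open>The holomorphic majorant must exceed |Re z| + 1 in real part. On the strip |Im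
    z| \<le> 1, so Re (z^2 + 3) \<ge> (Re z)^2 + 2 \<ge> |Re z| + 1.\<close>
  proof (rule holomorphic_limit_from_reals[OF S R, of "\<lambda>n z. L n z / of_nat n" "\<lambda>z. z\<^sup>2 + 3" "pressure q"])
    fix n
    show "(\<lambda>z. L n z / of_nat n) holomorphic_on zero_free_strip"
      by (cases "n = 0") (auto intro!: holomorphic_intros L)
    fix z assume z: "z \<in> zero_free_strip"
    have "\<bar>Im z\<bar> \<le> 1" using z width[of "Re z"] by (simp add: zero_free_strip_def)
    hence "(Im z)\<^sup>2 \<le> 1" by (simp add: abs_square_le_1)
    moreover have "\<bar>Re z\<bar> \<le> (Re z)\<^sup>2 + 1"
    proof -
      have "0 \<le> (\<bar>Re z\<bar> - 1)\<^sup>2" by simp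
      hence "2 * \<bar>Re z\<bar> \<le> (Re z)\<^sup>2 + 1" by (simp add: power2_diff)
      thus ?thesis using abs_ge_zero[of "Re z"] by linarith
    qed
    ultimately show "Re (L n z / of_nat n) + 1 \<le> Re (z\<^sup>2 + 3)"
      using Re_le[OF z, of n] by (simp add: power2_eq_square)
  next
    fix x :: real
    have "(\<lambda>n. complex_of_real (ln (mgf q n x) / real n)) \<longlonglongrightarrow> of_real (pressure q x)"
      by (intro tendsto_of_real pressure_limit q)
    thus "(\<lambda>n. L n (of_real x) / of_nat n) \<longlonglongrightarrow> of_real (pressure q x)"
      by (simp add: L(3))
  qed (auto intro!: holomorphic_intros)
  thus thesis using that L by blast
qed

section \<open>The Gaertner-Ellis theorem\<close>

lemma legendre_transform_ge: "ereal (\<theta> * x - \<Lambda> \<theta>) \<le> legendre_transform \<Lambda> x"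
  unfolding legendre_transform_def by (rule SUP_upper) simp

lemma legendre_transform_nonneg:
  assumes "\<Lambda> 0 = 0"
  shows "0 \<le> legendre_transform \<Lambda> x"
  using legendre_transform_ge[of 0 x \<Lambda>] assms by (simp add: zero_ereal_def)

lemma lower_semicontinuous_legendre_transform: "lower_semicontinuous (legendre_transform \<Lambda>)"
  unfolding lower_semicontinuous_def
proof (intro allI)
  fix x
  show "legendre_transform \<Lambda> x \<le> Liminf (at x) (legendre_transform \<Lambda>)"
    unfolding le_Liminf_iff
  proof (intro allI impI)
    fix y assume "y < legendre_transform \<Lambda> x"
    then obtain \<theta> where \<theta>: "y < ereal (\<theta> * x - \<Lambda> \<theta>)"
      unfolding legendre_transform_def less_SUP_iff by auto
    have "((\<lambda>x. ereal (\<theta> * x - \<Lambda> \<theta>)) \<longlongrightarrow> ereal (\<theta> * x - \<Lambda> \<theta>)) (at x)"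
      by (intro tendsto_intros)
    from order_tendstoD(1)[OF this \<theta>]
    show "\<forall>\<^sub>F x in at x. y < legendre_transform \<Lambda> x"
      by eventually_elim (use legendre_transform_ge less_le_trans in blast)
  qed
qed

text \<open>Differentiability of \<Lambda> on the whole line supplies the tilts for the lower bound.
  Nonnegativity together with \<Lambda> 0 = 0, which reflects centred sums, places a zero of the
  rate function at 0; both bounds are organised around this point.\<close>

locale gaertner_ellis = prob_space M for M :: "'a measure" +
  fixes S :: "nat \<Rightarrow> 'a \<Rightarrow> real" and \<Lambda> :: "real \<Rightarrow> real"
  assumes S_measurable [measurable]: "\<And>n. S n \<in> borel_measurable M"
    and S_bound: "\<And>n \<omega>. \<bar>S n \<omega>\<bar> \<le> real n"
    and limit: "\<And>\<theta>. (\<lambda>n. cgf M (S n) \<theta> / real n) \<longlonglongrightarrow> \<Lambda> \<theta>"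
    and nonneg: "\<And>\<theta>. 0 \<le> \<Lambda> \<theta>" and at_0: "\<Lambda> 0 = 0"
    and diff: "\<And>\<theta>. \<exists>D. (\<Lambda> has_real_derivative D) (at \<theta>)"
begin

definition E :: "nat \<Rightarrow> real \<Rightarrow> real" where
  "E n \<theta> = (\<integral>\<omega>. exp (\<theta> * S n \<omega>) \<partial>M)"

lemma exp_S_le: "exp (\<theta> * S n \<omega>) \<le> exp (\<bar>\<theta>\<bar> * real n)"
proof -
  have "\<theta> * S n \<omega> \<le> \<bar>\<theta>\<bar> * \<bar>S n \<omega>\<bar>" by (simp flip: abs_mult)
  also have "\<dots> \<le> \<bar>\<theta>\<bar> * real n" by (intro mult_left_mono S_bound) auto
  finally show ?thesis by simp
qed

lemma integrable_exp_S: "integrable M (\<lambda>\<omega>. exp (\<theta> * S n \<omega>))"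
  by (rule integrable_const_bound[of _ "exp (\<bar>\<theta>\<bar> * real n)"]) (use exp_S_le in auto)

lemma integrable_indicator_exp_S:
  assumes "X \<in> sets M"
  shows "integrable M (\<lambda>\<omega>. indicator X \<omega> * exp (\<theta> * S n \<omega>))"
  by (rule integrable_real_mult_indicator[OF assms integrable_exp_S, simplified mult.commute])

lemma E_pos: "0 < E n \<theta>"
proof -
  have "exp (- (\<bar>\<theta>\<bar> * real n)) \<le> exp (\<theta> * S n \<omega>)" for \<omega>
    using exp_S_le[of "- \<theta>" n \<omega>] by (simp add: exp_minus field_simps)
  hence "(\<integral>\<omega>. exp (- (\<bar>\<theta>\<bar> * real n)) \<partial>M) \<le> E n \<theta>"
    unfolding E_def by (intro integral_mono integrable_exp_S) auto
  thus ?thesis using exp_gt_zero[of "- (\<bar>\<theta>\<bar> * real n)"] by (simp add: prob_space del: exp_gt_zero)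
qed

lemma E_eq: "0 < n \<Longrightarrow> E n \<theta> = exp (real n * (cgf M (S n) \<theta> / real n))"
  using E_pos[of n \<theta>] by (simp add: cgf_def E_def)

text \<open>The exponential Chebyshev inequality for the unnormalised tilted measure. For \<theta> =
  0 it gives the upper bound; for general \<theta> it gives the concentration behind the lower
  bound.\<close>

lemma tilted_Chernoff:
  assumes X: "X \<in> sets M" and le: "\<And>\<omega>. \<omega> \<in> X \<Longrightarrow> t * b \<le> t * S n \<omega>"
  shows "(\<integral>\<omega>. indicator X \<omega> * exp (\<theta> * S n \<omega>) \<partial>M) \<le> exp (- t * b) * E n (\<theta> + t)"
proof -
  have "(\<integral>\<omega>. indicator X \<omega> * exp (\<theta> * S n \<omega>) \<partial>M) \<le> (\<integral>\<omega>. exp (- t * b) * exp ((\<theta> + t) * S n \<omega>) \<partial>M)"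
  proof (intro integral_mono integrable_indicator_exp_S X integrable_mult_right integrable_exp_S)
    fix \<omega>
    have "exp (\<theta> * S n \<omega>) \<le> exp (- t * b) * exp ((\<theta> + t) * S n \<omega>)" if "\<omega> \<in> X"
      using le[OF that] by (simp add: algebra_simps flip: exp_add)
    thus "indicator X \<omega> * exp (\<theta> * S n \<omega>) \<le> exp (- t * b) * exp ((\<theta> + t) * S n \<omega>)"
      by (auto simp: indicator_def)
  qed
  thus ?thesis by (simp add: E_def)
qed

text \<open>A strictly better rate absorbs constants. A quarter is chosen because two one-sided
  tails are added and at least half of the mass has to remain.\<close>

lemma eventually_half_exp:
  fixes c c' :: real
  assumes "c < c'"
  shows "\<forall>\<^sub>F n in sequentially. exp (- real n * c') \<le> exp (- real n * c) / 4"
proof -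
  obtain N :: nat where N: "ln 4 / (c' - c) < real N" using reals_Archimedean2 by blast
  show ?thesis
  proof (rule eventually_sequentiallyI[of N])
    fix n assume "N \<le> n"
    hence "ln 4 / (c' - c) < real n" using N by linarith
    hence "ln 4 \<le> real n * (c' - c)" using assms by (simp add: field_simps)
    hence "- real n * c' \<le> - real n * c - ln 4" by (simp add: algebra_simps)
    hence "exp (- real n * c') \<le> exp (- real n * c - ln 4)" by (simp only: exp_le_cancel_iff)
    thus "exp (- real n * c') \<le> exp (- real n * c) / 4" by (simp add: exp_diff)
  qed
qed

lemma eventually_E_le:
  assumes "\<Lambda> \<theta> < v"
  shows "\<forall>\<^sub>F n in sequentially. E n \<theta> \<le> exp (real n * v)"
  using order_tendstoD(2)[OF limit assms] eventually_gt_at_top[of 0]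
proof eventually_elim
  case (elim n)
  have "real n * (cgf M (S n) \<theta> / real n) \<le> real n * v" using elim by (intro mult_left_mono) auto
  thus ?case by (simp only: E_eq[OF elim(2)] exp_le_cancel_iff)
qed

lemma eventually_E_ge:
  assumes "v < \<Lambda> \<theta>"
  shows "\<forall>\<^sub>F n in sequentially. exp (real n * v) \<le> E n \<theta>"
  using order_tendstoD(1)[OF limit assms] eventually_gt_at_top[of 0]
proof eventually_elim
  case (elim n)
  have "real n * v \<le> real n * (cgf M (S n) \<theta> / real n)" using elim by (intro mult_left_mono) auto
  thus ?case by (simp only: E_eq[OF elim(2)] exp_le_cancel_iff)
qed

text \<open>On one side of 0 the point b of C nearest to 0 decides. Since \<Lambda> \<ge> 0 and c >
  0, a \<theta> with \<theta> b - \<Lambda> \<theta> > c has the sign of b, so \<theta> x \<ge>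
  \<theta> b throughout C and a single exponential Chebyshev bound covers C without any compactness
  argument.\<close>

lemma upper_bound_one_side:
  fixes \<sigma> c :: real
  assumes \<sigma>: "\<sigma> = 1 \<or> \<sigma> = -1" and C: "closed C" and c: "0 < c" "\<And>x. x \<in> C \<Longrightarrow> ereal c < legendre_transform \<Lambda> x"
    and sgn: "\<And>x. x \<in> C \<Longrightarrow> 0 \<le> \<sigma> * x"
  shows "\<forall>\<^sub>F n in sequentially. prob {\<omega> \<in> space M. S n \<omega> / real n \<in> C} \<le> exp (- real n * c) / 4"
proof (cases "C = {}")
  case False
  obtain b where b: "b \<in> C" "\<And>x. x \<in> C \<Longrightarrow> \<bar>b\<bar> \<le> \<bar>x\<bar>"
    using distance_attains_inf[OF C False, of 0] by (auto simp: dist_real_def)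
  obtain \<theta> where \<theta>: "c < \<theta> * b - \<Lambda> \<theta>"
    using c(2)[OF b(1)] unfolding legendre_transform_def less_SUP_iff by auto
  have C_borel [measurable]: "C \<in> sets borel" using C by auto
  have ineq: "\<theta> * b \<le> \<theta> * x" if "x \<in> C" for x
  proof -
    have "0 < \<theta> * b" using \<theta> c(1) nonneg[of \<theta>] by linarith
    show ?thesis using \<sigma>
    proof
      assume "\<sigma> = 1"
      hence "b \<le> x" "0 \<le> b" using sgn[OF that] sgn[OF b(1)] b(2)[OF that] by auto
      moreover have "0 \<le> \<theta>" using \<open>0 < \<theta> * b\<close> \<open>0 \<le> b\<close> by (auto simp: zero_less_mult_iff)
      ultimately show ?thesis by (intro mult_left_mono)
    next
      assume "\<sigma> = -1"
      hence "x \<le> b" "b \<le> 0" using sgn[OF that] sgn[OF b(1)] b(2)[OF that] by auto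
      moreover have "\<theta> \<le> 0" using \<open>0 < \<theta> * b\<close> \<open>b \<le> 0\<close> by (auto simp: zero_less_mult_iff)
      ultimately show ?thesis by (intro mult_left_mono_neg)
    qed
  qed
  \<comment> \<open>The midpoint of \<Lambda> \<theta> and \<theta> b - c leaves room on both sides:
    for the convergence of the moment generating functions and for the factor 1/4.\<close>
  define v where "v = (\<theta> * b - c + \<Lambda> \<theta>) / 2"
  have v: "\<Lambda> \<theta> < v" "c < \<theta> * b - v" using \<theta> by (auto simp: v_def field_simps)
  show ?thesis
    using eventually_E_le[OF v(1)] eventually_half_exp[OF v(2)] eventually_gt_at_top[of 0]
  proof eventually_elim
    case (elim n)
    let ?X = "{\<omega> \<in> space M. S n \<omega> / real n \<in> C}"
    have X: "?X \<in> sets M" by measurable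
    have "prob ?X = (\<integral>\<omega>. indicator ?X \<omega> * exp (0 * S n \<omega>) \<partial>M)"
      using X by simp
    also have "\<dots> \<le> exp (- \<theta> * (real n * b)) * E n (0 + \<theta>)"
    proof (rule tilted_Chernoff[OF X])
      fix \<omega> assume "\<omega> \<in> ?X"
      hence "real n * (\<theta> * b) \<le> real n * (\<theta> * (S n \<omega> / real n))"
        by (intro mult_left_mono[OF ineq]) auto
      thus "\<theta> * (real n * b) \<le> \<theta> * S n \<omega>" using elim(3) by (simp add: mult_ac)
    qed
    also have "\<dots> \<le> exp (- \<theta> * (real n * b)) * exp (real n * v)"
      using elim(1) by (intro mult_left_mono) auto
    also have "\<dots> = exp (- real n * (\<theta> * b - v))" by (simp add: algebra_simps flip: exp_add)
    also have "\<dots> \<le> exp (- real n * c) / 4" by (rule elim(2))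
    finally show ?case .
  qed
qed simp

lemma upper_bound:
  assumes A: "A \<in> sets borel"
  shows "limsup (\<lambda>n. ereal (1 / real n) * log_prob (prob {\<omega> \<in> space M. S n \<omega> / real n \<in> A}))
     \<le> - (INF x\<in>closure A. legendre_transform \<Lambda> x)"
proof -
  let ?I = "legendre_transform \<Lambda>"
  let ?X = "\<lambda>n. {\<omega> \<in> space M. S n \<omega> / real n \<in> A}"
  let ?l = "\<lambda>n. ereal (1 / real n) * log_prob (prob (?X n))"
  note [measurable] = A
  have bound: "limsup ?l \<le> ereal (- c)" if c: "ereal c < (INF x\<in>closure A. ?I x)" for c
  proof -
    have ev: "\<forall>\<^sub>F n in sequentially. prob (?X n) \<le> exp (- real n * c)"
    proof (cases "c \<le> 0")
      case True
      have "prob (?X n) \<le> exp (- real n * c)" for n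
      proof -
        have "prob (?X n) \<le> 1" by simp
        also have "1 \<le> exp (- real n * c)" using True by (simp add: mult_nonneg_nonpos)
        finally show ?thesis .
      qed
      thus ?thesis by simp
    next
      case False
      have Ic: "ereal c < ?I x" if "x \<in> closure A" for x
        using c that by (meson INF_lower less_le_trans)
      \<comment> \<open>The closure is split at 0, where the sign of the tilt changes.\<close>
      have side: "\<forall>\<^sub>F n in sequentially. prob {\<omega> \<in> space M. S n \<omega> / real n \<in> closure A \<inter> {x. 0 \<le> \<sigma> * x}} \<le> exp (- real n * c) / 4"
        if "\<sigma> = 1 \<or> \<sigma> = -1" for \<sigma> :: real
      proof (rule upper_bound_one_side[OF that])
        show "closed (closure A \<inter> {x. 0 \<le> \<sigma> * x})"
          by (intro closed_Int closed_closure closed_Collect_le continuous_intros)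
      qed (use False Ic in auto)
      show ?thesis using side[OF disjI1[OF refl]] side[OF disjI2[OF refl]]
      proof eventually_elim
        case (elim n)
        let ?Y = "\<lambda>\<sigma>. {\<omega> \<in> space M. S n \<omega> / real n \<in> closure A \<inter> {x. 0 \<le> \<sigma> * x}}"
        have "closure A \<inter> {x. 0 \<le> \<sigma> * x} \<in> sets borel" for \<sigma> :: real
          by (intro borel_closed closed_Int closed_closure closed_Collect_le continuous_intros)
        hence Y: "?Y \<sigma> \<in> sets M" for \<sigma> :: real by measurable
        have "prob (?X n) \<le> prob (?Y 1 \<union> ?Y (-1))"
        proof (rule finite_measure_mono)
          show "?Y 1 \<union> ?Y (-1) \<in> sets M" by (intro sets.Un Y)
        qed (use closure_subset[of A] in auto)
        also have "\<dots> \<le> prob (?Y 1) + prob (?Y (-1))" by (rule measure_Un_le[OF Y Y])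
        also have "\<dots> \<le> exp (- real n * c)" using elim exp_gt_zero[of "- real n * c"] by linarith
        finally show ?case .
      qed
    qed
    show ?thesis
    proof (rule Limsup_bounded)
      show "\<forall>\<^sub>F n in sequentially. ?l n \<le> ereal (- c)"
        using ev eventually_gt_at_top[of 0]
      proof eventually_elim
        case (elim n)
        show ?case
        proof (cases "prob (?X n) = 0")
          case False
          hence p: "0 < prob (?X n)" by (simp add: zero_less_measure_iff)
          have "ln (prob (?X n)) \<le> ln (exp (- real n * c))"
            using elim p by (subst ln_le_cancel_iff) auto
          thus ?thesis using elim(2) False by (simp add: log_prob_def field_simps)
        qed (use elim(2) in \<open>simp add: log_prob_def\<close>)
      qed
    qed
  qed
  show ?thesis
  proof (rule ccontr)
    assume "\<not> limsup ?l \<le> - (INF x\<in>closure A. ?I x)"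
    hence "- limsup ?l < (INF x\<in>closure A. ?I x)" by (simp add: ereal_uminus_less_reorder)
    then obtain c where c: "- limsup ?l < ereal c" "ereal c < (INF x\<in>closure A. ?I x)"
      using ereal_dense2 by blast
    from bound[OF c(2)] c(1) show False by (simp add: ereal_uminus_less_reorder)
  qed
qed

text \<open>Cramer's change of measure. Under the density proportional to exp (\<theta> S n), the
  quotient S n / n concentrates at y = \<Lambda>'(\<theta>): a further small tilt t costs \<Lambda>
  (\<theta> + t) - \<Lambda> \<theta> - t y < |t| \<delta>, so each tail outside the \<delta>-ball
  carries at most a quarter of the mass. On the ball the density is exp (n \<theta> y) up to exp (n
  |\<theta>| \<delta>), so the original probability can be recovered.\<close>

lemma lower_bound_exposed:
  assumes A: "A \<in> sets borel" and y: "y \<in> interior A" and D: "(\<Lambda> has_real_derivative y) (at \<theta>)"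
  shows "ereal (\<Lambda> \<theta> - \<theta> * y) \<le> liminf (\<lambda>n. ereal (1 / real n) * log_prob (prob {\<omega> \<in> space M. S n \<omega> / real n \<in> A}))"
    (is "_ \<le> liminf ?l")
proof (rule ereal_le_epsilon2)
  fix \<epsilon> :: real assume \<epsilon>: "0 < \<epsilon>"
  note [measurable] = A
  obtain r where r: "0 < r" "ball y r \<subseteq> A" using y mem_interior by metis
  \<comment> \<open>Keeps the ball inside A and the variation |\<theta>| \<delta> of the exponent
    below \<epsilon> / 4; the summand 1 covers \<theta> = 0.\<close>
  define \<delta> where "\<delta> = min r (\<epsilon> / 4 / (1 + \<bar>\<theta>\<bar>))"
  have \<delta>: "0 < \<delta>" "\<delta> \<le> r" using r \<epsilon> by (auto simp: \<delta>_def)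
  have \<theta>\<delta>: "\<bar>\<theta>\<bar> * \<delta> \<le> \<epsilon> / 4"
  proof -
    have "\<bar>\<theta>\<bar> * \<delta> \<le> (1 + \<bar>\<theta>\<bar>) * (\<epsilon> / 4 / (1 + \<bar>\<theta>\<bar>))" using \<delta> \<epsilon> by (intro mult_mono) (auto simp: \<delta>_def)
    also have "\<dots> = \<epsilon> / 4"
    proof -
      have "a * (\<epsilon> / 4 / a) = \<epsilon> / 4" if "a \<noteq> 0" for a :: real using that by simp
      thus ?thesis by this linarith
    qed
    finally show ?thesis .
  qed
  define X where "X n = {\<omega> \<in> space M. \<bar>S n \<omega> / real n - y\<bar> < \<delta>}" for n
  define Y where "Y \<sigma> n = {\<omega> \<in> space M. \<delta> \<le> \<sigma> * (S n \<omega> / real n - y)}" for \<sigma> n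
  have X: "X n \<in> sets M" for n unfolding X_def by measurable
  have Y: "Y \<sigma> n \<in> sets M" for \<sigma> n unfolding Y_def by measurable
  have side: "\<forall>\<^sub>F n in sequentially. (\<integral>\<omega>. indicator (Y \<sigma> n) \<omega> * exp (\<theta> * S n \<omega>) \<partial>M) \<le> E n \<theta> / 4"
    if \<sigma>: "\<sigma> = 1 \<or> \<sigma> = -1" for \<sigma> :: real
  proof -
    have "((\<lambda>h. (\<Lambda> (\<theta> + h) - \<Lambda> \<theta>) / h) \<longlongrightarrow> y) (at 0)"
      using D by (simp add: DERIV_def)
    hence "\<forall>\<^sub>F h in at 0. \<bar>(\<Lambda> (\<theta> + h) - \<Lambda> \<theta>) / h - y\<bar> < \<delta>"
      using \<delta>(1) by (auto dest!: tendstoD simp: dist_real_def)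
    then obtain d where d: "0 < d" "\<And>h. h \<noteq> 0 \<Longrightarrow> \<bar>h\<bar> < d \<Longrightarrow> \<bar>(\<Lambda> (\<theta> + h) - \<Lambda> \<theta>) / h - y\<bar> < \<delta>"
      unfolding eventually_at by (auto simp: dist_real_def)
    \<comment> \<open>The extra tilt points towards the tail in question and is small enough for the
      difference quotient to be within \<delta> of y.\<close>
    define t where "t = \<sigma> * (d / 2)"
    have t: "t \<noteq> 0" "\<bar>t\<bar> < d" "t * \<sigma> = \<bar>t\<bar>" using d(1) \<sigma> by (auto simp: t_def)
    have "\<Lambda> (\<theta> + t) - \<Lambda> \<theta> - t * y = t * ((\<Lambda> (\<theta> + t) - \<Lambda> \<theta>) / t - y)"
      using t(1) by (simp add: field_simps)
    also have "\<dots> \<le> \<bar>t\<bar> * \<bar>(\<Lambda> (\<theta> + t) - \<Lambda> \<theta>) / t - y\<bar>"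
      unfolding abs_mult[symmetric] by (rule abs_ge_self)
    also have "\<dots> < \<bar>t\<bar> * \<delta>" using d(2)[OF t(1,2)] t(1) by (intro mult_strict_left_mono) auto
    finally have lt: "\<Lambda> (\<theta> + t) - \<Lambda> \<theta> - t * y < \<bar>t\<bar> * \<delta>" .
    \<comment> \<open>A quarter of the gap is spent on the numerator and a quarter on the
      denominator; the remaining half is the exponential rate of decay of the tail.\<close>
    define gap where "gap = \<bar>t\<bar> * \<delta> - (\<Lambda> (\<theta> + t) - \<Lambda> \<theta> - t * y)"
    have gap: "0 < gap" using lt by (simp add: gap_def)
    have ev1: "\<forall>\<^sub>F n in sequentially. E n (\<theta> + t) \<le> exp (real n * (\<Lambda> (\<theta> + t) + gap / 4))"
      by (rule eventually_E_le) (use gap in simp)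
    have ev2: "\<forall>\<^sub>F n in sequentially. exp (real n * (\<Lambda> \<theta> - gap / 4)) \<le> E n \<theta>"
      by (rule eventually_E_ge) (use gap in simp)
    have ev3: "\<forall>\<^sub>F n in sequentially. exp (- real n * (t * y + \<bar>t\<bar> * \<delta> - (\<Lambda> (\<theta> + t) + gap / 4)))
        \<le> exp (- real n * (- (\<Lambda> \<theta> - gap / 4))) / 4"
      by (rule eventually_half_exp) (use gap in \<open>simp add: gap_def field_simps\<close>)
    show ?thesis using ev1 ev2 ev3 eventually_gt_at_top[of 0]
    proof eventually_elim
      case (elim n)
      have "(\<integral>\<omega>. indicator (Y \<sigma> n) \<omega> * exp (\<theta> * S n \<omega>) \<partial>M) \<le> exp (- t * (real n * (y + \<sigma> * \<delta>))) * E n (\<theta> + t)"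
      proof (rule tilted_Chernoff[OF Y])
        fix \<omega> assume "\<omega> \<in> Y \<sigma> n"
        hence "\<bar>t\<bar> * \<delta> \<le> t * \<sigma> * (\<sigma> * (S n \<omega> / real n - y))" unfolding Y_def t(3) by (intro mult_left_mono) auto
        also have "\<dots> = t * (S n \<omega> / real n - y)" using \<sigma> by auto
        finally have "t * (y + \<sigma> * \<delta>) \<le> t * (S n \<omega> / real n)" using t(3) by (simp add: algebra_simps flip: mult.assoc)
        hence "real n * (t * (y + \<sigma> * \<delta>)) \<le> real n * (t * (S n \<omega> / real n))" by (rule mult_left_mono) simp
        thus "t * (real n * (y + \<sigma> * \<delta>)) \<le> t * S n \<omega>" using elim(4) by (simp add: mult_ac)
      qed
      also have "\<dots> \<le> exp (- t * (real n * (y + \<sigma> * \<delta>))) * exp (real n * (\<Lambda> (\<theta> + t) + gap / 4))"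
        using elim(1) by (intro mult_left_mono) auto
      also have "\<dots> = exp (- real n * (t * y + (t * \<sigma>) * \<delta> - (\<Lambda> (\<theta> + t) + gap / 4)))"
        by (simp add: algebra_simps flip: exp_add)
      also have "\<dots> \<le> exp (- real n * (- (\<Lambda> \<theta> - gap / 4))) / 4" using elim(3) unfolding t(3) .
      also have "\<dots> \<le> E n \<theta> / 4" using elim(2) by (simp add: algebra_simps)
      finally show ?case .
    qed
  qed
  have ev: "\<forall>\<^sub>F n in sequentially. exp (- real n * (\<theta> * y - \<Lambda> \<theta> + \<epsilon>)) \<le> prob {\<omega> \<in> space M. S n \<omega> / real n \<in> A}"
  proof -
    have ev1: "\<forall>\<^sub>F n in sequentially. exp (real n * (\<Lambda> \<theta> - \<epsilon> / 4)) \<le> E n \<theta>"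
      by (rule eventually_E_ge) (use \<epsilon> in simp)
    have ev2: "\<forall>\<^sub>F n in sequentially. exp (- real n * (\<theta> * y - \<Lambda> \<theta> + \<epsilon>)) \<le> exp (- real n * (\<theta> * y - \<Lambda> \<theta> + \<epsilon> / 2)) / 4"
      by (rule eventually_half_exp) (use \<epsilon> in simp)
    show ?thesis using side[OF disjI1[OF refl]] side[OF disjI2[OF refl]] ev1 ev2 eventually_gt_at_top[of 0]
    proof eventually_elim
      case (elim n)
      let ?J = "\<lambda>Z. (\<integral>\<omega>. indicator Z \<omega> * exp (\<theta> * S n \<omega>) \<partial>M)"
      have "E n \<theta> \<le> (\<integral>\<omega>. indicator (X n) \<omega> * exp (\<theta> * S n \<omega>) + indicator (Y 1 n) \<omega> * exp (\<theta> * S n \<omega>)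
           + indicator (Y (-1) n) \<omega> * exp (\<theta> * S n \<omega>) \<partial>M)"
        unfolding E_def
      proof (intro integral_mono integrable_exp_S Bochner_Integration.integrable_add integrable_indicator_exp_S X Y)
        fix \<omega> assume "\<omega> \<in> space M"
        hence "\<omega> \<in> X n \<or> \<omega> \<in> Y 1 n \<or> \<omega> \<in> Y (-1) n" unfolding X_def Y_def by auto
        thus "exp (\<theta> * S n \<omega>) \<le> indicator (X n) \<omega> * exp (\<theta> * S n \<omega>) + indicator (Y 1 n) \<omega> * exp (\<theta> * S n \<omega>)
           + indicator (Y (-1) n) \<omega> * exp (\<theta> * S n \<omega>)"
          by (auto simp: indicator_def)
      qed
      also have "\<dots> = ?J (X n) + ?J (Y 1 n) + ?J (Y (-1) n)"
        by (simp add: integrable_indicator_exp_S X Y)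
      finally have "E n \<theta> / 2 \<le> ?J (X n)" using elim(1,2) by linarith
      also have "\<dots> \<le> (\<integral>\<omega>. exp (real n * (\<theta> * y + \<bar>\<theta>\<bar> * \<delta>)) * indicator (X n) \<omega> \<partial>M)"
      proof (intro integral_mono integrable_indicator_exp_S X integrable_mult_right)
        show "integrable M (indicator (X n) :: _ \<Rightarrow> real)"
          by (rule integrable_real_indicator[OF X]) (simp add: emeasure_eq_measure)
        fix \<omega>
        have "exp (\<theta> * S n \<omega>) \<le> exp (real n * (\<theta> * y + \<bar>\<theta>\<bar> * \<delta>))" if "\<omega> \<in> X n"
        proof -
          have "\<theta> * (S n \<omega> / real n - y) \<le> \<bar>\<theta>\<bar> * \<bar>S n \<omega> / real n - y\<bar>" by (simp flip: abs_mult)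
          also have "\<dots> \<le> \<bar>\<theta>\<bar> * \<delta>" using that by (intro mult_left_mono) (auto simp: X_def)
          finally have "\<theta> * (S n \<omega> / real n) \<le> \<theta> * y + \<bar>\<theta>\<bar> * \<delta>" by (simp add: algebra_simps)
          hence "real n * (\<theta> * (S n \<omega> / real n)) \<le> real n * (\<theta> * y + \<bar>\<theta>\<bar> * \<delta>)"
            by (rule mult_left_mono) simp
          thus ?thesis using elim(5) by simp
        qed
        thus "indicator (X n) \<omega> * exp (\<theta> * S n \<omega>) \<le> exp (real n * (\<theta> * y + \<bar>\<theta>\<bar> * \<delta>)) * indicator (X n) \<omega>"
          by (auto simp: indicator_def)
      qed
      also have "\<dots> = exp (real n * (\<theta> * y + \<bar>\<theta>\<bar> * \<delta>)) * prob (X n)" using X by simp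
      also have "\<dots> \<le> exp (real n * (\<theta> * y + \<epsilon> / 4)) * prob (X n)"
      proof (rule mult_right_mono)
        have "real n * (\<theta> * y + \<bar>\<theta>\<bar> * \<delta>) \<le> real n * (\<theta> * y + \<epsilon> / 4)"
          by (rule mult_left_mono) (use \<theta>\<delta> in simp_all)
        thus "exp (real n * (\<theta> * y + \<bar>\<theta>\<bar> * \<delta>)) \<le> exp (real n * (\<theta> * y + \<epsilon> / 4))" by simp
      qed simp
      finally have le: "E n \<theta> / 2 \<le> exp (real n * (\<theta> * y + \<epsilon> / 4)) * prob (X n)" .
      have "exp (- real n * (\<theta> * y - \<Lambda> \<theta> + \<epsilon>)) \<le> exp (- real n * (\<theta> * y - \<Lambda> \<theta> + \<epsilon> / 2)) / 4" by (rule elim(4))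
      also have "\<dots> \<le> exp (- real n * (\<theta> * y - \<Lambda> \<theta> + \<epsilon> / 2)) / 2" by simp
      also have "\<dots> = exp (- real n * (\<theta> * y + \<epsilon> / 4)) * (exp (real n * (\<Lambda> \<theta> - \<epsilon> / 4)) / 2)"
        by (simp add: algebra_simps flip: exp_add)
      also have "\<dots> \<le> exp (- real n * (\<theta> * y + \<epsilon> / 4)) * (exp (real n * (\<theta> * y + \<epsilon> / 4)) * prob (X n))"
        using elim(3) le by (intro mult_left_mono) auto
      also have "\<dots> = prob (X n)" by (simp flip: exp_add mult.assoc)
      also have "\<dots> \<le> prob {\<omega> \<in> space M. S n \<omega> / real n \<in> A}"
      proof (rule finite_measure_mono)
        show "X n \<subseteq> {\<omega> \<in> space M. S n \<omega> / real n \<in> A}"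
          using r(2) \<delta>(2) by (auto simp: X_def dist_real_def subset_iff abs_minus_commute)
      qed measurable
      finally show ?case .
    qed
  qed
  have "ereal (\<Lambda> \<theta> - \<theta> * y - \<epsilon>) \<le> liminf ?l"
  proof (rule Liminf_bounded)
    show "\<forall>\<^sub>F n in sequentially. ereal (\<Lambda> \<theta> - \<theta> * y - \<epsilon>) \<le> ?l n"
      using ev eventually_gt_at_top[of 0]
    proof eventually_elim
      case (elim n)
      let ?p = "prob {\<omega> \<in> space M. S n \<omega> / real n \<in> A}"
      have p: "0 < ?p" using elim(1) exp_gt_zero less_le_trans by blast
      have "ln (exp (- real n * (\<theta> * y - \<Lambda> \<theta> + \<epsilon>))) \<le> ln ?p"
        using elim(1) p by (subst ln_le_cancel_iff) auto
      thus ?case using p elim(2) by (simp add: log_prob_def field_simps)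
    qed
  qed
  thus "ereal (\<Lambda> \<theta> - \<theta> * y) \<le> liminf ?l + ereal \<epsilon>"
    by (cases "liminf ?l") auto
qed

text \<open>If \<open>I x < \<infinity>\<close> and \<open>y = l x\<close>, then \<open>\<Lambda> \<theta> - \<theta> y\<close> is coercive, hence has a minimum.\<close>

lemma exposed_point:
  assumes x: "legendre_transform \<Lambda> x < \<infinity>" and l: "0 < l" "l < 1"
  obtains \<theta> where "(\<Lambda> has_real_derivative l * x) (at \<theta>)" "ereal (\<theta> * (l * x) - \<Lambda> \<theta>) \<le> legendre_transform \<Lambda> x"
proof -
  have "0 \<le> legendre_transform \<Lambda> x" by (rule legendre_transform_nonneg[where \<Lambda> = \<Lambda>, OF at_0])
  then obtain r where r: "legendre_transform \<Lambda> x = ereal r" using x by (cases "legendre_transform \<Lambda> x") auto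
  have ge: "\<theta> * x - \<Lambda> \<theta> \<le> r" for \<theta> using legendre_transform_ge[of \<theta> x \<Lambda>] by (simp add: r)
  have r0: "0 \<le> r" using ge[of 0] at_0 by simp
  define G where "G \<theta> = \<Lambda> \<theta> - \<theta> * (l * x)" for \<theta>
  have scale: "\<theta> * (l * x) - \<Lambda> \<theta> \<le> r" for \<theta>
  proof -
    have "\<theta> * (l * x) - \<Lambda> \<theta> \<le> l * (\<theta> * x - \<Lambda> \<theta>)"
      using l nonneg[of \<theta>] mult_right_mono[of l 1 "\<Lambda> \<theta>"] by (simp add: algebra_simps)
    also have "\<dots> \<le> l * r" using l by (intro mult_left_mono ge) auto
    also have "\<dots> \<le> 1 * r" using l r0 by (intro mult_right_mono) auto
    finally show ?thesis by simp
  qed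
  have "\<exists>\<theta>. \<forall>\<theta>'. G \<theta> \<le> G \<theta>'"
  proof (cases "x = 0")
    case True
    show ?thesis using nonneg at_0 by (intro exI[of _ 0]) (simp add: G_def True)
  next
    case False
    \<comment> \<open>Chosen so that R (1 - l) |x| = r: beyond R the loss from replacing x by l x
      exceeds the bound r, hence G is nonnegative there, while G 0 = 0.\<close>
    define R where "R = r / ((1 - l) * \<bar>x\<bar>)"
    have R: "0 \<le> R" using r0 l by (simp add: R_def)
    have "continuous_on {-R..R} G" unfolding G_def
      using diff by (intro continuous_intros DERIV_atLeastAtMost_imp_continuous_on[of "-R" R \<Lambda>]) auto
    then obtain \<theta> where \<theta>: "\<theta> \<in> {-R..R}" "\<And>\<theta>'. \<theta>' \<in> {-R..R} \<Longrightarrow> G \<theta> \<le> G \<theta>'"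
      using continuous_attains_inf[of "{-R..R}" G] R by auto
    have "G \<theta> \<le> G \<theta>'" for \<theta>'
    proof (cases "\<theta>' \<in> {-R..R}")
      case False
      hence big: "R < \<bar>\<theta>'\<bar>" by auto
      have "0 \<le> G \<theta>'"
      proof (cases "\<theta>' * x \<le> 0")
        case True
        hence "l * (\<theta>' * x) \<le> 0" using l by (simp add: mult_nonneg_nonpos)
        thus ?thesis using nonneg[of \<theta>'] by (simp add: G_def algebra_simps)
      next
        case False
        hence "\<theta>' * x = \<bar>\<theta>'\<bar> * \<bar>x\<bar>" by (simp flip: abs_mult)
        moreover have "r = R * ((1 - l) * \<bar>x\<bar>)" using l \<open>x \<noteq> 0\<close> by (simp add: R_def)
        moreover have "R * ((1 - l) * \<bar>x\<bar>) \<le> \<bar>\<theta>'\<bar> * ((1 - l) * \<bar>x\<bar>)"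
          using big l by (intro mult_right_mono) auto
        ultimately have "r \<le> (1 - l) * (\<theta>' * x)" by (simp add: mult_ac)
        thus ?thesis using ge[of \<theta>'] by (simp add: G_def algebra_simps)
      qed
      moreover have "G \<theta> \<le> G 0" using R by (intro \<theta>) auto
      ultimately show ?thesis by (simp add: G_def at_0)
    qed (use \<theta> in auto)
    thus ?thesis by blast
  qed
  then obtain \<theta> where \<theta>: "\<And>\<theta>'. G \<theta> \<le> G \<theta>'" by blast
  obtain D where D: "(\<Lambda> has_real_derivative D) (at \<theta>)" using diff by blast
  have "(G has_real_derivative D - l * x) (at \<theta>)"
    unfolding G_def[abs_def] by (auto intro!: derivative_eq_intros D)
  hence "D - l * x = 0" by (rule DERIV_local_min[where d = 1]) (use \<theta> in auto)
  thus thesis using that[of \<theta>] D scale[of \<theta>] by (simp add: r)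
qed

text \<open>A point x of finite rate need not be exposed, but l x with l < 1 is, with a rate no
  larger than that of x; for l close to 1 it still lies in the interior of A.\<close>

lemma lower_bound:
  assumes A: "A \<in> sets borel"
  shows "- (INF x\<in>interior A. legendre_transform \<Lambda> x) \<le>
    liminf (\<lambda>n. ereal (1 / real n) * log_prob (prob {\<omega> \<in> space M. S n \<omega> / real n \<in> A}))" (is "_ \<le> liminf ?l")
proof -
  have "- liminf ?l \<le> legendre_transform \<Lambda> x" if x: "x \<in> interior A" for x
  proof (cases "legendre_transform \<Lambda> x < \<infinity>")
    case True
    have "((\<lambda>l. l * x) \<longlongrightarrow> 1 * x) (at_left 1)" by (intro tendsto_intros)
    hence "\<forall>\<^sub>F l in at_left 1. l * x \<in> interior A"
      using x by (intro topological_tendstoD[of _ _ _ "interior A"]) auto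
    moreover have "\<forall>\<^sub>F l in at_left (1::real). 0 < l" using eventually_at_left_real[of 0 1] by (auto elim: eventually_mono)
    moreover have "\<forall>\<^sub>F l in at_left (1::real). l < 1" by (simp add: eventually_at_filter)
    ultimately have "\<forall>\<^sub>F l in at_left (1::real). l * x \<in> interior A \<and> 0 < l \<and> l < 1"
      by eventually_elim auto
    then obtain l where l: "l * x \<in> interior A" "0 < l" "l < 1"
      using eventually_happens'[OF trivial_limit_at_left_real] by blast
    obtain \<theta> where \<theta>: "(\<Lambda> has_real_derivative l * x) (at \<theta>)" "ereal (\<theta> * (l * x) - \<Lambda> \<theta>) \<le> legendre_transform \<Lambda> x"
      using exposed_point[OF True l(2,3)] by blast
    have "- liminf ?l \<le> - ereal (\<Lambda> \<theta> - \<theta> * (l * x))"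
      unfolding ereal_minus_le_minus by (rule lower_bound_exposed[OF A l(1) \<theta>(1)])
    also have "\<dots> \<le> legendre_transform \<Lambda> x" using \<theta>(2) by simp
    finally show ?thesis .
  qed auto
  hence "- liminf ?l \<le> (INF x\<in>interior A. legendre_transform \<Lambda> x)" by (rule INF_greatest)
  thus ?thesis by (simp add: ereal_uminus_le_reorder)
qed

theorem LDP: "satisfies_LDP M (\<lambda>n \<omega>. S n \<omega> / real n) (\<lambda>n. real n) (legendre_transform \<Lambda>)"
  unfolding satisfies_LDP_def
proof (intro conjI allI ballI)
  show "incseq (\<lambda>n. real n)" by (simp add: incseq_def)
  show "filterlim (\<lambda>n. real n) at_top sequentially" by (rule filterlim_real_sequentially)
qed (use legendre_transform_nonneg[where \<Lambda> = \<Lambda>, OF at_0] lower_semicontinuous_legendre_transform upper_bound lower_bound in auto)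

end

section \<open>Nonnegative Fourier coefficients\<close>

lemma gcos_mult: "gcos (real k * x) * gcos (real l * x) = 1 / 2 * gcos (real (nat \<bar>int k - int l\<bar>) * x) + 1 / 2 * gcos (real (k + l) * x)"
proof -
  have "gcos (real (nat \<bar>int k - int l\<bar>) * x) = cos (2 * pi * (real k * x) - 2 * pi * (real l * x))"
  proof (cases "l \<le> k")
    case True
    hence "real (nat \<bar>int k - int l\<bar>) = real k - real l" by simp
    thus ?thesis by (simp add: gcos_def algebra_simps)
  next
    case False
    hence "real (nat \<bar>int k - int l\<bar>) = real l - real k" by simp
    hence "gcos (real (nat \<bar>int k - int l\<bar>) * x) = cos (- (2 * pi * (real k * x) - 2 * pi * (real l * x)))"
      by (simp add: gcos_def algebra_simps)
    thus ?thesis by (simp only: cos_minus)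
  qed
  thus ?thesis by (simp add: gcos_def cos_times_cos algebra_simps add_divide_distrib)
qed

lemma integral_gcos_multiple: "integral {0..1} (\<lambda>x. gcos (real k * x)) = (if k = 0 then 1 else 0)"
proof (cases "k = 0")
  case False
  have "integral {0..1} (\<lambda>x. gcos (real k * x)) = integral {0..1} gcos"
    by (rule integral_dilation) (use False in \<open>auto intro: continuous_on_gcos[OF continuous_on_id]\<close>)
  thus ?thesis using False integral_gcos by simp
qed (simp add: gcos_def)

text \<open>Only closure properties and signs of integrals are required, so an inductive predicate
  is enough and coefficients never have to be read off from a function.\<close>

inductive nonneg_cos_poly :: "(real \<Rightarrow> real) \<Rightarrow> bool" where
  basis: "0 \<le> c \<Longrightarrow> nonneg_cos_poly (\<lambda>x. c * gcos (real k * x))"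
| add: "nonneg_cos_poly f \<Longrightarrow> nonneg_cos_poly g \<Longrightarrow> nonneg_cos_poly (\<lambda>x. f x + g x)"

lemma nonneg_cos_poly_const: "0 \<le> c \<Longrightarrow> nonneg_cos_poly (\<lambda>x. c)"
  using nonneg_cos_poly.basis[of c 0] by (simp add: gcos_def)

lemma nonneg_cos_poly_gcos: "nonneg_cos_poly (\<lambda>x. gcos (real k * x))"
  using nonneg_cos_poly.basis[of 1 k] by simp

lemma nonneg_cos_poly_mult:
  assumes "nonneg_cos_poly f" and "nonneg_cos_poly g"
  shows "nonneg_cos_poly (\<lambda>x. f x * g x)"
  using assms
proof (induction f)
  case (basis c k)
  show ?case using basis.prems
  proof (induction g)
    case (basis d l)
    have "c * gcos (real k * x) * (d * gcos (real l * x)) =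
      c * d / 2 * gcos (real (nat \<bar>int k - int l\<bar>) * x) + c * d / 2 * gcos (real (k + l) * x)" for x
    proof -
      have "c * gcos (real k * x) * (d * gcos (real l * x)) = c * d * (gcos (real k * x) * gcos (real l * x))"
        by (simp only: mult_ac)
      also have "\<dots> = c * d / 2 * gcos (real (nat \<bar>int k - int l\<bar>) * x) + c * d / 2 * gcos (real (k + l) * x)"
        unfolding gcos_mult by (simp only: distrib_left mult.assoc[symmetric]) simp
      finally show ?thesis .
    qed
    thus ?case using basis \<open>0 \<le> c\<close>
      by (simp only:) (intro nonneg_cos_poly.add nonneg_cos_poly.basis; simp)
  next
    case (add f g)
    thus ?case using nonneg_cos_poly.add by (simp add: distrib_left)
  qed
next
  case (add f g')
  have "nonneg_cos_poly (\<lambda>x. f x * g x + g' x * g x)"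
    by (intro nonneg_cos_poly.add add)
  thus ?case by (simp add: distrib_right)
qed

lemma nonneg_cos_poly_power:
  assumes "nonneg_cos_poly f"
  shows "nonneg_cos_poly (\<lambda>x. f x ^ n)"
proof (induction n)
  case 0
  show ?case using nonneg_cos_poly_const[of 1] by simp
next
  case (Suc n)
  show ?case using nonneg_cos_poly_mult[OF assms Suc] by simp
qed

lemma nonneg_cos_poly_scale:
  assumes "nonneg_cos_poly f" "0 \<le> c"
  shows "nonneg_cos_poly (\<lambda>x. c * f x)"
  by (rule nonneg_cos_poly_mult[OF nonneg_cos_poly_const[OF assms(2)] assms(1)])

lemma nonneg_cos_poly_sum:
  assumes "\<And>i. i \<in> I \<Longrightarrow> nonneg_cos_poly (f i)"
  shows "nonneg_cos_poly (\<lambda>x. \<Sum>i\<in>I. f i x)"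
  using assms
proof (induction I rule: infinite_finite_induct)
  case (insert i I)
  thus ?case using nonneg_cos_poly.add[of "f i" "\<lambda>x. \<Sum>i\<in>I. f i x"] by simp
qed (use nonneg_cos_poly_const[of 0] in auto)

lemma nonneg_cos_poly_birkhoff_sum: "nonneg_cos_poly (\<lambda>x. birkhoff_sum q n (real q ^ m * x))"
proof -
  have "nonneg_cos_poly (\<lambda>x. \<Sum>k<n. gcos (real (q ^ (k + m)) * x))"
    by (intro nonneg_cos_poly_sum nonneg_cos_poly_gcos)
  thus ?thesis by (simp add: birkhoff_sum_def power_add mult_ac)
qed

lemma continuous_on_nonneg_cos_poly: "nonneg_cos_poly f \<Longrightarrow> continuous_on A f"
  by (induction rule: nonneg_cos_poly.induct) (intro continuous_intros; assumption)+

section \<open>Nonnegative covariances and lower bounds for the limit\<close>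

definition covariance :: "(real \<Rightarrow> real) \<Rightarrow> (real \<Rightarrow> real) \<Rightarrow> real" where
  "covariance f g = integral {0..1} (\<lambda>x. f x * g x) - integral {0..1} f * integral {0..1} g"

lemma covariance_commute: "covariance f g = covariance g f"
  by (simp add: covariance_def mult.commute)

lemma covariance_add:
  assumes "continuous_on {0..1} f" "continuous_on {0..1} f'" "continuous_on {0..1} g"
  shows "covariance (\<lambda>x. f x + f' x) g = covariance f g + covariance f' g"
proof -
  have i: "(\<lambda>x. f x * g x) integrable_on {0..1}" "(\<lambda>x. f' x * g x) integrable_on {0..1}"
    "f integrable_on {0..1}" "f' integrable_on {0..1}"
    using assms by (auto intro!: integrable_continuous_real continuous_on_mult)
  show ?thesis
    by (simp add: covariance_def distrib_right integral_add[OF i(1,2)] integral_add[OF i(3,4)])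
qed

text \<open>By bilinearity two cosines suffice. Their covariance is 1/2 if the frequencies are equal
  and positive, and 0 otherwise.\<close>

lemma covariance_nonneg_cos_poly:
  assumes "nonneg_cos_poly f" "nonneg_cos_poly g"
  shows "0 \<le> covariance f g"
  using assms
proof (induction f)
  case (basis c k)
  show ?case using basis.prems
  proof (induction g)
    case (basis d l)
    let ?i = "\<lambda>k. integral {0..1} (\<lambda>x. gcos (real k * x))"
    have i: "(\<lambda>x. 1 / 2 * gcos (real j * x)) integrable_on {0..1}" for j
      by (intro integrable_continuous_real continuous_intros)
    have "integral {0..1} (\<lambda>x. gcos (real k * x) * gcos (real l * x)) =
        1 / 2 * ?i (nat \<bar>int k - int l\<bar>) + 1 / 2 * ?i (k + l)"
      unfolding gcos_mult integral_add[OF i i] by simp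
    also have "\<dots> \<ge> ?i k * ?i l"
      unfolding integral_gcos_multiple by auto
    finally have "c * d * (?i k * ?i l) \<le> c * d * integral {0..1} (\<lambda>x. gcos (real k * x) * gcos (real l * x))"
      using basis \<open>0 \<le> c\<close> by (intro mult_left_mono) auto
    also have "\<dots> = integral {0..1} (\<lambda>x. c * gcos (real k * x) * (d * gcos (real l * x)))"
      by (simp add: mult_ac flip: integral_mult_right)
    finally show ?case by (simp add: covariance_def mult_ac)
  next
    case (add g g')
    have "covariance (\<lambda>x. g x + g' x) (\<lambda>x. c * gcos (real k * x)) =
      covariance g (\<lambda>x. c * gcos (real k * x)) + covariance g' (\<lambda>x. c * gcos (real k * x))"
      by (intro covariance_add continuous_on_nonneg_cos_poly add.hyps nonneg_cos_poly.basis \<open>0 \<le> c\<close>)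
    thus ?case using add.IH by (simp add: covariance_commute)
  qed
next
  case (add f f')
  have "covariance (\<lambda>x. f x + f' x) g = covariance f g + covariance f' g"
    by (intro covariance_add continuous_on_nonneg_cos_poly add)
  thus ?case using add by simp
qed

lemma covariance_mono:
  assumes "nonneg_cos_poly f" "nonneg_cos_poly f'" "nonneg_cos_poly g" "nonneg_cos_poly g'"
  shows "covariance f g \<le> covariance (\<lambda>x. f x + f' x) (\<lambda>x. g x + g' x)"
proof -
  have "covariance (\<lambda>x. f x + f' x) (\<lambda>x. g x + g' x) = covariance f (\<lambda>x. g x + g' x) + covariance f' (\<lambda>x. g x + g' x)"
    by (intro covariance_add continuous_on_nonneg_cos_poly assms nonneg_cos_poly.add)
  moreover have "covariance (\<lambda>x. g x + g' x) f = covariance g f + covariance g' f"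
    by (intro covariance_add continuous_on_nonneg_cos_poly assms)
  ultimately show ?thesis
    using covariance_nonneg_cos_poly[OF assms(2) nonneg_cos_poly.add[OF assms(3,4)]]
      covariance_nonneg_cos_poly[OF assms(4,1)]
    by (simp add: covariance_commute)
qed

text \<open>Exponentials are infinite sums of powers and lie outside \<open>nonneg_cos_poly\<close>;
  they are reached as limits of these truncations.\<close>

definition exp_poly :: "nat \<Rightarrow> real \<Rightarrow> real" where
  "exp_poly N x = (\<Sum>i<N. x ^ i / fact i)"

lemma exp_poly_LIMSEQ: "(\<lambda>N. exp_poly N x) \<longlonglongrightarrow> exp x"
  using exp_converges[of x] by (simp add: sums_def exp_poly_def field_simps scaleR_conv_of_real)

lemma abs_exp_poly_le: "\<bar>exp_poly N x\<bar> \<le> exp \<bar>x\<bar>"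
proof -
  have "\<bar>exp_poly N x\<bar> \<le> (\<Sum>i<N. \<bar>x ^ i / fact i\<bar>)" unfolding exp_poly_def by (rule sum_abs)
  also have "\<dots> = (\<Sum>i<N. \<bar>x\<bar> ^ i /\<^sub>R fact i)" by (simp add: power_abs field_simps)
  also have "\<dots> \<le> (\<Sum>i. \<bar>x\<bar> ^ i /\<^sub>R fact i)"
    by (rule sum_le_suminf) (simp_all add: summable_exp)
  finally show ?thesis by (simp add: exp_def)
qed

lemma continuous_on_exp_poly: "continuous_on A f \<Longrightarrow> continuous_on A (\<lambda>x. exp_poly N (f x))"
  unfolding exp_poly_def by (intro continuous_intros) auto

lemma nonneg_cos_poly_exp_poly:
  assumes "nonneg_cos_poly u"
  shows "nonneg_cos_poly (\<lambda>x. exp_poly N (u x))"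
  unfolding exp_poly_def
proof (rule nonneg_cos_poly_sum)
  fix i
  show "nonneg_cos_poly (\<lambda>x. u x ^ i / fact i)"
    using nonneg_cos_poly_scale[OF nonneg_cos_poly_power[OF assms], of "1 / fact i" i] by simp
qed

lemma covariance_exp_poly_LIMSEQ:
  assumes u: "continuous_on {0..1} u" and v: "continuous_on {0..1} v"
  shows "(\<lambda>N. covariance (\<lambda>x. exp_poly N (u x)) (\<lambda>x. exp_poly N (v x))) \<longlonglongrightarrow> covariance (\<lambda>x. exp (u x)) (\<lambda>x. exp (v x))"
  unfolding covariance_def
proof (intro tendsto_diff tendsto_mult)
  have *: "(\<lambda>N. integral {0..1} (\<lambda>x. exp_poly N (w x))) \<longlonglongrightarrow> integral {0..1} (\<lambda>x. exp (w x))"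
    if w: "continuous_on {0..1} w" for w :: "real \<Rightarrow> real"
  proof (rule dominated_convergence[where h = "\<lambda>x. exp \<bar>w x\<bar>"])
    show "(\<lambda>x. exp_poly N (w x)) integrable_on {0..1}" for N
      by (intro integrable_continuous_real continuous_on_exp_poly w)
    show "(\<lambda>x. exp \<bar>w x\<bar>) integrable_on {0..1}"
      by (intro integrable_continuous_real continuous_on_exp continuous_on_rabs w)
  qed (use abs_exp_poly_le exp_poly_LIMSEQ in auto)
  show "(\<lambda>N. integral {0..1} (\<lambda>x. exp_poly N (u x))) \<longlonglongrightarrow> integral {0..1} (\<lambda>x. exp (u x))" by (rule *[OF u])
  show "(\<lambda>N. integral {0..1} (\<lambda>x. exp_poly N (v x))) \<longlonglongrightarrow> integral {0..1} (\<lambda>x. exp (v x))" by (rule *[OF v])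
  show "(\<lambda>N. integral {0..1} (\<lambda>x. exp_poly N (u x) * exp_poly N (v x))) \<longlonglongrightarrow> integral {0..1} (\<lambda>x. exp (u x) * exp (v x))"
  proof (rule dominated_convergence[where h = "\<lambda>x. exp \<bar>u x\<bar> * exp \<bar>v x\<bar>"])
    show "(\<lambda>x. exp_poly N (u x) * exp_poly N (v x)) integrable_on {0..1}" for N
      by (intro integrable_continuous_real continuous_on_mult continuous_on_exp_poly u v)
    show "(\<lambda>x. exp \<bar>u x\<bar> * exp \<bar>v x\<bar>) integrable_on {0..1}"
      by (intro integrable_continuous_real continuous_on_mult continuous_on_exp continuous_on_rabs u v)
    show "norm (exp_poly N (u x) * exp_poly N (v x)) \<le> exp \<bar>u x\<bar> * exp \<bar>v x\<bar>" for N x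
      unfolding real_norm_def abs_mult by (intro mult_mono abs_exp_poly_le) auto
    show "(\<lambda>N. exp_poly N (u x) * exp_poly N (v x)) \<longlonglongrightarrow> exp (u x) * exp (v x)" for x
      by (intro tendsto_mult exp_poly_LIMSEQ)
  qed
qed

lemma covariance_exp_nonneg:
  assumes "nonneg_cos_poly u" "nonneg_cos_poly v"
  shows "0 \<le> covariance (\<lambda>x. exp (u x)) (\<lambda>x. exp (v x))"
  by (rule LIMSEQ_le_const[OF covariance_exp_poly_LIMSEQ])
     (use assms in \<open>auto intro!: continuous_on_nonneg_cos_poly covariance_nonneg_cos_poly nonneg_cos_poly_exp_poly\<close>)

text \<open>Expanding both exponentials, every pair of terms has nonnegative covariance, so any
  single pair is a lower bound. This is how strictness is obtained.\<close>

lemma covariance_exp_ge: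
  assumes u: "nonneg_cos_poly u" and v: "nonneg_cos_poly v"
  shows "covariance (\<lambda>x. u x ^ a / fact a) (\<lambda>x. v x ^ b / fact b) \<le> covariance (\<lambda>x. exp (u x)) (\<lambda>x. exp (v x))"
proof (rule LIMSEQ_le_const[OF covariance_exp_poly_LIMSEQ])
  have poly: "nonneg_cos_poly (\<lambda>x. w x ^ i / fact i)" if "nonneg_cos_poly w" for w i
    using nonneg_cos_poly_scale[OF nonneg_cos_poly_power[OF that], of "1 / fact i" i] by simp
  have split: "(\<lambda>x. exp_poly N (w x)) = (\<lambda>x. w x ^ a / fact a + (\<Sum>i\<in>{..<N}-{a}. w x ^ i / fact i))"
    if "a < N" for N a and w :: "real \<Rightarrow> real"
    using that by (simp add: exp_poly_def sum.remove[of _ a])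
  show "\<exists>N. \<forall>n\<ge>N. covariance (\<lambda>x. u x ^ a / fact a) (\<lambda>x. v x ^ b / fact b)
    \<le> covariance (\<lambda>x. exp_poly n (u x)) (\<lambda>x. exp_poly n (v x))"
  proof (intro exI[of _ "Suc (max a b)"] allI impI)
    fix n assume n: "Suc (max a b) \<le> n"
    have "a < n" "b < n" using n by auto
    show "covariance (\<lambda>x. u x ^ a / fact a) (\<lambda>x. v x ^ b / fact b)
      \<le> covariance (\<lambda>x. exp_poly n (u x)) (\<lambda>x. exp_poly n (v x))"
      unfolding split[OF \<open>a < n\<close>, of u] split[OF \<open>b < n\<close>, of v]
      by (intro covariance_mono nonneg_cos_poly_sum poly u v)
  qed
qed (use u v in \<open>auto intro: continuous_on_nonneg_cos_poly\<close>)

lemma mgf_add_eq_covariance: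
  fixes \<theta> :: real
  assumes "0 < q"
  shows "mgf q (n + m) \<theta> = mgf q n \<theta> * mgf q m \<theta> +
    covariance (\<lambda>x. exp (\<theta> * birkhoff_sum q n x)) (\<lambda>x. exp (\<theta> * birkhoff_sum q m (real q ^ n * x)))"
proof -
  have "integral {0..1} (\<lambda>x. exp (\<theta> * birkhoff_sum q m (real (q ^ n) * x))) = integral {0..1} (\<lambda>x. exp (\<theta> * birkhoff_sum q m x))"
  proof (rule integral_dilation)
    show "continuous_on UNIV (\<lambda>x. exp (\<theta> * birkhoff_sum q m x))" by (intro continuous_intros)
  qed (use assms in auto)
  thus ?thesis by (simp add: covariance_def mgf_def birkhoff_sum_add distrib_left exp_add)
qed

lemma mgf_supermultiplicative:
  fixes \<theta> :: real
  assumes "0 < q" "0 \<le> \<theta>"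
  shows "mgf q n \<theta> * mgf q m \<theta> \<le> mgf q (n + m) \<theta>"
proof -
  have "0 \<le> covariance (\<lambda>x. exp (\<theta> * birkhoff_sum q n x)) (\<lambda>x. exp (\<theta> * birkhoff_sum q m (real q ^ n * x)))"
    using nonneg_cos_poly_birkhoff_sum[of q n 0]
    by (intro covariance_exp_nonneg nonneg_cos_poly_scale nonneg_cos_poly_birkhoff_sum assms) auto
  thus ?thesis unfolding mgf_add_eq_covariance[OF assms(1)] by simp
qed

text \<open>For \<theta> \<ge> 0 the logarithms are superadditive; the limit is taken along
  multiples of n, as in Fekete's lemma.\<close>

lemma pressure_ge_mgf:
  assumes q: "2 \<le> q" and \<theta>: "0 \<le> \<theta>" and n: "0 < n"
  shows "ln (mgf q n \<theta>) / real n \<le> pressure q \<theta>"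
proof -
  have q0: "0 < q" using q by simp
  have *: "real m * ln (mgf q n \<theta>) \<le> ln (mgf q (n * m) \<theta>)" for m
  proof (induction m)
    case 0
    show ?case by (simp add: mgf_def birkhoff_sum_def)
  next
    case (Suc m)
    have "mgf q n \<theta> \<noteq> 0" "mgf q (n * m) \<theta> \<noteq> 0" using mgf_bounds(2)[of q _ \<theta>] by (metis less_irrefl)+
    hence "real (Suc m) * ln (mgf q n \<theta>) \<le> ln (mgf q n \<theta> * mgf q (n * m) \<theta>)"
      using Suc by (simp add: ln_mult algebra_simps)
    also have "\<dots> \<le> ln (mgf q (n * Suc m) \<theta>)"
      using mgf_supermultiplicative[OF q0 \<theta>, of n "n * m"] mgf_bounds(2)[of q _ \<theta>]
      by (subst ln_le_cancel_iff) (auto intro: mult_pos_pos)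
    finally show ?case .
  qed
  have sub: "strict_mono (\<lambda>m. n * Suc m)" using n by (auto simp: strict_mono_def)
  have "(\<lambda>m. ln (mgf q (n * Suc m) \<theta>) / real (n * Suc m)) \<longlonglongrightarrow> pressure q \<theta>"
    using LIMSEQ_subseq_LIMSEQ[OF pressure_limit[OF q] sub] by (simp add: o_def)
  moreover have "ln (mgf q n \<theta>) / real n \<le> ln (mgf q (n * Suc m) \<theta>) / real (n * Suc m)" for m
  proof -
    have "ln (mgf q n \<theta>) / real n = real (Suc m) * ln (mgf q n \<theta>) / (real (Suc m) * real n)"
      by (simp del: of_nat_Suc)
    also have "\<dots> \<le> ln (mgf q (n * Suc m) \<theta>) / (real (Suc m) * real n)"
      by (intro divide_right_mono *) auto
    finally show ?thesis by (simp add: mult.commute del: of_nat_Suc mult_Suc_right)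
  qed
  ultimately show ?thesis by (intro LIMSEQ_le_const) blast+
qed

section \<open>The transfer operator on powers of the cosine\<close>

inductive cos_span :: "nat \<Rightarrow> (real \<Rightarrow> real) \<Rightarrow> bool" for m where
  basis: "k < m \<Longrightarrow> cos_span m (\<lambda>x. c * gcos (real k * x))"
| add: "cos_span m f \<Longrightarrow> cos_span m g \<Longrightarrow> cos_span m (\<lambda>x. f x + g x)"

lemma cos_span_gcos_mult: "cos_span m f \<Longrightarrow> cos_span (Suc m) (\<lambda>x. gcos x * f x)"
proof (induction rule: cos_span.induct)
  case (basis k c)
  have "gcos x * (c * gcos (real k * x)) = c / 2 * gcos (real (nat \<bar>int 1 - int k\<bar>) * x) + c / 2 * gcos (real (1 + k) * x)" for x
  proof -
    have "gcos x * (c * gcos (real k * x)) = c * (gcos (real 1 * x) * gcos (real k * x))" by simp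
    thus ?thesis unfolding gcos_mult by (simp add: algebra_simps)
  qed
  thus ?case using basis by (simp only:) (intro cos_span.add cos_span.basis; linarith)
next
  case (add f g)
  thus ?case using cos_span.add by (simp add: distrib_left)
qed

text \<open>Each multiplication by the cosine raises the top frequency by one and halves its
  coefficient; \<open>r\<close> collects the lower frequencies, including the constant.\<close>

lemma gcos_power:
  obtains r where "cos_span (Suc m) r" "\<And>x. gcos x ^ Suc m = gcos (real (Suc m) * x) / 2 ^ m + r x"
proof -
  have "\<exists>r. cos_span (Suc m) r \<and> (\<forall>x. gcos x ^ Suc m = gcos (real (Suc m) * x) / 2 ^ m + r x)"
  proof (induction m)
    case 0
    show ?case using cos_span.basis[of 0 1 0] by (intro exI[of _ "\<lambda>x. 0"]) simp
  next
    case (Suc m)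
    then obtain r where r: "cos_span (Suc m) r" "\<And>x. gcos x ^ Suc m = gcos (real (Suc m) * x) / 2 ^ m + r x" by blast
    have "gcos x ^ Suc (Suc m) = gcos (real (Suc (Suc m)) * x) / 2 ^ Suc m + (1 / 2 ^ Suc m * gcos (real m * x) + gcos x * r x)" for x
    proof -
      have "gcos x ^ Suc (Suc m) = gcos (real 1 * x) * gcos (real (Suc m) * x) / 2 ^ m + gcos x * r x"
        unfolding power_Suc[of _ "Suc m"] r(2) by (simp add: distrib_left)
      also have "\<dots> = gcos (real (Suc (Suc m)) * x) / 2 ^ Suc m + (1 / 2 ^ Suc m * gcos (real m * x) + gcos x * r x)"
        unfolding gcos_mult by (simp add: add_divide_distrib)
      finally show ?thesis .
    qed
    moreover have "cos_span (Suc (Suc m)) (\<lambda>x. 1 / 2 ^ Suc m * gcos (real m * x) + gcos x * r x)"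
      by (intro cos_span.add cos_span.basis cos_span_gcos_mult r) simp
    ultimately show ?case by blast
  qed
  thus thesis using that by blast
qed

text \<open>Multiplied by 2 sin a, the cosines along an arithmetic progression telescope; after q
  steps the argument of the sine has advanced by k full periods.\<close>

lemma transfer_op_gcos_0:
  assumes "0 < k" "k < q"
  shows "transfer_op q (\<lambda>x. gcos (real k * x)) x = 0"
proof -
  define a where "a = pi * real k / real q"
  define s where "s j = sin (2 * a * (x + real j) - a)" for j
  have "0 < a" "a < pi" using assms by (auto simp: a_def field_simps)
  hence "sin a \<noteq> 0" using sin_gt_zero[of a] by simp
  have "2 * sin a * gcos (real k * ((x + real j) / real q)) = s (Suc j) - s j" for j
  proof -
    have "gcos (real k * ((x + real j) / real q)) = cos (2 * a * (x + real j))"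
      by (simp add: gcos_def a_def mult_ac)
    moreover have "s (Suc j) = sin (2 * a * (x + real j) + a)"
      by (simp add: s_def algebra_simps)
    ultimately show ?thesis by (simp add: s_def sin_add sin_diff)
  qed
  hence "2 * sin a * (\<Sum>j<q. gcos (real k * ((x + real j) / real q))) = (\<Sum>j<q. s (Suc j) - s j)"
    unfolding sum_distrib_left by (intro sum.cong refl)
  also have "\<dots> = s q - s 0" by (rule sum_lessThan_telescope)
  also have "s q = sin (2 * a * x - a + 2 * pi * real k)"
  proof -
    have "a * real q = pi * real k" using assms by (simp add: a_def)
    hence "2 * a * (x + real q) - a = 2 * a * x - a + 2 * pi * real k" by (simp add: algebra_simps)
    thus ?thesis by (simp only: s_def)
  qed
  also have "\<dots> = s 0" using sin.plus_of_nat[of "2 * a * x - a" k] by (simp add: s_def mult_ac)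
  finally show ?thesis using \<open>sin a \<noteq> 0\<close> by (simp add: transfer_op_def)
qed

text \<open>Below frequency q the constants are the only cosines not annihilated, so on this span
  the operator is integration.\<close>

lemma transfer_op_cos_span: "cos_span q f \<Longrightarrow> 0 < q \<Longrightarrow> transfer_op q f x = integral {0..1} f"
proof (induction rule: cos_span.induct)
  case (basis k c)
  have "transfer_op q (\<lambda>x. c * gcos (real k * x)) x = c * transfer_op q (\<lambda>x. gcos (real k * x)) x"
    by (simp add: transfer_op_def sum_distrib_left)
  also have "transfer_op q (\<lambda>x. gcos (real k * x)) x = (if k = 0 then 1 else 0)"
    using transfer_op_gcos_0[of k q x] basis by (simp add: transfer_op_def gcos_def)
  finally show ?case by (simp add: integral_gcos_multiple)
next
  case (add f g)
  have cont: "continuous_on {0..1} f" if "cos_span q f" for f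
    using that by (induction rule: cos_span.induct) (intro continuous_intros; assumption)+
  have "transfer_op q (\<lambda>x. f x + g x) x = transfer_op q f x + transfer_op q g x"
    by (simp add: transfer_op_def sum.distrib add_divide_distrib)
  also have "\<dots> = integral {0..1} (\<lambda>x. f x + g x)"
    using add by (subst integral_add) (auto intro: integrable_continuous_real cont)
  finally show ?case .
qed

text \<open>The power q is the first to contain the frequency q, with coefficient 2 / 2^q, and the
  operator maps this frequency to 1. Lower powers become constants. This is the source of the
  distinguished order q + 1 in (iv).\<close>

lemma transfer_op_gcos_power:
  assumes "m \<le> q" "0 < q"
  shows "transfer_op q (\<lambda>x. gcos x ^ m) x = integral {0..1} (\<lambda>x. gcos x ^ m) +
     (if m = q then 2 / 2 ^ q * gcos x else 0)"
proof (cases m)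
  case 0
  have "cos_span q (\<lambda>x. 1 * gcos (real 0 * x))" by (rule cos_span.basis) (use assms in simp)
  hence "cos_span q (\<lambda>x. 1)" by (simp add: gcos_def)
  from transfer_op_cos_span[OF this assms(2), of x] show ?thesis using 0 assms by simp
next
  case (Suc n)
  obtain r where r: "cos_span (Suc n) r" "\<And>x. gcos x ^ Suc n = gcos (real (Suc n) * x) / 2 ^ n + r x"
    using gcos_power by blast
  have mono: "cos_span q f" if "cos_span m' f" "m' \<le> q" for f m'
    using that by (induction rule: cos_span.induct) (auto intro: cos_span.intros)
  have rq: "cos_span q r" using mono[OF r(1)] assms Suc by simp
  have rc: "continuous_on {0..1} r"
    using r(1) by (induction rule: cos_span.induct) (intro continuous_intros; assumption)+
  have int: "integral {0..1} (\<lambda>x. gcos x ^ Suc n) = integral {0..1} r"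
  proof -
    have "integral {0..1} (\<lambda>x. gcos (real (Suc n) * x) / 2 ^ n) = integral {0..1} (\<lambda>x. gcos (real (Suc n) * x)) / 2 ^ n"
      by simp
    also have "\<dots> = 0" unfolding integral_gcos_multiple by simp
    finally have 0: "integral {0..1} (\<lambda>x. gcos (real (Suc n) * x) / 2 ^ n) = 0" .
    show ?thesis unfolding r(2) using 0 rc
      by (subst integral_add) (auto intro!: integrable_continuous_real continuous_intros simp del: of_nat_Suc)
  qed
  have split: "transfer_op q (\<lambda>x. gcos x ^ Suc n) x = transfer_op q (\<lambda>x. gcos (real (Suc n) * x)) x / 2 ^ n + transfer_op q r x"
    unfolding r(2) by (simp add: transfer_op_def sum.distrib add_divide_distrib mult.commute flip: sum_divide_distrib)
  have "transfer_op q (\<lambda>x. gcos (real (Suc n) * x)) x = (if Suc n = q then gcos x else 0)"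
  proof (cases "Suc n = q")
    case True
    thus ?thesis using assms by (auto simp: transfer_op_def)
  next
    case False
    thus ?thesis using transfer_op_gcos_0[of "Suc n" q x] assms Suc by simp
  qed
  thus ?thesis unfolding Suc split int transfer_op_cos_span[OF rq assms(2)] by auto
qed

lemma integral_gcos_squared: "integral {0..1} (\<lambda>x. gcos x * gcos x) = 1 / 2"
proof -
  have "gcos x * gcos x = 1 / 2 * gcos (real 0 * x) + 1 / 2 * gcos (real 2 * x)" for x
    using gcos_mult[of 1 x 1] by simp
  moreover have i: "(\<lambda>x. 1 / 2 * gcos (real j * x)) integrable_on {0..1}" for j
    by (intro integrable_continuous_real continuous_intros)
  ultimately have "integral {0..1} (\<lambda>x. gcos x * gcos x) =
      integral {0..1} (\<lambda>x. 1 / 2 * gcos (real 0 * x)) + integral {0..1} (\<lambda>x. 1 / 2 * gcos (real 2 * x))"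
    by (simp only: integral_add)
  also have "\<dots> = 1 / 2 * (if 0 = (0::nat) then 1 else 0) + 1 / 2 * (if 2 = (0::nat) then 1 else 0)"
    unfolding integral_mult_right integral_gcos_multiple ..
  finally show ?thesis by simp
qed

text \<open>The pair formed by (\<theta> g x)^q / q! and \<theta> g (q x) already has covariance
  \<theta>^(q+1) / (2^q q!) > 0.\<close>

lemma mgf_2_gt:
  fixes \<theta> :: real
  assumes q: "2 \<le> q" and \<theta>: "0 < \<theta>"
  shows "mgf q 1 \<theta> * mgf q 1 \<theta> < mgf q 2 \<theta>"
proof -
  have q0: "0 < q" using q by simp
  let ?u = "\<lambda>x. \<theta> * gcos x" and ?v = "\<lambda>x. \<theta> * gcos (real q * x)"
  have "integral {0..1} (\<lambda>x. gcos x ^ q * gcos (real q * x)) = integral {0..1} (transfer_op q (\<lambda>x. gcos x ^ q * gcos (real q * x)))"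
    by (rule integral_transfer_op[symmetric]) (intro continuous_intros q0)+
  also have "transfer_op q (\<lambda>x. gcos x ^ q * gcos (real q * x)) = (\<lambda>x. transfer_op q (\<lambda>x. gcos x ^ q) x * gcos x)"
    using q0 by (simp add: transfer_op_def fun_eq_iff flip: sum_distrib_right)
  also have "\<dots> = (\<lambda>x. integral {0..1} (\<lambda>x. gcos x ^ q) * gcos x + 2 / 2 ^ q * (gcos x * gcos x))"
    using transfer_op_gcos_power[of q q] q0 by (simp add: fun_eq_iff algebra_simps)
  also have "integral {0..1} \<dots> = integral {0..1} (\<lambda>x. gcos x ^ q) * integral {0..1} gcos + 2 / 2 ^ q * integral {0..1} (\<lambda>x. gcos x * gcos x)"
    by (subst integral_add) (auto intro!: integrable_continuous_real continuous_intros)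
  also have "\<dots> = 1 / 2 ^ q" by (simp add: integral_gcos integral_gcos_squared)
  finally have int: "integral {0..1} (\<lambda>x. gcos x ^ q * gcos (real q * x)) = 1 / 2 ^ q" .
  have v0: "integral {0..1} (\<lambda>x. ?v x ^ 1 / fact 1) = 0" using integral_gcos_multiple[of q] q0 by simp
  have "covariance (\<lambda>x. ?u x ^ q / fact q) (\<lambda>x. ?v x ^ 1 / fact 1) = integral {0..1} (\<lambda>x. \<theta> ^ (q + 1) / fact q * (gcos x ^ q * gcos (real q * x)))"
    unfolding covariance_def v0 by (simp add: power_mult_distrib mult_ac)
  also have "\<dots> = \<theta> ^ (q + 1) / fact q * (1 / 2 ^ q)" using int by simp
  also have "\<dots> > 0" using \<theta> by simp
  finally have "0 < covariance (\<lambda>x. ?u x ^ q / fact q) (\<lambda>x. ?v x ^ 1 / fact 1)" .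
  also have "\<dots> \<le> covariance (\<lambda>x. exp (?u x)) (\<lambda>x. exp (?v x))"
    using \<theta> nonneg_cos_poly_gcos[of 1]
    by (intro covariance_exp_ge nonneg_cos_poly_scale nonneg_cos_poly_gcos) auto
  also have "\<dots> = mgf q (1 + 1) \<theta> - mgf q 1 \<theta> * mgf q 1 \<theta>"
    unfolding mgf_add_eq_covariance[OF q0] by (simp add: birkhoff_sum_def)
  finally show ?thesis by (simp add: numeral_2_eq_2)
qed

lemma pressure_gt:
  assumes q: "2 \<le> q" and \<theta>: "0 < \<theta>"
  shows "ln (mgf q 1 \<theta>) < pressure q \<theta>"
proof -
  have pos: "0 < mgf q n \<theta>" for n by (rule mgf_bounds)
  have nz: "mgf q n \<theta> \<noteq> 0" for n using pos[of n] by simp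
  have "ln (mgf q 1 \<theta> * mgf q 1 \<theta>) < ln (mgf q 2 \<theta>)"
    using mgf_2_gt[OF assms] pos by (subst ln_less_cancel_iff) auto
  hence "ln (mgf q 1 \<theta>) < ln (mgf q 2 \<theta>) / real 2" using nz by (simp add: ln_mult)
  also have "\<dots> \<le> pressure q \<theta>" using \<theta> by (intro pressure_ge_mgf q) auto
  finally show ?thesis .
qed

section \<open>Expansion at the origin\<close>

text \<open>A Landau symbol for \<theta> near 0, uniform in x. The range |\<theta>| \<le> 1 is
  fixed, so that estimates combine without adjusting neighbourhoods; functions of \<theta> alone are
  treated as constant in x, and order 0 means bounded.\<close>

definition unif_O :: "nat \<Rightarrow> (real \<Rightarrow> real \<Rightarrow> real) \<Rightarrow> bool" where
  "unif_O k h \<longleftrightarrow> (\<exists>K. \<forall>\<theta> x. \<bar>\<theta>\<bar> \<le> 1 \<longrightarrow> \<bar>h \<theta> x\<bar> \<le> K * \<bar>\<theta>\<bar> ^ k)"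

lemma unif_OI: "(\<And>\<theta> x. \<bar>\<theta>\<bar> \<le> 1 \<Longrightarrow> \<bar>h \<theta> x\<bar> \<le> K * \<bar>\<theta>\<bar> ^ k) \<Longrightarrow> unif_O k h"
  unfolding unif_O_def by blast

lemma unif_OE:
  assumes "unif_O k h"
  obtains K where "0 \<le> K" "\<And>\<theta> x. \<bar>\<theta>\<bar> \<le> 1 \<Longrightarrow> \<bar>h \<theta> x\<bar> \<le> K * \<bar>\<theta>\<bar> ^ k"
proof -
  obtain K where K: "\<And>\<theta> x. \<bar>\<theta>\<bar> \<le> 1 \<Longrightarrow> \<bar>h \<theta> x\<bar> \<le> K * \<bar>\<theta>\<bar> ^ k"
    using assms unfolding unif_O_def by blast
  have "0 \<le> K" using K[of 1 0] by simp
  thus thesis using that K by blast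
qed

lemma unif_O_mono:
  assumes "unif_O l h" "k \<le> l"
  shows "unif_O k h"
proof -
  obtain K where K: "0 \<le> K" "\<And>\<theta> x. \<bar>\<theta>\<bar> \<le> 1 \<Longrightarrow> \<bar>h \<theta> x\<bar> \<le> K * \<bar>\<theta>\<bar> ^ l"
    using unif_OE[OF assms(1)] by blast
  show ?thesis
  proof (rule unif_OI)
    fix \<theta> x :: real assume t: "\<bar>\<theta>\<bar> \<le> 1"
    have "\<bar>h \<theta> x\<bar> \<le> K * \<bar>\<theta>\<bar> ^ l" by (rule K(2)[OF t])
    also have "\<dots> \<le> K * \<bar>\<theta>\<bar> ^ k" using t assms(2) K(1) by (intro mult_left_mono power_decreasing) auto
    finally show "\<bar>h \<theta> x\<bar> \<le> K * \<bar>\<theta>\<bar> ^ k" .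
  qed
qed

lemma unif_O_add:
  assumes "unif_O k f" "unif_O k g"
  shows "unif_O k (\<lambda>\<theta> x. f \<theta> x + g \<theta> x)"
proof -
  obtain K where K: "0 \<le> K" "\<And>\<theta> x. \<bar>\<theta>\<bar> \<le> 1 \<Longrightarrow> \<bar>f \<theta> x\<bar> \<le> K * \<bar>\<theta>\<bar> ^ k"
    using unif_OE[OF assms(1)] by blast
  obtain L where L: "0 \<le> L" "\<And>\<theta> x. \<bar>\<theta>\<bar> \<le> 1 \<Longrightarrow> \<bar>g \<theta> x\<bar> \<le> L * \<bar>\<theta>\<bar> ^ k"
    using unif_OE[OF assms(2)] by blast
  show ?thesis
    by (rule unif_OI[of _ "K + L"]) (rule order_trans[OF abs_triangle_ineq], simp add: distrib_right K L add_mono)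
qed

lemma unif_O_mult:
  assumes "unif_O k f" "unif_O l g"
  shows "unif_O (k + l) (\<lambda>\<theta> x. f \<theta> x * g \<theta> x)"
proof -
  obtain K where K: "0 \<le> K" "\<And>\<theta> x. \<bar>\<theta>\<bar> \<le> 1 \<Longrightarrow> \<bar>f \<theta> x\<bar> \<le> K * \<bar>\<theta>\<bar> ^ k"
    using unif_OE[OF assms(1)] by blast
  obtain L where L: "0 \<le> L" "\<And>\<theta> x. \<bar>\<theta>\<bar> \<le> 1 \<Longrightarrow> \<bar>g \<theta> x\<bar> \<le> L * \<bar>\<theta>\<bar> ^ l"
    using unif_OE[OF assms(2)] by blast
  show ?thesis
  proof (rule unif_OI[of _ "K * L"])
    fix \<theta> x :: real assume t: "\<bar>\<theta>\<bar> \<le> 1"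
    have "\<bar>f \<theta> x * g \<theta> x\<bar> \<le> (K * \<bar>\<theta>\<bar> ^ k) * (L * \<bar>\<theta>\<bar> ^ l)"
      unfolding abs_mult using K L t by (intro mult_mono) auto
    thus "\<bar>f \<theta> x * g \<theta> x\<bar> \<le> K * L * \<bar>\<theta>\<bar> ^ (k + l)" by (simp add: power_add mult_ac)
  qed
qed

lemma unif_O_bounded: "(\<And>\<theta> x. \<bar>\<theta>\<bar> \<le> 1 \<Longrightarrow> \<bar>h \<theta> x\<bar> \<le> K) \<Longrightarrow> unif_O 0 h"
  by (rule unif_OI[of _ K]) simp

lemma unif_O_bounded_mult:
  assumes "unif_O k g" "\<And>\<theta> x. \<bar>\<theta>\<bar> \<le> 1 \<Longrightarrow> \<bar>f \<theta> x\<bar> \<le> K"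
  shows "unif_O k (\<lambda>\<theta> x. f \<theta> x * g \<theta> x)"
  using unif_O_mult[OF unif_O_bounded[of f K, OF assms(2)] assms(1)] by simp

lemma unif_O_cmult: "unif_O k g \<Longrightarrow> unif_O k (\<lambda>\<theta> x. c * g \<theta> x)"
  by (rule unif_O_bounded_mult[of k g _ "\<bar>c\<bar>"]) auto

lemma unif_O_diff: "unif_O k f \<Longrightarrow> unif_O k g \<Longrightarrow> unif_O k (\<lambda>\<theta> x. f \<theta> x - g \<theta> x)"
  using unif_O_add[of k f "\<lambda>\<theta> x. - 1 * g \<theta> x"] unif_O_cmult[of k g "-1"] by simp

lemma unif_O_power: "unif_O k (\<lambda>\<theta> x. \<theta> ^ k)"
  by (rule unif_OI[of _ 1]) (simp add: power_abs)

lemma unif_O_integral: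
  assumes "unif_O k h"
  shows "unif_O k (\<lambda>\<theta> x. integral {0..1} (h \<theta>))"
proof -
  obtain K where K: "0 \<le> K" "\<And>\<theta> x. \<bar>\<theta>\<bar> \<le> 1 \<Longrightarrow> \<bar>h \<theta> x\<bar> \<le> K * \<bar>\<theta>\<bar> ^ k"
    using unif_OE[OF assms(1)] by blast
  show ?thesis
  proof (rule unif_OI[of _ K])
    fix \<theta> :: real assume t: "\<bar>\<theta>\<bar> \<le> 1"
    show "\<bar>integral {0..1} (h \<theta>)\<bar> \<le> K * \<bar>\<theta>\<bar> ^ k"
    proof (cases "h \<theta> integrable_on {0..1}")
      case True
      have "norm (integral {0..1} (h \<theta>)) \<le> integral {0..1::real} (\<lambda>x. K * \<bar>\<theta>\<bar> ^ k)"
        by (rule integral_norm_bound_integral[OF True]) (use K(2)[OF t] in auto)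
      thus ?thesis by simp
    next
      \<comment> \<open>A nonintegrable function has integral 0 by convention.\<close>
      case False
      thus ?thesis using K(1) by (simp add: not_integrable_integral)
    qed
  qed
qed

lemma unif_O_transfer_op:
  assumes "unif_O k h" "0 < q"
  shows "unif_O k (\<lambda>\<theta> x. transfer_op q (h \<theta>) x)"
proof -
  obtain K where K: "0 \<le> K" "\<And>\<theta> x. \<bar>\<theta>\<bar> \<le> 1 \<Longrightarrow> \<bar>h \<theta> x\<bar> \<le> K * \<bar>\<theta>\<bar> ^ k"
    using unif_OE[OF assms(1)] by blast
  show ?thesis
  proof (rule unif_OI[of _ K])
    fix \<theta> x :: real assume t: "\<bar>\<theta>\<bar> \<le> 1"
    have "\<bar>\<Sum>j<q. h \<theta> ((x + real j) / real q)\<bar> \<le> (\<Sum>j<q. K * \<bar>\<theta>\<bar> ^ k)"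
      by (rule order_trans[OF sum_abs]) (intro sum_mono K(2)[OF t])
    thus "\<bar>transfer_op q (h \<theta>) x\<bar> \<le> K * \<bar>\<theta>\<bar> ^ k"
      using assms(2) by (simp add: transfer_op_def field_simps)
  qed
qed

lemma unif_O_exp_remainder:
  assumes "\<And>x. \<bar>S x\<bar> \<le> B"
  shows "unif_O n (\<lambda>\<theta> x. exp (\<theta> * S x) - (\<Sum>i<n. (\<theta> * S x) ^ i / fact i))"
proof (rule unif_OI[of _ "exp B * B ^ n"])
  fix \<theta> x :: real assume t: "\<bar>\<theta>\<bar> \<le> 1"
  have B: "0 \<le> B" using assms[of x] abs_ge_zero order_trans by blast
  have tS: "\<bar>\<theta> * S x\<bar> \<le> B"
    unfolding abs_mult using t assms[of x] mult_mono[of "\<bar>\<theta>\<bar>" 1 "\<bar>S x\<bar>" B] by simp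
  obtain t' where t': "\<bar>t'\<bar> \<le> \<bar>\<theta> * S x\<bar>"
    "exp (\<theta> * S x) = (\<Sum>i<n. (\<theta> * S x) ^ i / fact i) + exp t' / fact n * (\<theta> * S x) ^ n"
    using Maclaurin_exp_le by blast
  have "\<bar>exp (\<theta> * S x) - (\<Sum>i<n. (\<theta> * S x) ^ i / fact i)\<bar> = exp t' / fact n * (\<bar>S x\<bar> ^ n * \<bar>\<theta>\<bar> ^ n)"
    using t'(2) by (simp add: abs_mult power_abs power_mult_distrib mult_ac)
  also have "\<dots> \<le> exp B * (B ^ n * \<bar>\<theta>\<bar> ^ n)"
  proof (intro mult_mono power_mono assms)
    have "exp t' \<le> exp B" using t'(1) tS by simp
    moreover have "exp t' / fact n \<le> exp t' / 1" by (intro divide_left_mono) auto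
    ultimately show "exp t' / fact n \<le> exp B" unfolding div_by_1 by (rule order_trans[rotated])
  qed (auto simp: B)
  finally show "\<bar>exp (\<theta> * S x) - (\<Sum>i<n. (\<theta> * S x) ^ i / fact i)\<bar> \<le> exp B * B ^ n * \<bar>\<theta>\<bar> ^ n" by simp
qed

lemma unif_O_exp_1:
  assumes "\<And>x. \<bar>S x\<bar> \<le> B"
  shows "unif_O 1 (\<lambda>\<theta> x. exp (\<theta> * S x) - 1)"
  using unif_O_exp_remainder[OF assms, of 1] by simp

lemma unif_O_exp_2:
  assumes "\<And>x. \<bar>S x\<bar> \<le> B"
  shows "unif_O 2 (\<lambda>\<theta> x. exp (\<theta> * S x) - 1 - \<theta> * S x)"
  using unif_O_exp_remainder[OF assms, of 2] by (simp add: numeral_2_eq_2 algebra_simps)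

lemma exp_gcos_le: "\<bar>\<theta>\<bar> \<le> 1 \<Longrightarrow> \<bar>exp (\<theta> * gcos x)\<bar> \<le> exp 1"
proof -
  assume t: "\<bar>\<theta>\<bar> \<le> 1"
  have "\<theta> * gcos x \<le> \<bar>\<theta>\<bar> * \<bar>gcos x\<bar>" unfolding abs_mult[symmetric] by (rule abs_ge_self)
  also have "\<dots> \<le> 1 * 1" using t gcos_le[of x] by (intro mult_mono) auto
  finally show ?thesis by simp
qed

lemma unif_O_mgf_1: "unif_O 1 (\<lambda>\<theta> x. mgf q n \<theta> - 1)"
proof -
  have "integral {0..1} (\<lambda>x. exp (\<theta> * birkhoff_sum q n x) - 1) = mgf q n \<theta> - 1" for \<theta>
    unfolding mgf_def
    by (subst integral_diff) (auto intro!: integrable_continuous_real continuous_intros)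
  thus ?thesis
    using unif_O_integral[OF unif_O_exp_1[of "birkhoff_sum q n" "real n", OF birkhoff_sum_le]] by simp
qed

lemma mgf_le_exp: "\<bar>\<theta>\<bar> \<le> 1 \<Longrightarrow> \<bar>mgf q n (\<theta>::real)\<bar> \<le> exp (real n)"
proof -
  assume "\<bar>\<theta>\<bar> \<le> 1"
  hence "\<bar>\<theta>\<bar> * real n \<le> 1 * real n" by (intro mult_right_mono) auto
  hence "exp (\<bar>\<theta>\<bar> * real n) \<le> exp (real n)" by simp
  thus ?thesis using mgf_bounds[of q n \<theta>] by linarith
qed

lemma mgf_1_eq: "mgf q 1 \<theta> = integral {0..1} (\<lambda>x. exp (\<theta> * of_real (gcos x)))"
  by (simp add: mgf_def birkhoff_sum_def)

text \<open>In the exponential series the powers of g below q are replaced by their means, the power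
  q leaves the extra term in g, and the rest has order q + 1. Subtracting the full mean only adds
  the mean of that rest.\<close>

lemma transfer_op_exp_expansion:
  assumes q: "0 < q"
  shows "unif_O (Suc q) (\<lambda>\<theta> x. transfer_op q (\<lambda>y. exp (\<theta> * gcos y)) x
     - mgf q 1 \<theta> - 2 / 2 ^ q / fact q * (\<theta> ^ q * gcos x))"
proof -
  define P where "P \<theta> y = (\<Sum>i<Suc q. (\<theta> * gcos y) ^ i / fact i)" for \<theta> y
  define R where "R \<theta> y = exp (\<theta> * gcos y) - P \<theta> y" for \<theta> y
  have R: "unif_O (Suc q) R"
    unfolding R_def[abs_def] P_def by (rule unif_O_exp_remainder[OF gcos_le])
  have i: "(\<lambda>x. (\<theta> * gcos x) ^ i / fact i) integrable_on {0..1}" for \<theta> i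
    by (intro integrable_continuous_real continuous_intros) auto
  have TP: "transfer_op q (P \<theta>) x = integral {0..1} (P \<theta>) + 2 / 2 ^ q / fact q * (\<theta> ^ q * gcos x)" for \<theta> x
  proof -
    have "transfer_op q (P \<theta>) x = (\<Sum>i<Suc q. \<theta> ^ i / fact i * transfer_op q (\<lambda>y. gcos y ^ i) x)"
    proof -
      have "(\<Sum>j<q. P \<theta> ((x + real j) / real q)) = (\<Sum>i<Suc q. \<Sum>j<q. \<theta> ^ i / fact i * gcos ((x + real j) / real q) ^ i)"
        unfolding P_def by (subst sum.swap) (simp add: power_mult_distrib del: sum.lessThan_Suc)
      thus ?thesis unfolding transfer_op_def
        by (simp add: sum_distrib_left sum_divide_distrib mult.commute del: sum.lessThan_Suc)
    qed
    also have "\<dots> = (\<Sum>i<Suc q. \<theta> ^ i / fact i * integral {0..1} (\<lambda>x. gcos x ^ i) +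
        (if i = q then \<theta> ^ q / fact q * (2 / 2 ^ q * gcos x) else 0))"
      by (intro sum.cong refl) (subst transfer_op_gcos_power, use q in \<open>auto simp: distrib_left\<close>)
    also have "\<dots> = (\<Sum>i<Suc q. \<theta> ^ i / fact i * integral {0..1} (\<lambda>x. gcos x ^ i)) + \<theta> ^ q / fact q * (2 / 2 ^ q * gcos x)"
      unfolding sum.distrib by (subst sum.delta) auto
    also have "(\<Sum>i<Suc q. \<theta> ^ i / fact i * integral {0..1} (\<lambda>x. gcos x ^ i)) = (\<Sum>i<Suc q. integral {0..1} (\<lambda>x. (\<theta> * gcos x) ^ i / fact i))"
      by (simp add: power_mult_distrib del: sum.lessThan_Suc)
    also have "\<dots> = integral {0..1} (P \<theta>)"
      unfolding P_def[abs_def] by (rule integral_sum[symmetric]) (rule finite_lessThan i)+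
    finally show ?thesis by (simp add: mult_ac)
  qed
  have Pc: "continuous_on {0..1} (P \<theta>)" for \<theta>
    unfolding P_def[abs_def] by (intro continuous_intros) auto
  have I: "mgf q 1 \<theta> = integral {0..1} (P \<theta>) + integral {0..1} (R \<theta>)" for \<theta> :: real
  proof -
    have ei: "(\<lambda>x. exp (\<theta> * gcos x)) integrable_on {0..1}"
      by (intro integrable_continuous_real continuous_intros)
    have "integral {0..1} (R \<theta>) = integral {0..1} (\<lambda>x. exp (\<theta> * gcos x)) - integral {0..1} (P \<theta>)"
      unfolding R_def[abs_def] by (rule integral_diff[OF ei integrable_continuous_real[OF Pc]])
    thus ?thesis by (simp add: mgf_1_eq del: One_nat_def)
  qed
  have T: "transfer_op q (\<lambda>y. exp (\<theta> * gcos y)) x = transfer_op q (P \<theta>) x + transfer_op q (R \<theta>) x" for \<theta> x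
    by (simp add: transfer_op_def R_def add_divide_distrib[symmetric] sum.distrib[symmetric])
  have "transfer_op q (\<lambda>y. exp (\<theta> * gcos y)) x - mgf q 1 \<theta> - 2 / 2 ^ q / fact q * (\<theta> ^ q * gcos x)
     = transfer_op q (R \<theta>) x - integral {0..1} (R \<theta>)" for \<theta> x
    unfolding T TP I by simp
  moreover have "unif_O (Suc q) (\<lambda>\<theta> x. transfer_op q (R \<theta>) x - integral {0..1} (R \<theta>))"
    by (intro unif_O_diff unif_O_transfer_op unif_O_integral R q)
  ultimately show ?thesis by simp
qed

text \<open>The leading fluctuation is the same for all n \<ge> 1: it is created by the outermost
  application of the operator. The fluctuation inherited from the previous iterate is a multiple of
  g, whose sum over the preimages vanishes, so it survives only with an additional factor of order
  \<theta>.\<close>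

lemma transfer_iter_expansion:
  assumes q: "2 \<le> q"
  shows "unif_O (Suc q) (\<lambda>\<theta> x. transfer_iter q \<theta> n x - mgf q n \<theta> -
     (if n = 0 then 0 else 2 / 2 ^ q / fact q) * (\<theta> ^ q * gcos x))"
proof (induction n)
  case 0
  show ?case by (rule unif_OI[of _ 0]) (simp add: mgf_def birkhoff_sum_def)
next
  case (Suc n)
  have q0: "0 < q" using q by simp
  define c :: real where "c = 2 / 2 ^ q / fact q"
  define b where "b = (if n = 0 then 0 else c)"
  define e where "e \<theta> x = transfer_iter q \<theta> n x - mgf q n \<theta> - b * (\<theta> ^ q * gcos x)" for \<theta> x
  have e: "unif_O (Suc q) e" using Suc unfolding e_def[abs_def] b_def c_def by simp
  define d where "d \<theta> x = transfer_op q (\<lambda>y. exp (\<theta> * gcos y)) x - mgf q 1 \<theta> - c * (\<theta> ^ q * gcos x)" for \<theta> x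
  have d: "unif_O (Suc q) d" using transfer_op_exp_expansion[OF q0] unfolding d_def[abs_def] c_def .
  \<comment> \<open>Centred first at the product of the moment generating functions, which the
    recursion produces, and only afterwards at the true mean of the iterate.\<close>
  define r where "r \<theta> x = transfer_iter q \<theta> (Suc n) x - mgf q n \<theta> * mgf q 1 \<theta> - c * (\<theta> ^ q * gcos x)" for \<theta> x
  have "(\<Sum>j<q. gcos ((x + real j) / real q)) = 0" for x
    using transfer_op_gcos_0[of 1 q x] q by (simp add: transfer_op_def)
  \<comment> \<open>Replacing exp by exp - 1 is free here and gains one power of \<theta>.\<close>
  hence t0: "transfer_op q (\<lambda>y. exp (\<theta> * gcos y) * gcos y) x = transfer_op q (\<lambda>y. (exp (\<theta> * gcos y) - 1) * gcos y) x" for \<theta> x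
    by (simp add: transfer_op_def left_diff_distrib sum_subtractf)
  have r_eq: "r \<theta> x = mgf q n \<theta> * d \<theta> x + (c * ((mgf q n \<theta> - 1) * \<theta> ^ q)) * gcos x
      + b * (\<theta> ^ q * transfer_op q (\<lambda>y. (exp (\<theta> * gcos y) - 1) * gcos y) x)
      + transfer_op q (\<lambda>y. exp (\<theta> * gcos y) * e \<theta> y) x" for \<theta> x
  proof -
    have "transfer_iter q \<theta> n y = mgf q n \<theta> + b * (\<theta> ^ q * gcos y) + e \<theta> y" for y
      by (simp add: e_def)
    hence "transfer_iter q \<theta> (Suc n) x = mgf q n \<theta> * transfer_op q (\<lambda>y. exp (\<theta> * gcos y)) x
        + b * (\<theta> ^ q * transfer_op q (\<lambda>y. exp (\<theta> * gcos y) * gcos y) x)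
        + transfer_op q (\<lambda>y. exp (\<theta> * gcos y) * e \<theta> y) x"
      by (simp add: transfer_op_def distrib_left sum.distrib sum_distrib_left add_divide_distrib mult_ac)
    thus ?thesis unfolding r_def t0 by (simp add: d_def algebra_simps)
  qed
  have r: "unif_O (Suc q) r"
    unfolding r_eq[abs_def]
  proof (intro unif_O_add)
    show "unif_O (Suc q) (\<lambda>\<theta> x. mgf q n \<theta> * d \<theta> x)"
      by (rule unif_O_bounded_mult[OF d mgf_le_exp])
    have "unif_O (1 + q + 0) (\<lambda>\<theta> x. ((mgf q n \<theta> - 1) * \<theta> ^ q) * gcos x)"
      by (intro unif_O_mult unif_O_mgf_1 unif_O_power unif_O_bounded[of _ 1] gcos_le)
    from unif_O_cmult[OF this, of c]
    show "unif_O (Suc q) (\<lambda>\<theta> x. (c * ((mgf q n \<theta> - 1) * \<theta> ^ q)) * gcos x)" by (simp add: mult_ac)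
    have "unif_O (1 + 0) (\<lambda>\<theta> y. (exp (\<theta> * gcos y) - 1) * gcos y)"
      by (intro unif_O_mult unif_O_exp_1[of gcos 1] unif_O_bounded[of _ 1] gcos_le)
    from unif_O_cmult[OF unif_O_mult[OF unif_O_power[of q] unif_O_transfer_op[OF this q0]], of b]
    show "unif_O (Suc q) (\<lambda>\<theta> x. b * (\<theta> ^ q * transfer_op q (\<lambda>y. (exp (\<theta> * gcos y) - 1) * gcos y) x))"
      by simp
    show "unif_O (Suc q) (\<lambda>\<theta> x. transfer_op q (\<lambda>y. exp (\<theta> * gcos y) * e \<theta> y) x)"
      by (intro unif_O_transfer_op unif_O_bounded_mult[OF e exp_gcos_le] q0)
  qed
  have "integral {0..1} (r \<theta>) = mgf q (Suc n) \<theta> - mgf q n \<theta> * mgf q 1 \<theta>" for \<theta>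
  proof -
    have i: "transfer_iter q \<theta> (Suc n) integrable_on {0..1}" "gcos integrable_on {0..1}"
      using continuous_on_gcos[OF continuous_on_id]
      by (auto intro!: integrable_continuous_real continuous_on_transfer_iter simp del: transfer_iter.simps)
    have "(r \<theta> has_integral (mgf q (Suc n) \<theta> - mgf q n \<theta> * mgf q 1 \<theta> - c * (\<theta> ^ q * 0))) {0..1}"
      unfolding r_def[abs_def]
    proof (intro has_integral_diff has_integral_mult_right)
      show "(transfer_iter q \<theta> (Suc n) has_integral mgf q (Suc n) \<theta>) {0..1}"
        using integrable_integral[OF i(1)] by (simp only: mgf_eq_integral[OF q0])
      show "(gcos has_integral 0) {0..1}" using integrable_integral[OF i(2)] by (simp add: integral_gcos)
      show "((\<lambda>x. mgf q 1 \<theta>) has_integral mgf q 1 \<theta>) {0..1::real}"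
        using has_integral_const_real[of "mgf q 1 \<theta>" 0 1] by simp
    qed
    thus ?thesis by (simp add: integral_unique)
  qed
  \<comment> \<open>The difference of the two centrings is the mean of r, since g has mean 0; it has
    the same order as r.\<close>
  hence "transfer_iter q \<theta> (Suc n) x - mgf q (Suc n) \<theta> - c * (\<theta> ^ q * gcos x) = r \<theta> x - integral {0..1} (r \<theta>)" for \<theta> x
    by (simp add: r_def del: transfer_iter.simps)
  hence "unif_O (Suc q) (\<lambda>\<theta> x. transfer_iter q \<theta> (Suc n) x - mgf q (Suc n) \<theta> - c * (\<theta> ^ q * gcos x))"
    using unif_O_diff[OF r unif_O_integral[OF r]] by (simp del: transfer_iter.simps)
  thus ?case by (simp add: c_def del: transfer_iter.simps)
qed

text \<open>The fluctuation c \<theta>^q g of the iterate meets the linear term \<theta> g of the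
  exponential. As g^2 has mean 1/2, this contributes c / 2 = 1 / (2^q q!). For n = 0 there is no
  fluctuation.\<close>

lemma mgf_Suc_expansion:
  assumes q: "2 \<le> q" and n: "0 < n"
  shows "unif_O (q + 2) (\<lambda>\<theta> x. mgf q (Suc n) \<theta> - mgf q n \<theta> * mgf q 1 \<theta> - 1 / (2 ^ q * fact q) * \<theta> ^ Suc q)"
proof -
  have q0: "0 < q" using q by simp
  define c :: real where "c = 2 / 2 ^ q / fact q"
  define e where "e \<theta> x = transfer_iter q \<theta> n x - mgf q n \<theta> - c * (\<theta> ^ q * gcos x)" for \<theta> x
  have e: "unif_O (Suc q) e" using transfer_iter_expansion[OF q, of n] n unfolding e_def[abs_def] c_def by simp
  have ec: "continuous_on {0..1} (e \<theta>)" for \<theta>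
    unfolding e_def[abs_def] by (intro continuous_intros continuous_on_transfer_iter)
  \<comment> \<open>What is left of exp (\<theta> g) times the fluctuation of the iterate after
    removing the fluctuation itself, which integrates to 0, and the term c \<theta>^(q+1)
    g^2.\<close>
  define h where "h \<theta> x = (exp (\<theta> * gcos x) - 1 - \<theta> * gcos x) * (c * (\<theta> ^ q * gcos x)) + (exp (\<theta> * gcos x) - 1) * e \<theta> x" for \<theta> x
  have hc: "continuous_on {0..1} (h \<theta>)" for \<theta>
    unfolding h_def[abs_def] by (intro continuous_intros ec)
  have h: "unif_O (q + 2) h"
    unfolding h_def[abs_def]
  proof (rule unif_O_add)
    have "unif_O (2 + (q + 0)) (\<lambda>\<theta> x. (exp (\<theta> * gcos x) - 1 - \<theta> * gcos x) * (\<theta> ^ q * gcos x))"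
      by (intro unif_O_mult unif_O_exp_2[of gcos 1] unif_O_power unif_O_bounded[of _ 1] gcos_le)
    from unif_O_cmult[OF this, of c]
    show "unif_O (q + 2) (\<lambda>\<theta> x. (exp (\<theta> * gcos x) - 1 - \<theta> * gcos x) * (c * (\<theta> ^ q * gcos x)))"
      by (simp add: mult_ac)
    show "unif_O (q + 2) (\<lambda>\<theta> x. (exp (\<theta> * gcos x) - 1) * e \<theta> x)"
      using unif_O_mult[OF unif_O_exp_1[of gcos 1, OF gcos_le] e] by simp
  qed
  have "mgf q (Suc n) \<theta> - mgf q n \<theta> * mgf q 1 \<theta> - 1 / (2 ^ q * fact q) * \<theta> ^ Suc q = integral {0..1} (h \<theta>)" for \<theta> :: real
  proof -
    have i1: "(\<lambda>x. transfer_iter q \<theta> n x) integrable_on {0..1}"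
      by (intro integrable_continuous_real continuous_on_transfer_iter)
    have i2: "(\<lambda>x. gcos x * gcos x) integrable_on {0..1}" "(\<lambda>x. exp (\<theta> * gcos x)) integrable_on {0..1}"
      by (intro integrable_continuous_real continuous_intros)+
    have hi: "(h \<theta> has_integral integral {0..1} (h \<theta>)) {0..1}"
      by (intro integrable_integral integrable_continuous_real hc)
    have eq: "exp (\<theta> * gcos x) * transfer_iter q \<theta> n x =
      (mgf q n \<theta> * exp (\<theta> * gcos x) + (c * \<theta> ^ Suc q) * (gcos x * gcos x)) + (h \<theta> x + (transfer_iter q \<theta> n x - mgf q n \<theta>))" for x
      by (simp add: h_def e_def algebra_simps)
    have "((\<lambda>x. exp (\<theta> * gcos x) * transfer_iter q \<theta> n x) has_integral
      ((mgf q n \<theta> * mgf q 1 \<theta> + (c * \<theta> ^ Suc q) * (1 / 2)) + (integral {0..1} (h \<theta>) + (mgf q n \<theta> - mgf q n \<theta>)))) {0..1}"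
      unfolding eq
    proof (intro has_integral_add has_integral_diff has_integral_mult_right hi)
      show "((\<lambda>x. exp (\<theta> * gcos x)) has_integral mgf q 1 \<theta>) {0..1}"
        using integrable_integral[OF i2(2)] by (simp add: mgf_1_eq del: One_nat_def)
      show "((\<lambda>x. gcos x * gcos x) has_integral (1 / 2)) {0..1}"
        using integrable_integral[OF i2(1)] by (simp add: integral_gcos_squared)
      show "((\<lambda>x. transfer_iter q \<theta> n x) has_integral mgf q n \<theta>) {0..1}"
        using integrable_integral[OF i1] by (simp add: mgf_eq_integral[OF q0])
      show "((\<lambda>x. mgf q n \<theta>) has_integral mgf q n \<theta>) {0..1::real}"
        using has_integral_const_real[of "mgf q n \<theta>" 0 1] by simp
    qed
    hence I: "integral {0..1} (\<lambda>x. exp (\<theta> * gcos x) * transfer_iter q \<theta> n x) =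
       mgf q n \<theta> * mgf q 1 \<theta> + (c * \<theta> ^ Suc q) * (1 / 2) + integral {0..1} (h \<theta>)"
      by (simp add: integral_unique)
    have "mgf q (Suc n) \<theta> = integral {0..1} (transfer_op q (\<lambda>y. exp (\<theta> * gcos y) * transfer_iter q \<theta> n y))"
      by (simp add: mgf_eq_integral[OF q0])
    also have "\<dots> = integral {0..1} (\<lambda>x. exp (\<theta> * gcos x) * transfer_iter q \<theta> n x)"
      by (intro integral_transfer_op continuous_intros continuous_on_transfer_iter q0)
    finally show ?thesis unfolding I by (simp add: c_def)
  qed
  thus ?thesis using unif_O_integral[OF h] by simp
qed

lemma abs_ln_diff_le:
  fixes a b m :: real
  assumes "0 < m" "m \<le> a" "m \<le> b"
  shows "\<bar>ln a - ln b\<bar> \<le> \<bar>a - b\<bar> / m"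
proof -
  have *: "ln a - ln b \<le> \<bar>a - b\<bar> / m" if "0 < m" "m \<le> a" "m \<le> b" for a b :: real
  proof -
    have "ln a - ln b = ln (a / b)" using that by (simp add: ln_div)
    also have "\<dots> \<le> a / b - 1" using that by (intro ln_le_minus_one) auto
    also have "\<dots> = (a - b) / b" using that by (simp add: field_simps)
    also have "\<dots> \<le> \<bar>a - b\<bar> / b" using that by (intro divide_right_mono) auto
    also have "\<dots> \<le> \<bar>a - b\<bar> / m" using that by (intro divide_left_mono) auto
    finally show ?thesis .
  qed
  show ?thesis using *[OF assms] *[OF assms(1,3,2)] by (simp add: abs_le_iff abs_minus_commute)
qed

lemma abs_exp_minus_linear_le:
  fixes y :: real
  assumes "\<bar>y\<bar> \<le> 1"
  shows "\<bar>exp y - 1 - y\<bar> \<le> 2 * y\<^sup>2"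
proof -
  obtain t where t: "\<bar>t\<bar> \<le> \<bar>y\<bar>" "exp y = (\<Sum>m<2. y ^ m / fact m) + exp t / fact 2 * y\<^sup>2"
    using Maclaurin_exp_le by blast
  have "exp t \<le> exp 1" using t(1) assms by simp
  hence "exp t \<le> 3" using exp_le by linarith
  hence "exp t / 2 * y\<^sup>2 \<le> 2 * y\<^sup>2" by (intro mult_right_mono) auto
  moreover have "exp y - 1 - y = exp t / 2 * y\<^sup>2" using t(2) by (simp add: numeral_2_eq_2)
  moreover have "0 \<le> exp t / 2 * y\<^sup>2" by simp
  ultimately show ?thesis by linarith
qed

lemma ln_mgf_Suc_expansion:
  assumes q: "2 \<le> q" and n: "0 < n"
  shows "unif_O (q + 2) (\<lambda>\<theta> x. ln (mgf q (Suc n) \<theta>) - ln (mgf q n \<theta>) - ln (mgf q 1 \<theta>) - 1 / (2 ^ q * fact q) * \<theta> ^ Suc q)"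
proof -
  define c :: real where "c = 1 / (2 ^ q * fact q)"
  have c: "0 \<le> c" "c \<le> 1"
  proof -
    have "(1::real) * 1 \<le> 2 ^ q * fact q" by (intro mult_mono) (auto simp: fact_ge_1)
    thus "0 \<le> c" "c \<le> 1" by (auto simp: c_def field_simps)
  qed
  define y where "y \<theta> = c * \<theta> ^ Suc q" for \<theta>
  \<comment> \<open>The logarithm of \<open>b\<close> is exactly the desired approximation, so
    comparing logarithms reduces to comparing their arguments, both of which are at least exp
    (-1).\<close>
  define b where "b \<theta> = mgf q n \<theta> * mgf q 1 \<theta> * exp (y \<theta>)" for \<theta> :: real
  have y1: "\<bar>y \<theta>\<bar> \<le> 1" if "\<bar>\<theta>\<bar> \<le> 1" for \<theta>
    unfolding y_def abs_mult power_abs using c that mult_mono[of c 1 "\<bar>\<theta>\<bar> ^ Suc q" 1] power_le_one[of "\<bar>\<theta>\<bar>" "Suc q"] by simp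
  have y: "unif_O (Suc q) (\<lambda>\<theta> x. y \<theta>)"
    unfolding y_def by (intro unif_O_cmult unif_O_power)
  have ey: "unif_O (q + 2) (\<lambda>\<theta> x. exp (y \<theta>) - 1 - y \<theta>)"
  proof -
    have *: "unif_O (q + 2) (\<lambda>\<theta> x. 2 * (y \<theta> * y \<theta>))"
      using unif_O_mono[OF unif_O_mult[OF y y], of "q + 2"] by (intro unif_O_cmult) simp
    obtain K where K: "\<forall>(\<theta>::real) (x::real). \<bar>\<theta>\<bar> \<le> 1 \<longrightarrow> \<bar>2 * (y \<theta> * y \<theta>)\<bar> \<le> K * \<bar>\<theta>\<bar> ^ (q + 2)"
      using *[unfolded unif_O_def] ..
    show ?thesis
    proof (rule unif_OI[of _ K])
      fix \<theta> x :: real assume t: "\<bar>\<theta>\<bar> \<le> 1"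
      have "\<bar>exp (y \<theta>) - 1 - y \<theta>\<bar> \<le> \<bar>2 * (y \<theta> * y \<theta>)\<bar>"
        using abs_exp_minus_linear_le[OF y1[OF t]] by (simp add: power2_eq_square)
      also have "\<dots> \<le> K * \<bar>\<theta>\<bar> ^ (q + 2)" by (rule K[rule_format, OF t])
      finally show "\<bar>exp (y \<theta>) - 1 - y \<theta>\<bar> \<le> K * \<bar>\<theta>\<bar> ^ (q + 2)" .
    qed
  qed
  have diff: "unif_O (q + 2) (\<lambda>\<theta> x. mgf q (Suc n) \<theta> - b \<theta>)"
  proof -
    have eq: "mgf q (Suc n) \<theta> - b \<theta> = (mgf q (Suc n) \<theta> - mgf q n \<theta> * mgf q 1 \<theta> - c * \<theta> ^ Suc q)
       - mgf q n \<theta> * (mgf q 1 \<theta> * (exp (y \<theta>) - 1 - y \<theta>))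
       - (mgf q n \<theta> * ((mgf q 1 \<theta> - 1) * y \<theta>) + (mgf q n \<theta> - 1) * y \<theta>)" for \<theta>
    proof -
      have "A - N * M' * e = (A - N * M' - Y) - N * (M' * (e - 1 - Y)) - (N * ((M' - 1) * Y) + (N - 1) * Y)"
        for A N M' e Y :: real by algebra
      thus ?thesis unfolding b_def y_def .
    qed
    show ?thesis unfolding eq
    proof (rule unif_O_diff[OF unif_O_diff unif_O_add])
      show "unif_O (q + 2) (\<lambda>\<theta> x. mgf q (Suc n) \<theta> - mgf q n \<theta> * mgf q 1 \<theta> - c * \<theta> ^ Suc q)"
        using mgf_Suc_expansion[OF q n] unfolding c_def .
      show "unif_O (q + 2) (\<lambda>\<theta> x. mgf q n \<theta> * (mgf q 1 \<theta> * (exp (y \<theta>) - 1 - y \<theta>)))"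
        by (intro unif_O_bounded_mult[OF _ mgf_le_exp] ey)
      have *: "unif_O (q + 2) (\<lambda>\<theta> x. (mgf q m \<theta> - 1) * y \<theta>)" for m
        using unif_O_mult[OF unif_O_mgf_1 y] by simp
      show "unif_O (q + 2) (\<lambda>\<theta> x. mgf q n \<theta> * ((mgf q 1 \<theta> - 1) * y \<theta>))"
        by (rule unif_O_bounded_mult[OF * mgf_le_exp])
      show "unif_O (q + 2) (\<lambda>\<theta> x. (mgf q n \<theta> - 1) * y \<theta>)" by (rule *)
    qed
  qed
  obtain K where K: "\<forall>(\<theta>::real) (x::real). \<bar>\<theta>\<bar> \<le> 1 \<longrightarrow> \<bar>mgf q (Suc n) \<theta> - b \<theta>\<bar> \<le> K * \<bar>\<theta>\<bar> ^ (q + 2)"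
    using diff[unfolded unif_O_def] ..
  show ?thesis
  proof (rule unif_OI[of _ "K / exp (- 1)"])
    fix \<theta> x :: real assume t: "\<bar>\<theta>\<bar> \<le> 1"
    have ge1: "1 \<le> mgf q m \<theta>" for m using mgf_ge_1[of q m \<theta>] q by simp
    have nz: "mgf q m \<theta> \<noteq> 0" for m using ge1[of m] by simp
    have "ln (b \<theta>) = ln (mgf q n \<theta>) + ln (mgf q 1 \<theta>) + y \<theta>"
      using nz by (simp add: b_def ln_mult)
    hence "\<bar>ln (mgf q (Suc n) \<theta>) - ln (mgf q n \<theta>) - ln (mgf q 1 \<theta>) - 1 / (2 ^ q * fact q) * \<theta> ^ Suc q\<bar> =
        \<bar>ln (mgf q (Suc n) \<theta>) - ln (b \<theta>)\<bar>"
      by (simp add: y_def c_def)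
    also have "\<dots> \<le> \<bar>mgf q (Suc n) \<theta> - b \<theta>\<bar> / exp (- 1)"
    proof (rule abs_ln_diff_le)
      have "exp (-1) \<le> (1::real)" by simp
      thus "exp (- 1) \<le> mgf q (Suc n) \<theta>" using ge1[of "Suc n"] by linarith
      have "1 * 1 * exp (- 1) \<le> b \<theta>"
        unfolding b_def using y1[OF t] ge1 less_imp_le[OF mgf_bounds(2)[of q _ \<theta>]] by (intro mult_mono mult_nonneg_nonneg) (auto simp: abs_le_iff)
      thus "exp (- 1) \<le> b \<theta>" by simp
    qed simp
    also have "\<dots> \<le> K * \<bar>\<theta>\<bar> ^ (q + 2) / exp (- 1)"
      by (intro divide_right_mono K[rule_format] t) auto
    finally show "\<bar>ln (mgf q (Suc n) \<theta>) - ln (mgf q n \<theta>) - ln (mgf q 1 \<theta>) - 1 / (2 ^ q * fact q) * \<theta> ^ Suc q\<bar>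
       \<le> K / exp (- 1) * \<bar>\<theta>\<bar> ^ (q + 2)" by simp
  qed
qed

text \<open>A sum of n + 1 terms has n junctions, each contributing \<theta>^(q+1) / (2^q
  q!).\<close>

lemma ln_mgf_expansion:
  assumes q: "2 \<le> q"
  shows "unif_O (q + 2) (\<lambda>\<theta> x. ln (mgf q (Suc n) \<theta>) - real (Suc n) * ln (mgf q 1 \<theta>) - real n / (2 ^ q * fact q) * \<theta> ^ Suc q)"
proof (induction n)
  case 0
  show ?case by (rule unif_OI[of _ 0]) simp
next
  case (Suc n)
  have "ln (mgf q (Suc (Suc n)) \<theta>) - real (Suc (Suc n)) * ln (mgf q 1 \<theta>) - real (Suc n) / (2 ^ q * fact q) * \<theta> ^ Suc q =
    (ln (mgf q (Suc (Suc n)) \<theta>) - ln (mgf q (Suc n) \<theta>) - ln (mgf q 1 \<theta>) - 1 / (2 ^ q * fact q) * \<theta> ^ Suc q)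
    + (ln (mgf q (Suc n) \<theta>) - real (Suc n) * ln (mgf q 1 \<theta>) - real n / (2 ^ q * fact q) * \<theta> ^ Suc q)" for \<theta> :: real
  proof -
    have "real (Suc n) / (2 ^ q * fact q) * \<theta> ^ Suc q = 1 / (2 ^ q * fact q) * \<theta> ^ Suc q + real n / (2 ^ q * fact q) * \<theta> ^ Suc q"
      unfolding distrib_right[symmetric] add_divide_distrib[symmetric] by simp
    moreover have "real (Suc (Suc n)) * ln (mgf q 1 \<theta>) = ln (mgf q 1 \<theta>) + real (Suc n) * ln (mgf q 1 \<theta>)"
      by (simp add: algebra_simps)
    ultimately show ?thesis by simp
  qed
  note eq = this
  show ?case unfolding eq by (rule unif_O_add[OF ln_mgf_Suc_expansion[OF q] Suc]) simp
qed

text \<open>Mean 0 and variance 1/2 of the arcsine law. The positive second derivative makes the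
  derivative locally invertible at 0, as the Legendre transforms require.\<close>

lemma ln_mgf_1_expansion: "unif_O 3 (\<lambda>\<theta> x. ln (mgf q 1 \<theta>) - \<theta>\<^sup>2 / 4)"
proof -
  define R where "R \<theta> x = exp (\<theta> * gcos x) - 1 - \<theta> * gcos x - \<theta>\<^sup>2 / 2 * (gcos x * gcos x)" for \<theta> x
  have R: "unif_O 3 R"
    using unif_O_exp_remainder[of gcos 1 3, OF gcos_le]
    unfolding R_def[abs_def] by (simp add: eval_nat_numeral power2_eq_square algebra_simps)
  have I: "mgf q 1 \<theta> - 1 - \<theta>\<^sup>2 / 4 = integral {0..1} (R \<theta>)" for \<theta> :: real
  proof -
    have ii: "(\<lambda>x. gcos x * gcos x) integrable_on {0..1}" "(\<lambda>x. exp (\<theta> * gcos x)) integrable_on {0..1}" "gcos integrable_on {0..1}"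
      by (intro integrable_continuous_real continuous_intros continuous_on_gcos[OF continuous_on_id])+
    have "(R \<theta> has_integral (mgf q 1 \<theta> - 1 - \<theta> * 0 - \<theta>\<^sup>2 / 2 * (1 / 2))) {0..1}"
      unfolding R_def[abs_def]
    proof (intro has_integral_diff has_integral_mult_right)
      show "((\<lambda>x. exp (\<theta> * gcos x)) has_integral mgf q 1 \<theta>) {0..1}"
        using integrable_integral[OF ii(2)] by (simp add: mgf_1_eq del: One_nat_def)
      show "((\<lambda>x. gcos x * gcos x) has_integral (1 / 2)) {0..1}"
        using integrable_integral[OF ii(1)] by (simp add: integral_gcos_squared)
      show "(gcos has_integral 0) {0..1}"
        using integrable_integral[OF ii(3)] by (simp add: integral_gcos)
      show "((\<lambda>x. 1) has_integral (1::real)) {0..1::real}"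
        using has_integral_const_real[of "1::real" 0 1] by simp
    qed
    thus ?thesis by (simp add: integral_unique)
  qed
  have A: "unif_O 3 (\<lambda>\<theta> x. mgf q 1 \<theta> - 1 - \<theta>\<^sup>2 / 4)"
    unfolding I by (rule unif_O_integral[OF R])
  have "unif_O 3 (\<lambda>\<theta> x. exp (\<theta>\<^sup>2 / 4) - 1 - \<theta>\<^sup>2 / 4)"
  proof (rule unif_OI[of _ 1])
    fix \<theta> :: real assume t: "\<bar>\<theta>\<bar> \<le> 1"
    have t2: "\<theta>\<^sup>2 \<le> 1" using t by (simp add: abs_square_le_1)
    have "\<bar>exp (\<theta>\<^sup>2 / 4) - 1 - \<theta>\<^sup>2 / 4\<bar> \<le> 2 * (\<theta>\<^sup>2 / 4)\<^sup>2"
      by (rule abs_exp_minus_linear_le) (use t2 in simp)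
    also have "\<dots> = \<bar>\<theta>\<bar> ^ 4 / 8" by (simp add: power_divide flip: power_mult)
    also have "\<dots> \<le> \<bar>\<theta>\<bar> ^ 3" using t power_decreasing[of 3 4 "\<bar>\<theta>\<bar>"] zero_le_power[of "\<bar>\<theta>\<bar>" 3] by linarith
    finally show "\<bar>exp (\<theta>\<^sup>2 / 4) - 1 - \<theta>\<^sup>2 / 4\<bar> \<le> 1 * \<bar>\<theta>\<bar> ^ 3" by simp
  qed
  from unif_O_diff[OF A this] have "unif_O 3 (\<lambda>\<theta> x. mgf q 1 \<theta> - exp (\<theta>\<^sup>2 / 4))" by simp
  then obtain K where K: "\<forall>(\<theta>::real) (x::real). \<bar>\<theta>\<bar> \<le> 1 \<longrightarrow> \<bar>mgf q 1 \<theta> - exp (\<theta>\<^sup>2 / 4)\<bar> \<le> K * \<bar>\<theta>\<bar> ^ 3"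
    unfolding unif_O_def ..
  have ge1: "1 \<le> mgf q 1 \<theta>" for \<theta> :: real
    \<comment> \<open>Here \<open>q\<close> may be 0, whereas \<open>mgf_ge_1\<close> asks for a
      positive parameter; for a single summand the value is the same for all parameters.\<close>
    using mgf_ge_1[of 1 1 \<theta>] by (simp add: mgf_1_eq del: One_nat_def)
  show ?thesis
  proof (rule unif_OI[of _ K])
    fix \<theta> :: real assume t: "\<bar>\<theta>\<bar> \<le> 1"
    have "\<bar>ln (mgf q 1 \<theta>) - ln (exp (\<theta>\<^sup>2 / 4))\<bar> \<le> \<bar>mgf q 1 \<theta> - exp (\<theta>\<^sup>2 / 4)\<bar> / 1"
      by (rule abs_ln_diff_le) (use ge1 in auto)
    thus "\<bar>ln (mgf q 1 \<theta>) - \<theta>\<^sup>2 / 4\<bar> \<le> K * \<bar>\<theta>\<bar> ^ 3" using K[rule_format, OF t] by simp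
  qed
qed

section \<open>Legendre transforms at the origin\<close>

text \<open>The bridge that lets derivatives of real functions be computed from their holomorphic
  extensions, where limits and Taylor expansions are easy to differentiate.\<close>

lemma deriv_of_real_restriction:
  assumes S: "open S" and G: "G holomorphic_on S" and g: "\<And>x. of_real x \<in> S \<Longrightarrow> G (of_real x) = of_real (g x)"
    and x: "complex_of_real x \<in> S"
  shows "(g has_real_derivative deriv g x) (at x)" and "deriv G (of_real x) = of_real (deriv g x)"
proof -
  let ?D = "deriv G (of_real x)"
  have T: "open {t. complex_of_real t \<in> S}"
    using continuous_open_vimage[of S complex_of_real] S by (simp add: vimage_def)
  have "(G has_field_derivative ?D) (at (of_real x))"
    using holomorphic_derivI[OF G S x] .
  hence "((\<lambda>t. G (of_real t)) has_vector_derivative ?D) (at x)"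
    by (rule has_vector_derivative_real_field)
  hence *: "((\<lambda>t. complex_of_real (g t)) has_vector_derivative ?D) (at x)"
    by (rule has_vector_derivative_transform_within_open[OF _ T]) (use x g in auto)
  have "((\<lambda>t. Re (complex_of_real (g t))) has_vector_derivative Re ?D) (at x)"
    by (rule bounded_linear.has_vector_derivative[OF bounded_linear_Re *])
  hence re: "(g has_real_derivative Re ?D) (at x)"
    by (simp add: has_real_derivative_iff_has_vector_derivative)
  have "((\<lambda>t. Im (complex_of_real (g t))) has_vector_derivative Im ?D) (at x)"
    by (rule bounded_linear.has_vector_derivative[OF bounded_linear_Im *])
  hence "((\<lambda>t. 0) has_real_derivative Im ?D) (at x)"
    by (simp add: has_real_derivative_iff_has_vector_derivative)
  hence im: "Im ?D = 0" using DERIV_unique[OF _ DERIV_const] by blast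
  have d: "deriv g x = Re ?D" by (rule DERIV_imp_deriv[OF re])
  show "(g has_real_derivative deriv g x) (at x)" using re unfolding d .
  show "deriv G (of_real x) = of_real (deriv g x)" using im unfolding d by (simp add: complex_eq_iff)
qed

lemma higher_deriv_of_real_restriction:
  assumes S: "open S" and F: "F holomorphic_on S" and f: "\<And>x. of_real x \<in> S \<Longrightarrow> F (of_real x) = of_real (f x)"
    and x: "complex_of_real x \<in> S"
  shows "(deriv ^^ m) F (of_real x) = of_real ((deriv ^^ m) f x)"
  using x
proof (induction m arbitrary: x)
  case 0
  thus ?case using f by simp
next
  case (Suc m)
  have "deriv ((deriv ^^ m) F) (of_real x) = of_real (deriv ((deriv ^^ m) f) x)"
    by (rule deriv_of_real_restriction(2)[OF S holomorphic_higher_deriv[OF F S] Suc.IH Suc.prems])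
  thus ?case by simp
qed

lemma times_differentiable_at_of_real_restriction:
  assumes S: "open S" and F: "F holomorphic_on S" and f: "\<And>x. of_real x \<in> S \<Longrightarrow> F (of_real x) = of_real (f x)"
    and x: "complex_of_real x \<in> S"
  shows "times_differentiable_at m f x"
  using x
proof (induction m arbitrary: x)
  case (Suc m)
  have T: "open {t. complex_of_real t \<in> S}"
    using continuous_open_vimage[of S complex_of_real] S by (simp add: vimage_def)
  have "\<forall>\<^sub>F t in nhds x. t \<in> {t. complex_of_real t \<in> S}"
    by (rule eventually_nhds_in_open[OF T]) (use Suc.prems in simp)
  hence "\<forall>\<^sub>F t in nhds x. times_differentiable_at m f t"
    by eventually_elim (use Suc.IH in simp)
  moreover have "((deriv ^^ m) f has_real_derivative deriv ((deriv ^^ m) f) x) (at x)"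
    by (rule deriv_of_real_restriction(1)[OF S holomorphic_higher_deriv[OF F S]
          higher_deriv_of_real_restriction[OF S F f] Suc.prems])
  ultimately show ?case
    by (auto simp: real_differentiable_def)
qed simp

text \<open>The order of a zero of a holomorphic function can be read off on the real axis. At the
  first nonvanishing order m one has F = z^m g with g 0 \<noteq> 0, but if m \<le> k the bound
  forces g to tend to 0 along the positive axis.\<close>

lemma higher_deriv_eq_0_if_bounded:
  assumes S: "open S" "0 \<in> S" and F: "F holomorphic_on S" and r: "0 < r"
    and bound: "\<And>\<theta>. \<bar>\<theta>\<bar> < r \<Longrightarrow> cmod (F (of_real \<theta>)) \<le> K * \<bar>\<theta>\<bar> ^ Suc k"
  shows "m \<le> k \<Longrightarrow> (deriv ^^ m) F 0 = 0"
proof (induction m rule: less_induct)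
  case (less m)
  have F0: "F 0 = 0" using bound[of 0] r by simp
  show ?case
  proof (cases "m = 0")
    case False
    show ?thesis
    proof (rule ccontr)
      assume nz: "(deriv ^^ m) F 0 \<noteq> 0"
      obtain g d where g: "0 < d" "g holomorphic_on ball 0 d"
          "\<And>w. w \<in> ball 0 d \<Longrightarrow> F w - F 0 = (w - 0) ^ m * g w" "\<And>w. w \<in> ball 0 d \<Longrightarrow> g w \<noteq> 0"
        by (rule holomorphic_factor_order_of_zero[OF F S _ nz]) (use False less in auto)
      define e where "e = min d r"
      have e: "0 < e" using g(1) r by (simp add: e_def)
      have g_le: "cmod (g (of_real \<theta>)) \<le> K * \<bar>\<theta>\<bar> ^ (Suc k - m)" if \<theta>: "0 < \<theta>" "\<theta> < e" for \<theta>
      proof -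
        have \<theta>': "\<theta> < d" "\<theta> < r" using \<theta> by (auto simp: e_def)
        have "\<bar>\<theta>\<bar> ^ m * cmod (g (of_real \<theta>)) = cmod (F (of_real \<theta>))"
          using g(3)[of "of_real \<theta>"] \<theta> \<theta>' F0 by (simp add: norm_mult norm_power)
        also have "\<dots> \<le> K * \<bar>\<theta>\<bar> ^ Suc k" by (rule bound) (use \<theta> \<theta>' in simp)
        also have "\<dots> = \<bar>\<theta>\<bar> ^ m * (K * \<bar>\<theta>\<bar> ^ (Suc k - m))"
          using less.prems by (simp flip: power_add)
        finally show ?thesis by (rule mult_left_le_imp_le) (use \<theta> in simp)
      qed
      have "isCont g 0"
        using holomorphic_on_imp_continuous_on[OF g(2)] g(1) by (simp add: continuous_on_eq_continuous_at)
      hence "((\<lambda>\<theta>. cmod (g (of_real \<theta>))) \<longlongrightarrow> cmod (g (of_real 0))) (at_right (0::real))"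
        by (intro tendsto_norm isCont_tendsto_compose[of _ g] tendsto_intros) simp
      moreover have "((\<lambda>\<theta>::real. K * \<bar>\<theta>\<bar> ^ (Suc k - m)) \<longlongrightarrow> K * \<bar>0\<bar> ^ (Suc k - m)) (at_right (0::real))"
        by (intro tendsto_intros)
      moreover have "\<forall>\<^sub>F \<theta> in at_right (0::real). cmod (g (of_real \<theta>)) \<le> K * \<bar>\<theta>\<bar> ^ (Suc k - m)"
        using eventually_at_right_real[OF e] by eventually_elim (use g_le in auto)
      ultimately have "cmod (g (of_real 0)) \<le> K * \<bar>0\<bar> ^ (Suc k - m)"
        by (intro tendsto_le[OF trivial_limit_at_right_real])
      hence "g 0 = 0" using less.prems by (simp add: power_0_left)
      thus False using g(1,4) by simp
    qed
  qed (use F0 in simp)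
qed

lemma bounded_if_higher_deriv_eq_0:
  assumes S: "open S" "0 \<in> S" and F: "F holomorphic_on S"
    and zero: "\<And>m. m \<le> k \<Longrightarrow> (deriv ^^ m) F 0 = 0"
  obtains r K where "0 < r" "\<forall>z. cmod z < r \<longrightarrow> cmod (F z) \<le> K * cmod z ^ Suc k"
proof -
  obtain r where r: "0 < r" "cball 0 r \<subseteq> S" using S open_contains_cball by blast
  have hol: "(deriv ^^ m) F holomorphic_on S" for m by (rule holomorphic_higher_deriv[OF F S(1)])
  have "continuous_on (cball 0 r) ((deriv ^^ Suc k) F)"
    using holomorphic_on_imp_continuous_on[OF hol] continuous_on_subset r(2) by blast
  hence "bounded ((deriv ^^ Suc k) F ` cball 0 r)"
    by (intro compact_imp_bounded compact_continuous_image compact_cball)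
  then obtain B where "\<forall>w\<in>(deriv ^^ Suc k) F ` cball 0 r. cmod w \<le> B"
    unfolding bounded_iff ..
  hence B: "\<forall>z\<in>cball 0 r. cmod ((deriv ^^ Suc k) F z) \<le> B" by blast
  have "cmod (F z) \<le> (B / fact k) * cmod z ^ Suc k" if z: "cmod z < r" for z
  proof -
    have "cmod ((deriv ^^ 0) F z - (\<Sum>i\<le>k. (deriv ^^ i) F 0 * (z - 0) ^ i / fact i)) \<le> B * cmod (z - 0) ^ Suc k / fact k"
    proof (rule complex_Taylor[of "cball 0 r" k "\<lambda>i. (deriv ^^ i) F"])
      fix i x assume x: "x \<in> cball (0::complex) r"
      have "((deriv ^^ i) F has_field_derivative deriv ((deriv ^^ i) F) x) (at x)"
        by (rule holomorphic_derivI[OF hol S(1)]) (use x r in auto)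
      thus "((deriv ^^ i) F has_field_derivative (deriv ^^ Suc i) F x) (at x within cball 0 r)"
        by (simp add: has_field_derivative_at_within)
    qed (use B z r in auto)
    moreover have "(\<Sum>i\<le>k. (deriv ^^ i) F 0 * (z - 0) ^ i / fact i) = 0" by (simp add: zero)
    ultimately show ?thesis by simp
  qed
  thus thesis using that r(1) by blast
qed

lemma legendre_transform_eq:
  assumes conv: "convex_on UNIV f" and D: "(f has_real_derivative y) (at t)"
  shows "legendre_transform f y = ereal (t * y - f t)"
  unfolding legendre_transform_def
proof (rule antisym)
  show "(SUP \<theta>. ereal (\<theta> * y - f \<theta>)) \<le> ereal (t * y - f t)"
  proof (rule SUP_least)
    fix \<theta>
    have "f \<theta> - f t \<ge> y * (\<theta> - t)"
      by (rule convex_on_imp_above_tangent[OF conv]) (use D in auto)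
    thus "ereal (\<theta> * y - f \<theta>) \<le> ereal (t * y - f t)" by (simp add: algebra_simps)
  qed
  show "ereal (t * y - f t) \<le> (SUP \<theta>. ereal (\<theta> * y - f \<theta>))"
    by (rule SUP_upper) simp
qed

text \<open>The maximiser \<tau> y solves f' t = y, and f' is the restriction of a map that is
  locally biholomorphic at 0. So \<tau> extends to the holomorphic inverse g, and the transform to g
  z z - F (g z). The bound on \<tau> serves to compare two transforms.\<close>

lemma legendre_transform_local:
  assumes conv: "convex_on UNIV f" and S: "open S" "0 \<in> S" and F: "F holomorphic_on S"
    and fo: "\<forall>x. of_real x \<in> S \<longrightarrow> F (of_real x) = of_real (f x)"
    and d1: "deriv f 0 = 0" and d2: "0 < deriv (deriv f) 0"
  shows "\<exists>\<rho> C \<tau> G. 0 < \<rho> \<and> 0 \<le> C \<and> G holomorphic_on ball 0 \<rho> \<and>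
    (\<forall>y. \<bar>y\<bar> < \<rho> \<longrightarrow> legendre_transform f y = ereal (\<tau> y * y - f (\<tau> y)) \<and> \<bar>\<tau> y\<bar> \<le> C * \<bar>y\<bar> \<and>
       G (of_real y) = of_real (\<tau> y * y - f (\<tau> y)))"
proof -
  have f: "F (of_real x) = of_real (f x)" if "of_real x \<in> S" for x using fo that by blast
  let ?F' = "deriv F" and ?f' = "deriv f"
  have F': "?F' holomorphic_on S" by (rule holomorphic_deriv[OF F S(1)])
  have f': "?F' (of_real x) = of_real (?f' x)" if "of_real x \<in> S" for x
    using deriv_of_real_restriction(2)[OF S(1) F f that] .
  have 0: "of_real 0 \<in> S" using S(2) by simp
  have "deriv ?F' (of_real 0) = of_real (deriv ?f' 0)"
    by (rule deriv_of_real_restriction(2)[OF S(1) F' f' 0])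
  hence "deriv ?F' 0 \<noteq> 0" using d2 by simp
  then obtain r where r: "0 < r" "ball 0 r \<subseteq> S" "inj_on ?F' (ball 0 r)"
    using has_complex_derivative_locally_injective[OF F' S(2,1)] by blast
  have F'r: "?F' holomorphic_on ball 0 r" using F' r(2) holomorphic_on_subset by blast
  obtain g where g: "g holomorphic_on (?F' ` ball 0 r)" "\<And>z. z \<in> ball 0 r \<Longrightarrow> deriv ?F' z * deriv g (?F' z) = 1"
      "\<And>z. z \<in> ball 0 r \<Longrightarrow> g (?F' z) = z"
    by (rule holomorphic_has_inverse[OF F'r open_ball r(3)]) (rule that)
  have op: "open (?F' ` ball 0 r)" by (rule open_mapping_thm3[OF F'r open_ball r(3)])
  have F'0: "?F' 0 = 0" using f'[of 0] 0 d1 by simp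
  hence "0 \<in> ?F' ` ball 0 r" using r(1) by (metis centre_in_ball imageI)
  then obtain \<rho>1 where \<rho>1: "0 < \<rho>1" "ball 0 \<rho>1 \<subseteq> ?F' ` ball 0 r" using op openE by blast
  have gball: "g z \<in> ball 0 r" if "z \<in> ball 0 \<rho>1" for z
  proof -
    obtain w where "w \<in> ball 0 r" "z = ?F' w" using \<rho>1(2) \<open>z \<in> ball 0 \<rho>1\<close> by blast
    thus ?thesis using g(3) by simp
  qed
  have g0: "g 0 = 0" using g(3)[of 0] r(1) F'0 by simp
  have ghol: "g holomorphic_on ball 0 \<rho>1" using g(1) \<rho>1(2) holomorphic_on_subset by blast
  have inS: "complex_of_real t \<in> S" if "\<bar>t\<bar> < r" for t using r(2) that by auto
  have f'': "(?f' has_real_derivative deriv ?f' t) (at t)" if "\<bar>t\<bar> < r" for t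
    by (rule deriv_of_real_restriction(1)[OF S(1) F' f' inS[OF that]])
  have D0: "(?f' has_real_derivative deriv ?f' 0) (at 0)" by (rule f'') (use r in simp)
  obtain a where a: "0 < a" "\<forall>h>0. h < a \<longrightarrow> ?f' 0 < ?f' (0 + h)"
    using DERIV_pos_inc_right[OF D0 d2] by (elim exE conjE)
  obtain b where b: "0 < b" "\<forall>h>0. h < b \<longrightarrow> ?f' (0 - h) < ?f' 0"
    using DERIV_pos_inc_left[OF D0 d2] by (elim exE conjE)
  \<comment> \<open>The complex inverse must be shown to be real on the real axis. As f' changes
    sign between -t0 and t0, the intermediate value theorem gives a real solution of f' t = y, and
    by injectivity the inverse returns it.\<close>
  define t0 where "t0 = min r (min a b) / 2"
  have t0: "0 < t0" "t0 < r" "t0 < a" "t0 < b" using r a b by (auto simp: t0_def)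
  have pos: "0 < ?f' t0" using a(2)[rule_format, OF t0(1,3)] d1 by simp
  have neg: "?f' (- t0) < 0" using b(2)[rule_format, OF t0(1,4)] d1 by simp
  have cont: "continuous_on {-t0..t0} ?f'"
  proof (rule DERIV_atLeastAtMost_imp_continuous_on)
    fix x assume "-t0 \<le> x" "x \<le> t0"
    hence "\<bar>x\<bar> < r" using t0 by auto
    thus "\<exists>y. (?f' has_real_derivative y) (at x)" using f'' by blast
  qed
  have "(g has_field_derivative deriv g 0) (at 0)"
    by (rule holomorphic_derivI[OF ghol open_ball]) (use \<rho>1 in simp)
  hence "((\<lambda>z. (g z - g 0) / (z - 0)) \<longlongrightarrow> deriv g 0) (at 0)" by (simp only: has_field_derivative_iff)
  hence "\<forall>\<^sub>F z in at 0. dist ((g z - g 0) / (z - 0)) (deriv g 0) < 1" by (rule tendstoD) simp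
  then obtain \<rho>2 where \<rho>2: "0 < \<rho>2" "\<And>z. z \<noteq> 0 \<Longrightarrow> dist z 0 < \<rho>2 \<Longrightarrow> dist ((g z - g 0) / (z - 0)) (deriv g 0) < 1"
    unfolding eventually_at by blast
  define C where "C = cmod (deriv g 0) + 1"
  have g_le: "cmod (g z) \<le> C * cmod z" if z: "cmod z < \<rho>2" for z
  proof (cases "z = 0")
    case False
    have "cmod (g z / z) \<le> C"
      using \<rho>2(2)[OF False] z norm_triangle_sub[of "g z / z" "deriv g 0"] by (simp add: g0 C_def dist_norm)
    thus ?thesis using False by (simp add: norm_divide field_simps)
  qed (simp add: g0)
  define \<rho> where "\<rho> = min (min \<rho>1 \<rho>2) (min (?f' t0) (- ?f' (- t0)))"
  have \<rho>: "0 < \<rho>" "\<rho> \<le> \<rho>1" "\<rho> \<le> \<rho>2" "\<rho> \<le> ?f' t0" "\<rho> \<le> - ?f' (- t0)"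
    using \<rho>1 \<rho>2 pos neg by (auto simp: \<rho>_def)
  define \<tau> where "\<tau> y = Re (g (of_real y))" for y
  have key: "g (of_real y) = of_real (\<tau> y) \<and> ?f' (\<tau> y) = y \<and> \<bar>\<tau> y\<bar> < r" if y: "\<bar>y\<bar> < \<rho>" for y
  proof -
    have "\<exists>t. - t0 \<le> t \<and> t \<le> t0 \<and> ?f' t = y"
      by (rule IVT'[OF _ _ _ cont]) (use y \<rho> t0 in auto)
    then obtain t where t: "- t0 \<le> t" "t \<le> t0" "?f' t = y" by blast
    have tr: "\<bar>t\<bar> < r" using t t0 by auto
    have "g (of_real y) = of_real t"
      using g(3)[of "of_real t"] f'[OF inS[OF tr]] tr t(3) by simp
    thus ?thesis using t tr by (simp add: \<tau>_def)
  qed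
  show ?thesis
  proof (rule exI[of _ \<rho>], rule exI[of _ C], rule exI[of _ \<tau>], rule exI[of _ "\<lambda>z. g z * z - F (g z)"], intro conjI allI impI)
    show "0 < \<rho>" by fact
    show "0 \<le> C" by (simp add: C_def)
    have sub: "g holomorphic_on ball 0 \<rho>" using ghol \<rho>(2) by (rule_tac holomorphic_on_subset) auto
    have "(F \<circ> g) holomorphic_on ball 0 \<rho>"
      by (rule holomorphic_on_compose_gen[OF sub F]) (use gball r(2) \<rho>(2) in fastforce)
    thus "(\<lambda>z. g z * z - F (g z)) holomorphic_on ball 0 \<rho>"
      unfolding o_def by (intro holomorphic_intros sub)
    fix y :: real assume y: "\<bar>y\<bar> < \<rho>"
    note k = key[OF y]
    have "(f has_real_derivative ?f' (\<tau> y)) (at (\<tau> y))"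
      by (rule deriv_of_real_restriction(1)[OF S(1) F f inS]) (use k in auto)
    thus "legendre_transform f y = ereal (\<tau> y * y - f (\<tau> y))"
      using legendre_transform_eq[OF conv] k by simp
    show "\<bar>\<tau> y\<bar> \<le> C * \<bar>y\<bar>"
      using g_le[of "of_real y"] k y \<rho>(3) by simp
    show "g (of_real y) * of_real y - F (g (of_real y)) = of_real (\<tau> y * y - f (\<tau> y))"
      using k f[OF inS] by simp
  qed
qed

text \<open>Each maximiser competes in the other supremum, so f and h have to be compared at the two
  maximisers only.\<close>

lemma legendre_transform_diff_le:
  assumes 1: "legendre_transform f y = ereal (s * y - f s)" and 2: "legendre_transform h y = ereal (t * y - h t)"
    and s: "\<bar>f s - h s\<bar> \<le> B" and t: "\<bar>f t - h t\<bar> \<le> B"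
  shows "\<bar>(s * y - f s) - (t * y - h t)\<bar> \<le> B"
proof -
  have "ereal (s * y - h s) \<le> ereal (t * y - h t)" "ereal (t * y - f t) \<le> ereal (s * y - f s)"
    unfolding 1[symmetric] 2[symmetric] by (rule legendre_transform_ge)+
  thus ?thesis using s t by (simp add: abs_le_iff)
qed

text \<open>The maximisers at y are O(y), and at such points f and h differ by O(y^(k+1)); hence so
  do the transforms, and the holomorphic extensions agree to order k.\<close>

lemma legendre_transform_Taylor_agree:
  assumes f: "convex_on UNIV f" "open S" "0 \<in> S" "F holomorphic_on S"
      "\<forall>x. of_real x \<in> S \<longrightarrow> F (of_real x) = of_real (f x)" "deriv f 0 = 0" "0 < deriv (deriv f) 0"
    and h: "convex_on UNIV h" "open T" "0 \<in> T" "H holomorphic_on T"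
      "\<forall>x. of_real x \<in> T \<longrightarrow> H (of_real x) = of_real (h x)" "deriv h 0 = 0" "0 < deriv (deriv h) 0"
    and r: "0 < r" and bound: "\<And>\<theta>. \<bar>\<theta>\<bar> < r \<Longrightarrow> \<bar>f \<theta> - h \<theta>\<bar> \<le> K * \<bar>\<theta>\<bar> ^ Suc k"
  shows "ereal_times_differentiable_at m (legendre_transform f) 0"
    and "ereal_times_differentiable_at m (legendre_transform h) 0"
    and "m \<le> k \<Longrightarrow> (deriv ^^ m) (\<lambda>x. real_of_ereal (legendre_transform f x)) 0 =
      (deriv ^^ m) (\<lambda>x. real_of_ereal (legendre_transform h x)) 0"
proof -
  obtain \<rho>1 C1 s G1 where 1: "0 < \<rho>1" "0 \<le> C1" "G1 holomorphic_on ball 0 \<rho>1"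
    "\<forall>y. \<bar>y\<bar> < \<rho>1 \<longrightarrow> legendre_transform f y = ereal (s y * y - f (s y)) \<and> \<bar>s y\<bar> \<le> C1 * \<bar>y\<bar> \<and>
       G1 (of_real y) = of_real (s y * y - f (s y))"
    using legendre_transform_local[OF f] by (elim exE conjE)
  have I1: "legendre_transform f y = ereal (s y * y - f (s y))" "\<bar>s y\<bar> \<le> C1 * \<bar>y\<bar>"
    "G1 (of_real y) = of_real (s y * y - f (s y))" if "\<bar>y\<bar> < \<rho>1" for y
    using 1(4) that by simp_all
  obtain \<rho>2 C2 t G2 where 2: "0 < \<rho>2" "0 \<le> C2" "G2 holomorphic_on ball 0 \<rho>2"
    "\<forall>y. \<bar>y\<bar> < \<rho>2 \<longrightarrow> legendre_transform h y = ereal (t y * y - h (t y)) \<and> \<bar>t y\<bar> \<le> C2 * \<bar>y\<bar> \<and>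
       G2 (of_real y) = of_real (t y * y - h (t y))"
    using legendre_transform_local[OF h] by (elim exE conjE)
  have I2: "legendre_transform h y = ereal (t y * y - h (t y))" "\<bar>t y\<bar> \<le> C2 * \<bar>y\<bar>"
    "G2 (of_real y) = of_real (t y * y - h (t y))" if "\<bar>y\<bar> < \<rho>2" for y
    using 2(4) that by simp_all
  have diffble: "ereal_times_differentiable_at m (legendre_transform u) 0"
    if "0 < \<rho>" "G holomorphic_on ball 0 \<rho>" "\<And>y. \<bar>y\<bar> < \<rho> \<Longrightarrow> legendre_transform u y = ereal (v y)"
      "\<And>y. \<bar>y\<bar> < \<rho> \<Longrightarrow> G (of_real y) = of_real (v y)" for u v G \<rho>
    unfolding ereal_times_differentiable_at_def
  proof
    have "\<forall>\<^sub>F x in nhds 0. x \<in> ball (0::real) \<rho>"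
      by (rule eventually_nhds_in_open) (use that in auto)
    thus "\<forall>\<^sub>F x in nhds 0. \<bar>legendre_transform u x\<bar> \<noteq> \<infinity>"
      by eventually_elim (use that(3) in simp)
    show "times_differentiable_at m (\<lambda>x. real_of_ereal (legendre_transform u x)) 0"
      by (rule times_differentiable_at_of_real_restriction[OF open_ball that(2)]) (use that in auto)
  qed
  show "ereal_times_differentiable_at m (legendre_transform f) 0" by (rule diffble[OF 1(1,3) I1(1,3)])
  show "ereal_times_differentiable_at m (legendre_transform h) 0" by (rule diffble[OF 2(1,3) I2(1,3)])
  assume m: "m \<le> k"
  \<comment> \<open>The summand 1 makes C positive, as r / C requires.\<close>
  define C where "C = max C1 C2 + 1"
  have C: "C1 \<le> C" "C2 \<le> C" "0 < C" using 1(2) by (auto simp: C_def)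
  define \<rho> where "\<rho> = min (min \<rho>1 \<rho>2) (r / C)"
  have \<rho>: "0 < \<rho>" "\<rho> \<le> \<rho>1" "\<rho> \<le> \<rho>2" "\<rho> \<le> r / C" using 1(1) 2(1) r C by (auto simp: \<rho>_def)
  have K0: "0 \<le> K"
  proof -
    have "0 \<le> K * \<bar>r / 2\<bar> ^ Suc k" using bound[of "r / 2"] r by (simp del: power_Suc)
    moreover have "0 < \<bar>r / 2\<bar> ^ Suc k" using r by (simp del: power_Suc)
    ultimately show ?thesis by (simp only: zero_le_mult_iff) linarith
  qed
  have small: "\<bar>f w - h w\<bar> \<le> K * C ^ Suc k * \<bar>y\<bar> ^ Suc k" if "\<bar>w\<bar> \<le> C * \<bar>y\<bar>" "\<bar>y\<bar> < \<rho>" for w y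
  proof -
    have "C * \<bar>y\<bar> < C * (r / C)" using that(2) \<rho>(4) C(3) by (intro mult_strict_left_mono) auto
    hence "\<bar>w\<bar> < r" using that(1) C(3) by simp
    hence "\<bar>f w - h w\<bar> \<le> K * \<bar>w\<bar> ^ Suc k" by (rule bound)
    also have "\<dots> \<le> K * (C * \<bar>y\<bar>) ^ Suc k" using that(1) K0 by (intro mult_left_mono power_mono) auto
    finally show ?thesis by (simp only: power_mult_distrib mult.assoc)
  qed
  have sub: "ball 0 \<rho> \<subseteq> ball (0::complex) \<rho>1" "ball 0 \<rho> \<subseteq> ball (0::complex) \<rho>2" using \<rho> by auto
  have hol: "G1 holomorphic_on ball 0 \<rho>" "G2 holomorphic_on ball 0 \<rho>"
    using 1(3) 2(3) sub holomorphic_on_subset by blast+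
  have "(deriv ^^ m) (\<lambda>z. G1 z - G2 z) 0 = 0"
  proof (rule higher_deriv_eq_0_if_bounded[OF open_ball _ _ \<rho>(1) _ m])
    show "(\<lambda>z. G1 z - G2 z) holomorphic_on ball 0 \<rho>" by (intro holomorphic_intros hol)
    show "0 \<in> ball 0 \<rho>" using \<rho> by simp
    fix y :: real assume y: "\<bar>y\<bar> < \<rho>"
    have y1: "\<bar>y\<bar> < \<rho>1" and y2: "\<bar>y\<bar> < \<rho>2" using y \<rho> by auto
    have "\<bar>s y\<bar> \<le> C * \<bar>y\<bar>" using I1(2)[OF y1] C(1) mult_right_mono[of C1 C "\<bar>y\<bar>"] by simp
    moreover have "\<bar>t y\<bar> \<le> C * \<bar>y\<bar>" using I2(2)[OF y2] C(2) mult_right_mono[of C2 C "\<bar>y\<bar>"] by simp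
    ultimately have "\<bar>(s y * y - f (s y)) - (t y * y - h (t y))\<bar> \<le> K * C ^ Suc k * \<bar>y\<bar> ^ Suc k"
      by (intro legendre_transform_diff_le[OF I1(1)[OF y1] I2(1)[OF y2]] small y)
    moreover have "G1 (of_real y) - G2 (of_real y) = of_real ((s y * y - f (s y)) - (t y * y - h (t y)))"
      using I1(3)[OF y1] I2(3)[OF y2] by simp
    ultimately show "cmod (G1 (of_real y) - G2 (of_real y)) \<le> K * C ^ Suc k * \<bar>y\<bar> ^ Suc k"
      by (simp only: norm_of_real)
  qed
  hence eq: "(deriv ^^ m) G1 0 = (deriv ^^ m) G2 0"
    using higher_deriv_diff[OF hol open_ball, of 0 m] \<rho> by simp
  have "(deriv ^^ m) G1 (of_real 0) = of_real ((deriv ^^ m) (\<lambda>x. real_of_ereal (legendre_transform f x)) 0)"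
    by (rule higher_deriv_of_real_restriction[OF open_ball 1(3)]) (use 1(1) I1 in auto)
  moreover have "(deriv ^^ m) G2 (of_real 0) = of_real ((deriv ^^ m) (\<lambda>x. real_of_ereal (legendre_transform h x)) 0)"
    by (rule higher_deriv_of_real_restriction[OF open_ball 2(3)]) (use 2(1) I2 in auto)
  ultimately show "(deriv ^^ m) (\<lambda>x. real_of_ereal (legendre_transform f x)) 0 =
      (deriv ^^ m) (\<lambda>x. real_of_ereal (legendre_transform h x)) 0"
    using eq by simp
qed

section \<open>Properties of the rate functions\<close>

text \<open>Near 0 the cosine exceeds r, and near 1/2 it is below -r. Depending on the sign of
  \<theta>, an interval of length d at one of these places contributes at least d exp (r
  |\<theta>|), so c = - ln d.\<close>

lemma ln_mgf_1_coercive: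
  fixes r :: real
  assumes r: "r < 1"
  obtains c where "0 \<le> c" "\<forall>\<theta>. r * \<bar>\<theta>\<bar> - c \<le> ln (mgf q 1 \<theta>)"
proof -
  define r' where "r' = max r 0"
  have "((\<lambda>x. gcos x) \<longlongrightarrow> gcos 0) (at_right 0)"
    unfolding gcos_def by (intro tendsto_intros)
  hence "\<forall>\<^sub>F x in at_right 0. r' < gcos x"
    by (rule order_tendstoD) (use r in \<open>simp add: gcos_def r'_def\<close>)
  then obtain b where b: "0 < b" "\<forall>y>0. y < b \<longrightarrow> r' < gcos y"
    unfolding eventually_at_right[OF zero_less_one] by blast
  \<comment> \<open>The interval from d to 2 d lies below b, and its translate by 1/2 still lies in
    the unit interval.\<close>
  define d where "d = min b 1 / 4"
  have d: "0 < d" "2 * d < b" "2 * d \<le> 1 / 2" "d \<le> 1" using b(1) by (auto simp: d_def min_def)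
  have gc: "r' \<le> gcos y" if "d \<le> y" "y \<le> 2 * d" for y
    using b(2) that d by (intro less_imp_le) (simp)
  have gc': "gcos (y + 1 / 2) = - gcos y" for y
  proof -
    have "2 * pi * (y + 1 / 2) = 2 * pi * y + pi" by (simp add: algebra_simps)
    thus ?thesis by (simp only: gcos_def cos_periodic_pi)
  qed
  have main: "r * \<bar>\<theta>\<bar> - (- ln d) \<le> ln (mgf q 1 \<theta>)" for \<theta>
  proof -
    define s where "s = (if 0 \<le> \<theta> then d else d + 1 / 2)"
    have sub: "{s..s + d} \<subseteq> {0..1}" using d by (auto simp: s_def)
    have le: "r * \<bar>\<theta>\<bar> \<le> \<theta> * gcos y" if "y \<in> {s..s + d}" for y
    proof -
      have "\<bar>\<theta>\<bar> * r \<le> \<bar>\<theta>\<bar> * r'" by (intro mult_left_mono) (auto simp: r'_def)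
      hence "r * \<bar>\<theta>\<bar> \<le> \<bar>\<theta>\<bar> * r'" by (simp only: mult.commute)
      also have "\<dots> \<le> \<theta> * gcos y"
      proof (cases "0 \<le> \<theta>")
        case True
        thus ?thesis using gc[of y] that by (auto simp: s_def intro!: mult_left_mono)
      next
        case False
        hence "r' \<le> gcos (y - 1 / 2)" using that by (intro gc) (auto simp: s_def)
        also have "gcos (y - 1 / 2) = - gcos y" using gc'[of "y - 1 / 2"] by simp
        finally have "\<bar>\<theta>\<bar> * r' \<le> \<bar>\<theta>\<bar> * (- gcos y)" by (intro mult_left_mono) auto
        thus ?thesis using False by simp
      qed
      finally show ?thesis .
    qed
    have i: "(\<lambda>x. exp (\<theta> * gcos x)) integrable_on {a..b}" for a b
      by (intro integrable_continuous_real continuous_intros)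
    have "d * exp (r * \<bar>\<theta>\<bar>) = integral {s..s + d} (\<lambda>x. exp (r * \<bar>\<theta>\<bar>))"
      using d by simp
    also have "\<dots> \<le> integral {s..s + d} (\<lambda>x. exp (\<theta> * gcos x))"
      by (intro integral_le i) (use le in auto)
    also have "\<dots> \<le> integral {0..1} (\<lambda>x. exp (\<theta> * gcos x))"
      by (intro integral_subset_le sub i) auto
    also have "\<dots> = mgf q 1 \<theta>" by (simp add: mgf_1_eq del: One_nat_def)
    finally have "d * exp (r * \<bar>\<theta>\<bar>) \<le> mgf q 1 \<theta>" .
    hence "ln (d * exp (r * \<bar>\<theta>\<bar>)) \<le> ln (mgf q 1 \<theta>)"
      using d mgf_bounds(2)[of q 1 \<theta>] by (subst ln_le_cancel_iff) auto
    thus ?thesis using d by (simp add: ln_mult)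
  qed
  have "0 \<le> - ln d" using d by simp
  thus thesis using that[of "- ln d"] main by blast
qed

text \<open>The map \<theta> \<mapsto> \<theta> x - f \<theta> vanishes at 0 with derivative x
  \<noteq> 0, so it is positive on one side of 0.\<close>

lemma legendre_transform_pos:
  assumes D: "(f has_real_derivative 0) (at 0)" and f0: "f 0 = 0" and x: "x \<noteq> 0"
  shows "0 < legendre_transform f x"
proof -
  have D': "((\<lambda>\<theta>. \<theta> * x - f \<theta>) has_real_derivative x) (at 0)"
    by (auto intro!: derivative_eq_intros D)
  have "\<exists>\<theta>. 0 < \<theta> * x - f \<theta>"
  proof (cases "0 < x")
    case True
    obtain d where d: "0 < d" "\<forall>h>0. h < d \<longrightarrow> 0 * x - f 0 < (0 + h) * x - f (0 + h)"
      using DERIV_pos_inc_right[OF D' True] by (elim exE conjE)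
    have "0 < d / 2" "d / 2 < d" using d(1) by simp_all
    from d(2)[rule_format, OF this] have "0 * x - f 0 < (0 + d / 2) * x - f (0 + d / 2)" .
    thus ?thesis unfolding f0 by (intro exI[of _ "0 + d / 2"]) simp
  next
    case False
    hence "x < 0" using x by simp
    obtain d where d: "0 < d" "\<forall>h>0. h < d \<longrightarrow> 0 * x - f 0 < (0 - h) * x - f (0 - h)"
      using DERIV_neg_dec_left[OF D' \<open>x < 0\<close>] by (elim exE conjE)
    have "0 < d / 2" "d / 2 < d" using d(1) by simp_all
    from d(2)[rule_format, OF this] have "0 * x - f 0 < (0 - d / 2) * x - f (0 - d / 2)" .
    thus ?thesis unfolding f0 by (intro exI[of _ "0 - d / 2"]) simp
  qed
  then obtain \<theta> where "0 < \<theta> * x - f \<theta>" by blast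
  thus ?thesis using legendre_transform_ge[of \<theta> x f] by (meson ereal_less(2) less_le_trans)
qed

lemma legendre_transform_eq_infinity:
  assumes f: "\<And>\<theta>. f \<theta> \<le> \<bar>\<theta>\<bar>" and x: "x \<notin> {-1..1}"
  shows "legendre_transform f x = \<infinity>"
proof (rule ereal_top)
  fix B
  have x1: "1 < \<bar>x\<bar>" using x by auto
  define a where "a = \<bar>B\<bar> / (\<bar>x\<bar> - 1)"
  define \<theta> where "\<theta> = sgn x * a"
  have "\<bar>\<theta>\<bar> = a"
  proof -
    have "x \<noteq> 0" using x1 by auto
    thus ?thesis using x1 by (simp add: \<theta>_def a_def abs_mult abs_sgn_eq)
  qed
  moreover have "\<theta> * x = a * \<bar>x\<bar>" by (simp add: \<theta>_def sgn_if)
  ultimately have "\<theta> * x - \<bar>\<theta>\<bar> = a * (\<bar>x\<bar> - 1)" by (simp add: algebra_simps)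
  hence "\<theta> * x - \<bar>\<theta>\<bar> = \<bar>B\<bar>" using x1 by (simp add: a_def)
  hence "B \<le> \<theta> * x - f \<theta>" using f[of \<theta>] by linarith
  thus "ereal B \<le> legendre_transform f x" using legendre_transform_ge[of \<theta> x f] by (meson ereal_less_eq(3) order_trans)
qed

lemma pressure_differentiable:
  assumes q: "2 \<le> q"
  shows "(pressure q has_real_derivative deriv (pressure q) \<theta>) (at \<theta>)" and "deriv (pressure q) 0 = 0"
proof -
  obtain L \<Lambda> where \<Lambda>:
    "\<And>n. L n holomorphic_on zero_free_strip" "\<And>n z. z \<in> zero_free_strip \<Longrightarrow> exp (L n z) = mgf q n z"
    "\<And>n x. L n (complex_of_real x) = of_real (ln (mgf q n x))"
    "\<Lambda> holomorphic_on zero_free_strip" "\<And>x. \<Lambda> (complex_of_real x) = of_real (pressure q x)"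
    "\<And>K. compact K \<Longrightarrow> K \<subseteq> zero_free_strip \<Longrightarrow> uniform_limit K (\<lambda>n z. L n z / of_nat n) \<Lambda> sequentially"
    by (rule complex_pressure[OF q]) (rule that)
  show D: "(pressure q has_real_derivative deriv (pressure q) \<theta>) (at \<theta>)" for \<theta>
    by (rule deriv_of_real_restriction(1)[OF open_zero_free_strip \<Lambda>(4) \<Lambda>(5) of_real_in_zero_free_strip])
  show "deriv (pressure q) 0 = 0"
    by (rule DERIV_local_min[OF D[of 0], of 1]) (use pressure_simple_bounds[OF q] in auto)
qed

lemma gaertner_ellis_lacunary_sum:
  assumes M: "prob_space M" and U: "uniform_rv M U" and q: "2 \<le> q"
  shows "gaertner_ellis M (lacunary_sum U q) (pressure q)"
proof -
  have q0: "0 < q" using q by simp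
  interpret prob_space M by (rule M)
  have [measurable]: "U \<in> borel_measurable M"
    using U unfolding uniform_rv_def distributed_def by simp
  show ?thesis
  proof
    show "lacunary_sum U q n \<in> borel_measurable M" for n
      unfolding lacunary_sum_def[abs_def] by measurable
    show "\<bar>lacunary_sum U q n \<omega>\<bar> \<le> real n" for n \<omega>
      unfolding lacunary_sum_eq by (rule birkhoff_sum_le)
    show "(\<lambda>n. cgf M (lacunary_sum U q n) \<theta> / real n) \<longlonglongrightarrow> pressure q \<theta>" for \<theta>
      unfolding cgf_lacunary_sum[OF U q0] by (rule pressure_limit[OF q])
    show "0 \<le> pressure q \<theta>" "pressure q 0 = 0" for \<theta> using pressure_simple_bounds[OF q] by auto
    show "\<exists>D. (pressure q has_real_derivative D) (at \<theta>)" for \<theta> using pressure_differentiable(1)[OF q] by blast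
  qed
qed

lemma Lambda_q_eq_pressure:
  assumes "uniform_rv M U" and "2 \<le> q"
  shows "Lambda_q M U q = pressure q"
  using cgf_lacunary_sum[OF assms(1), of q] assms(2) by (simp add: fun_eq_iff Lambda_q_def pressure_def)

text \<open>The supremum defining I_q at x is attained: negative \<theta> contribute nothing, and
  coercivity with a slope above x confines \<theta> to a compact interval. Positivity of the
  supremum excludes t = 0, and at t > 0 the two functions differ strictly.\<close>

lemma I_q_less_I_tilde:
  assumes q: "2 \<le> q" and h: "\<And>\<theta>. h \<theta> = ln (mgf q 1 \<theta>)" and x: "x \<in> {0<..<1}"
  shows "legendre_transform (pressure q) x < legendre_transform h x"
proof -
  let ?f = "pressure q"
  define r where "r = (1 + x) / 2"
  have r: "x < r" "r < 1" using x by (auto simp: r_def)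
  obtain c where c: "0 \<le> c" "\<forall>\<theta>. r * \<bar>\<theta>\<bar> - c \<le> ln (mgf q 1 \<theta>)"
    by (rule ln_mgf_1_coercive[OF r(2)])
  \<comment> \<open>From R on, r \<theta> - c \<ge> \<theta> x, so such \<theta> do not exceed the
    value 0 reached at \<theta> = 0.\<close>
  define R where "R = c / (r - x)"
  have R: "0 \<le> R" using c r by (simp add: R_def)
  note D = pressure_differentiable[OF q]
  have fh: "h \<theta> \<le> ?f \<theta>" if "0 \<le> \<theta>" for \<theta>
    using pressure_gt[OF q, of \<theta>] that pressure_simple_bounds(3)[OF q] by (cases "\<theta> = 0") (auto simp: h)
  have cont: "continuous_on {0..R} (\<lambda>\<theta>. \<theta> * x - ?f \<theta>)"
    by (intro continuous_intros DERIV_atLeastAtMost_imp_continuous_on) (use D(1) in blast)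
  obtain t where t: "t \<in> {0..R}" "\<forall>\<theta>\<in>{0..R}. \<theta> * x - ?f \<theta> \<le> t * x - ?f t"
    using continuous_attains_sup[OF compact_Icc _ cont] R by auto
  have t0: "0 \<le> t * x - ?f t" using t(2) R pressure_simple_bounds(3)[OF q] by force
  have "legendre_transform ?f x \<le> ereal (t * x - ?f t)"
    unfolding legendre_transform_def
  proof (rule SUP_least)
    fix \<theta>
    have "\<theta> * x - ?f \<theta> \<le> t * x - ?f t"
    proof (cases "\<theta> < 0")
      case True
      hence "\<theta> * x \<le> 0" using x by (intro mult_nonpos_nonneg) auto
      thus ?thesis using t0 pressure_simple_bounds(1)[OF q, of \<theta>] by linarith
    next
      case False
      show ?thesis
      proof (cases "\<theta> \<le> R")
        case True
        thus ?thesis using False t(2) by simp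
      next
        case big: False
        have "c = R * (r - x)" using r by (simp add: R_def)
        also have "\<dots> \<le> \<theta> * (r - x)" using big r by (intro mult_right_mono) auto
        finally have "\<theta> * x \<le> r * \<bar>\<theta>\<bar> - c" using False by (simp add: algebra_simps)
        also have "\<dots> \<le> h \<theta>" using c(2) h by simp
        finally show ?thesis using fh[of \<theta>] False t0 by simp
      qed
    qed
    thus "ereal (\<theta> * x - ?f \<theta>) \<le> ereal (t * x - ?f t)" by simp
  qed
  moreover have "ereal (t * x - ?f t) \<le> legendre_transform ?f x" by (rule legendre_transform_ge)
  ultimately have eq: "legendre_transform ?f x = ereal (t * x - ?f t)" by (rule antisym)
  have "0 < legendre_transform ?f x"
    by (rule legendre_transform_pos) (use D(1)[of 0] D(2) pressure_simple_bounds(3)[OF q] x in auto)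
  hence "t \<noteq> 0" unfolding eq using pressure_simple_bounds(3)[OF q] by auto
  hence "0 < t" using t(1) by simp
  hence "ereal (t * x - ?f t) < ereal (t * x - h t)" using pressure_gt[OF q, of t] h by simp
  also have "\<dots> \<le> legendre_transform h x" by (rule legendre_transform_ge)
  finally show ?thesis unfolding eq .
qed

text \<open>At x = 1 no slope fits between x and 1, so the confinement of \<theta> to a compact
  interval breaks down; comparing the suprema term by term yields the weak inequality.\<close>

lemma I_q_1_le_I_tilde_1:
  assumes q: "2 \<le> q" and h: "\<And>\<theta>. h \<theta> = ln (mgf q 1 \<theta>)"
  shows "legendre_transform (pressure q) 1 \<le> legendre_transform h 1"
  unfolding legendre_transform_def[of "pressure q"]
proof (rule SUP_least)
  fix \<theta>
  show "ereal (\<theta> * 1 - pressure q \<theta>) \<le> legendre_transform h 1"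
  proof (cases "\<theta> \<le> 0")
    case True
    have "h 0 = 0" by (simp add: h)
    hence "0 \<le> legendre_transform h 1" by (rule legendre_transform_nonneg)
    moreover have "ereal (\<theta> * 1 - pressure q \<theta>) \<le> 0" using True pressure_simple_bounds(1)[OF q, of \<theta>] by simp
    ultimately show ?thesis by (rule order_trans[rotated])
  next
    case False
    hence "ereal (\<theta> * 1 - pressure q \<theta>) \<le> ereal (\<theta> * 1 - h \<theta>)" using pressure_gt[OF q, of \<theta>] h by simp
    also have "\<dots> \<le> legendre_transform h 1" by (rule legendre_transform_ge)
    finally show ?thesis .
  qed
qed

text \<open>For |\<theta>| > c / g both expressions under the suprema are nonpositive and do not
  matter; for the other \<theta> the functions differ by at most b c / g. Of the excess 2 g of
  slope, one half absorbs the constant c and the other half the difference b |\<theta>|.\<close>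

lemma legendre_transform_close:
  fixes f h :: "real \<Rightarrow> real"
  assumes fh: "\<And>\<theta>. \<bar>f \<theta> - h \<theta>\<bar> \<le> b * \<bar>\<theta>\<bar>" and f0: "f 0 = 0" and h0: "h 0 = 0"
    and coercive: "\<And>\<theta>. r' * \<bar>\<theta>\<bar> - c \<le> h \<theta>" and c: "0 \<le> c"
    and b: "0 \<le> b" "b \<le> g" and g: "0 < g" "r + 2 * g \<le> r'" and x: "\<bar>x\<bar> \<le> r"
  shows "\<bar>legendre_transform f x - legendre_transform h x\<bar> \<le> ereal (b * (c / g))"
proof -
  let ?B = "b * (c / g)"
  have B: "0 \<le> ?B" using b c g by simp
  have far: "\<theta> * x - f \<theta> \<le> 0 \<and> \<theta> * x - h \<theta> \<le> 0" if "c / g < \<bar>\<theta>\<bar>" for \<theta>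
  proof -
    have "\<theta> * x \<le> \<bar>\<theta>\<bar> * r"
      using mult_left_mono[OF x, of "\<bar>\<theta>\<bar>"] abs_ge_self[of "\<theta> * x"] by (simp add: abs_mult)
    moreover have "(r + 2 * g) * \<bar>\<theta>\<bar> \<le> r' * \<bar>\<theta>\<bar>" by (intro mult_right_mono g) auto
    moreover have "c \<le> g * \<bar>\<theta>\<bar>" using that g by (simp add: field_simps)
    moreover have "b * \<bar>\<theta>\<bar> \<le> g * \<bar>\<theta>\<bar>" by (intro mult_right_mono b) auto
    moreover have "0 \<le> b * \<bar>\<theta>\<bar>" using b by simp
    ultimately show ?thesis using coercive[of \<theta>] fh[of \<theta>] by (simp add: algebra_simps abs_le_iff)
  qed
  have near: "\<bar>f \<theta> - h \<theta>\<bar> \<le> ?B" if "\<not> c / g < \<bar>\<theta>\<bar>" for \<theta>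
    using fh[of \<theta>] mult_left_mono[of "\<bar>\<theta>\<bar>" "c / g" b] that b by linarith
  have le: "legendre_transform u x \<le> legendre_transform v x + ereal ?B"
    if v0: "v 0 = 0" and far: "\<And>\<theta>. c / g < \<bar>\<theta>\<bar> \<Longrightarrow> \<theta> * x - u \<theta> \<le> 0"
      and near: "\<And>\<theta>. \<not> c / g < \<bar>\<theta>\<bar> \<Longrightarrow> \<bar>u \<theta> - v \<theta>\<bar> \<le> ?B" for u v
    unfolding legendre_transform_def[of u]
  proof (rule SUP_least)
    fix \<theta>
    show "ereal (\<theta> * x - u \<theta>) \<le> legendre_transform v x + ereal ?B"
    proof (cases "c / g < \<bar>\<theta>\<bar>")
      case True
      have "ereal (\<theta> * x - u \<theta>) \<le> 0" using far[OF True] by simp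
      also have "0 \<le> legendre_transform v x + ereal ?B"
        using legendre_transform_nonneg[of v x, OF v0] B by (intro add_nonneg_nonneg) auto
      finally show ?thesis .
    next
      case False
      have "ereal (\<theta> * x - u \<theta>) \<le> ereal (\<theta> * x - v \<theta>) + ereal ?B" using near[OF False] by (simp add: abs_le_iff)
      also have "\<dots> \<le> legendre_transform v x + ereal ?B" by (intro add_right_mono legendre_transform_ge)
      finally show ?thesis .
    qed
  qed
  have le1: "legendre_transform f x \<le> legendre_transform h x + ereal ?B"
    by (rule le) (use h0 far near in auto)
  have le2: "legendre_transform h x \<le> legendre_transform f x + ereal ?B"
    by (rule le) (use f0 far near in \<open>auto simp: abs_minus_commute\<close>)
  have "legendre_transform h x \<le> ereal c"
    unfolding legendre_transform_def
  proof (rule SUP_least)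
    fix \<theta>
    have "\<theta> * x \<le> \<bar>\<theta>\<bar> * r"
      using mult_left_mono[OF x, of "\<bar>\<theta>\<bar>"] abs_ge_self[of "\<theta> * x"] by (simp add: abs_mult)
    moreover have "r * \<bar>\<theta>\<bar> \<le> r' * \<bar>\<theta>\<bar>" using g by (intro mult_right_mono) auto
    ultimately show "ereal (\<theta> * x - h \<theta>) \<le> ereal c" using coercive[of \<theta>] by (simp add: mult.commute)
  qed
  moreover have "0 \<le> legendre_transform h x" by (rule legendre_transform_nonneg[of h, OF h0])
  ultimately obtain a where a: "legendre_transform h x = ereal a" by (cases "legendre_transform h x") auto
  have "0 \<le> legendre_transform f x" by (rule legendre_transform_nonneg[of f, OF f0])
  then obtain a' where a': "legendre_transform f x = ereal a'" using le1 a by (cases "legendre_transform f x") auto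
  show ?thesis using le1 le2 by (simp add: a a' abs_le_iff)
qed

lemma I_q_uniform_convergence:
  assumes K: "compact K" "K \<subseteq> {-1<..<1}" and \<epsilon>: "0 < \<epsilon>" and h: "\<And>q \<theta>. h \<theta> = ln (mgf q 1 \<theta>)"
  shows "\<forall>\<^sub>F q in sequentially. \<forall>x\<in>K. \<bar>legendre_transform (pressure q) x - legendre_transform h x\<bar> < ereal \<epsilon>"
proof (cases "K = {}")
  case False
  have "continuous_on K (\<lambda>x. \<bar>x\<bar>)" by (intro continuous_intros)
  then obtain x0 where x0: "x0 \<in> K" "\<forall>x\<in>K. \<bar>x\<bar> \<le> \<bar>x0\<bar>"
    using continuous_attains_sup[OF K(1) False] by blast
  define r where "r = \<bar>x0\<bar>"
  have "x0 \<in> {-1<..<1}" using x0(1) K(2) by blast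
  hence r: "0 \<le> r" "r < 1" by (auto simp: r_def)
  \<comment> \<open>The coercivity slope (1 + r) / 2, halfway between r and 1, exceeds r by exactly
    2 g.\<close>
  define g where "g = (1 - r) / 4"
  have g: "0 < g" "r + 2 * g \<le> (1 + r) / 2" using r by (auto simp: g_def field_simps)
  have r': "(1 + r) / 2 < 1" using r by simp
  \<comment> \<open>The parameter 2 is a representative, since a single summand does not depend on
    it. So c is fixed before q tends to infinity.\<close>
  obtain c where c: "0 \<le> c" "\<forall>\<theta>. (1 + r) / 2 * \<bar>\<theta>\<bar> - c \<le> ln (mgf 2 1 \<theta>)"
    by (rule ln_mgf_1_coercive[OF r'])
  have lim: "(\<lambda>q::nat. 2 * pi / (real q - 1)) \<longlonglongrightarrow> 0" by real_asymp
  have "(\<lambda>q::nat. 2 * pi / (real q - 1) * (c / g)) \<longlonglongrightarrow> 0 * (c / g)"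
    by (intro tendsto_mult lim tendsto_const)
  hence "\<forall>\<^sub>F q::nat in sequentially. 2 * pi / (real q - 1) * (c / g) < \<epsilon>"
    using \<epsilon> by (intro order_tendstoD(2)) auto
  moreover have "\<forall>\<^sub>F q::nat in sequentially. 2 * pi / (real q - 1) < g"
    by (rule order_tendstoD(2)[OF lim g(1)])
  ultimately show ?thesis using eventually_ge_at_top[of 2]
  proof eventually_elim
    case (elim q)
    show ?case
    proof
      fix x assume "x \<in> K"
      have "\<bar>legendre_transform (pressure q) x - legendre_transform h x\<bar> \<le> ereal (2 * pi / (real q - 1) * (c / g))"
      proof (rule legendre_transform_close)
        show "\<bar>pressure q \<theta> - h \<theta>\<bar> \<le> 2 * pi / (real q - 1) * \<bar>\<theta>\<bar>" for \<theta>
          using pressure_bound[OF elim(3), of \<theta>] by (simp add: h[of _ q])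
        show "(1 + r) / 2 * \<bar>\<theta>\<bar> - c \<le> h \<theta>" for \<theta> using c(2) h[of \<theta> 2] by simp
        show "r + 2 * g \<le> (1 + r) / 2" by (rule g(2))
        show "\<bar>x\<bar> \<le> r" using x0(2) \<open>x \<in> K\<close> by (simp add: r_def)
      qed (use elim c(1) g(1) pressure_simple_bounds(3)[OF elim(3)] h[of 0 q] in auto)
      also have "\<dots> < ereal \<epsilon>" using elim(1) by simp
      finally show "\<bar>legendre_transform (pressure q) x - legendre_transform h x\<bar> < ereal \<epsilon>" .
    qed
  qed
qed simp

section \<open>Taylor coefficients of the limit and of its Legendre transform\<close>

lemma higher_deriv_power_0:
  "m \<le> k \<Longrightarrow> (deriv ^^ m) (\<lambda>z::complex. z ^ k) 0 = (if m = k then fact k else 0)"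
  using higher_deriv_power[of m "0::complex" k 0] by (auto simp: pochhammer_fact)

lemma higher_deriv_cmult_power_0:
  "m \<le> k \<Longrightarrow> (deriv ^^ m) (\<lambda>z::complex. c * z ^ k) 0 = (if m = k then c * fact k else 0)"
  using higher_deriv_cmult[of "\<lambda>z. z ^ k" UNIV 0 m c] higher_deriv_power_0[of m k]
  by (simp add: holomorphic_intros)

text \<open>The expansion for n + 1 terms determines the derivatives at 0 up to order q + 1 exactly.
  By Weierstrass's theorem they converge with the functions, and the factor n / (n + 1) of the
  correction tends to 1.\<close>

lemma higher_deriv_pressure:
  assumes q: "2 \<le> q" and S: "S = zero_free_strip"
  obtains L \<Lambda> where "L holomorphic_on S" "\<forall>x. L (complex_of_real x) = of_real (ln (mgf q 1 x))"
    "\<Lambda> holomorphic_on S" "\<forall>x. \<Lambda> (complex_of_real x) = of_real (pressure q x)"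
    "\<forall>m\<le>Suc q. (deriv ^^ m) \<Lambda> 0 = (deriv ^^ m) L 0 + (if m = Suc q then of_real (real (q + 1) / 2 ^ q) else 0)"
proof -
  obtain L \<Lambda> where L:
    "\<And>n. L n holomorphic_on zero_free_strip" "\<And>n z. z \<in> zero_free_strip \<Longrightarrow> exp (L n z) = mgf q n z"
    "\<And>n x. L n (complex_of_real x) = of_real (ln (mgf q n x))"
    "\<Lambda> holomorphic_on zero_free_strip" "\<And>x. \<Lambda> (complex_of_real x) = of_real (pressure q x)"
    "\<And>K. compact K \<Longrightarrow> K \<subseteq> zero_free_strip \<Longrightarrow> uniform_limit K (\<lambda>n z. L n z / of_nat n) \<Lambda> sequentially"
    by (rule complex_pressure[OF q]) (rule that)
  note o = open_zero_free_strip
  have z0: "0 \<in> zero_free_strip" using of_real_in_zero_free_strip[of 0] by simp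
  define c :: real where "c = 1 / (2 ^ q * fact q)"
  have cf: "of_real c * fact (Suc q) = (of_real (real (q + 1) / 2 ^ q) :: complex)"
    by (simp add: c_def field_simps)
  have lim: "(deriv ^^ m) \<Lambda> 0 = (deriv ^^ m) (L 1) 0 + (if m = Suc q then of_real (real (q + 1) / 2 ^ q) else 0)"
    (is "_ = _ + ?e") if m: "m \<le> Suc q" for m
  proof -
    have eq: "(deriv ^^ m) (\<lambda>z. L (Suc n) z / of_nat (Suc n)) 0 = (deriv ^^ m) (L 1) 0 + of_real (real n / real (Suc n)) * ?e" for n
    proof -
      define P where "P z = of_nat (Suc n) * L 1 z" for z
      define Q where "Q z = of_real (real n * c) * z ^ Suc q" for z :: complex
      have hol: "P holomorphic_on zero_free_strip" "Q holomorphic_on zero_free_strip"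
        unfolding P_def[abs_def] Q_def[abs_def] by (intro holomorphic_intros L)+
      obtain K where K: "\<forall>(\<theta>::real) (x::real). \<bar>\<theta>\<bar> \<le> 1 \<longrightarrow>
          \<bar>ln (mgf q (Suc n) \<theta>) - real (Suc n) * ln (mgf q 1 \<theta>) - real n / (2 ^ q * fact q) * \<theta> ^ Suc q\<bar> \<le> K * \<bar>\<theta>\<bar> ^ (q + 2)"
        using ln_mgf_expansion[OF q, of n, unfolded unif_O_def] ..
      have "(deriv ^^ m) (\<lambda>z. L (Suc n) z - P z - Q z) 0 = 0"
      proof (rule higher_deriv_eq_0_if_bounded[OF o z0 _ zero_less_one _ m])
        show "(\<lambda>z. L (Suc n) z - P z - Q z) holomorphic_on zero_free_strip"
          by (intro holomorphic_intros hol L)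
        fix \<theta> :: real assume t: "\<bar>\<theta>\<bar> < 1"
        have "L (Suc n) (of_real \<theta>) - P (of_real \<theta>) - Q (of_real \<theta>) =
          of_real (ln (mgf q (Suc n) \<theta>) - real (Suc n) * ln (mgf q 1 \<theta>) - real n / (2 ^ q * fact q) * \<theta> ^ Suc q)"
          unfolding P_def Q_def L(3) c_def by simp
        thus "cmod (L (Suc n) (of_real \<theta>) - P (of_real \<theta>) - Q (of_real \<theta>)) \<le> K * \<bar>\<theta>\<bar> ^ Suc (Suc q)"
          using K t by (simp only: norm_of_real) simp
      qed
      hence "(deriv ^^ m) (L (Suc n)) 0 - (deriv ^^ m) P 0 - (deriv ^^ m) Q 0 = 0"
        using higher_deriv_diff[OF holomorphic_on_diff[OF L(1)[of "Suc n"] hol(1)] hol(2) o z0, of m]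
          higher_deriv_diff[OF L(1)[of "Suc n"] hol(1) o z0, of m] by simp
      hence "(deriv ^^ m) (L (Suc n)) 0 = (deriv ^^ m) P 0 + (deriv ^^ m) Q 0"
        by (simp add: algebra_simps)
      also have "(deriv ^^ m) P 0 = of_nat (Suc n) * (deriv ^^ m) (L 1) 0"
        unfolding P_def[abs_def] by (rule higher_deriv_cmult[OF L(1) z0 o])
      also have "(deriv ^^ m) Q 0 = of_nat n * ?e"
        unfolding Q_def[abs_def] higher_deriv_cmult_power_0[OF m] using cf by (simp add: mult.assoc)
      finally have 1: "(deriv ^^ m) (L (Suc n)) 0 = of_nat (Suc n) * (deriv ^^ m) (L 1) 0 + of_nat n * ?e" .
      have "(deriv ^^ m) (\<lambda>z. L (Suc n) z / of_nat (Suc n)) 0 = (deriv ^^ m) (\<lambda>z. inverse (of_nat (Suc n)) * L (Suc n) z) 0"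
        by (simp add: field_simps)
      also have "\<dots> = inverse (of_nat (Suc n)) * (deriv ^^ m) (L (Suc n)) 0"
        by (rule higher_deriv_cmult[OF L(1) z0 o])
      also have "\<dots> = (deriv ^^ m) (L 1) 0 + of_real (real n / real (Suc n)) * ?e"
        unfolding 1 distrib_left by (simp add: field_simps del: of_nat_Suc)
      finally show ?thesis .
    qed
    obtain \<rho> where \<rho>: "0 < \<rho>" "cball 0 \<rho> \<subseteq> zero_free_strip" using o z0 open_contains_cball by blast
    have "uniform_limit (ball 0 \<rho>) (\<lambda>n z. L n z / of_nat n) \<Lambda> sequentially"
      by (rule uniform_limit_on_subset[OF L(6)[OF compact_cball \<rho>(2)]]) auto
    hence "uniform_limit (ball 0 \<rho>) (\<lambda>n z. L (Suc n) z / of_nat (Suc n)) \<Lambda> sequentially"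
      by (rule filterlim_compose[OF _ filterlim_Suc])
    hence "(\<lambda>n. (deriv ^^ m) (\<lambda>z. L (Suc n) z / of_nat (Suc n)) 0) \<longlonglongrightarrow> (deriv ^^ m) \<Lambda> 0"
    proof (rule higher_deriv_complex_uniform_limit)
      have "(\<lambda>z. L (Suc n) z / of_nat (Suc n)) holomorphic_on ball 0 \<rho>" for n
      proof (rule holomorphic_on_subset)
        show "(\<lambda>z. L (Suc n) z / of_nat (Suc n)) holomorphic_on zero_free_strip"
          by (intro holomorphic_intros L) (simp del: of_nat_Suc)
        show "ball 0 \<rho> \<subseteq> zero_free_strip" using \<rho>(2) ball_subset_cball by blast
      qed
      thus "\<forall>\<^sub>F n in sequentially. (\<lambda>z. L (Suc n) z / of_nat (Suc n)) holomorphic_on ball 0 \<rho>" by simp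
    qed (use \<rho> in auto)
    hence l1: "(\<lambda>n. (deriv ^^ m) (L 1) 0 + of_real (real n / real (Suc n)) * ?e) \<longlonglongrightarrow> (deriv ^^ m) \<Lambda> 0"
      unfolding eq .
    have "(\<lambda>n. real n / real (Suc n)) \<longlonglongrightarrow> 1" by (rule LIMSEQ_n_over_Suc_n)
    hence "(\<lambda>n. complex_of_real (real n / real (Suc n))) \<longlonglongrightarrow> of_real 1" by (rule tendsto_of_real)
    hence "(\<lambda>n. (deriv ^^ m) (L 1) 0 + of_real (real n / real (Suc n)) * ?e) \<longlonglongrightarrow> (deriv ^^ m) (L 1) 0 + of_real 1 * ?e"
      by (intro tendsto_add tendsto_mult tendsto_const)
    from LIMSEQ_unique[OF l1 this] show ?thesis by simp
  qed
  show thesis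
  proof (rule that[of "L 1" \<Lambda>])
    show "L 1 holomorphic_on S" "\<Lambda> holomorphic_on S" using L(1,4) S by simp_all
  qed (use L lim in auto)
qed

lemma Taylor_at_0:
  assumes q: "2 \<le> q" and h: "\<And>\<theta>. h \<theta> = ln (mgf q 1 \<theta>)"
  shows "times_differentiable_at m (pressure q) 0"
    and "times_differentiable_at m h 0"
    and "m \<le> Suc q \<Longrightarrow> (deriv ^^ m) (pressure q) 0 = (deriv ^^ m) h 0 + (if m = Suc q then real (q + 1) / 2 ^ q else 0)"
    and "ereal_times_differentiable_at m (legendre_transform (pressure q)) 0"
    and "ereal_times_differentiable_at m (legendre_transform h) 0"
    and "m \<le> q \<Longrightarrow> (deriv ^^ m) (\<lambda>x. real_of_ereal (legendre_transform (pressure q) x)) 0 =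
      (deriv ^^ m) (\<lambda>x. real_of_ereal (legendre_transform h x)) 0"
proof -
  let ?S = zero_free_strip
  obtain L \<Lambda> where L: "L holomorphic_on ?S" "\<forall>x. L (complex_of_real x) = of_real (ln (mgf q 1 x))"
    "\<Lambda> holomorphic_on ?S" "\<forall>x. \<Lambda> (complex_of_real x) = of_real (pressure q x)"
    "\<forall>m\<le>Suc q. (deriv ^^ m) \<Lambda> 0 = (deriv ^^ m) L 0 + (if m = Suc q then of_real (real (q + 1) / 2 ^ q) else 0)"
    by (rule higher_deriv_pressure[OF q refl]) (rule that)
  note o = open_zero_free_strip
  have z0: "0 \<in> ?S" "complex_of_real 0 \<in> ?S" using of_real_in_zero_free_strip[of 0] by simp_all
  have Lh: "L (complex_of_real x) = of_real (h x)" for x using L(2) h by simp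
  have \<Lambda>f: "\<Lambda> (complex_of_real x) = of_real (pressure q x)" for x using L(4) by simp
  show "times_differentiable_at m (pressure q) 0"
    by (rule times_differentiable_at_of_real_restriction[OF o L(3) \<Lambda>f z0(2)])
  show "times_differentiable_at m h 0"
    by (rule times_differentiable_at_of_real_restriction[OF o L(1) Lh z0(2)])
  have derivs: "(deriv ^^ m) \<Lambda> 0 = of_real ((deriv ^^ m) (pressure q) 0)" "(deriv ^^ m) L 0 = of_real ((deriv ^^ m) h 0)" for m
    using higher_deriv_of_real_restriction[OF o L(3) \<Lambda>f z0(2), of m]
      higher_deriv_of_real_restriction[OF o L(1) Lh z0(2), of m] by simp_all
  have deriv_eq: "(deriv ^^ m) (pressure q) 0 = (deriv ^^ m) h 0 + (if m = Suc q then real (q + 1) / 2 ^ q else 0)"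
    if "m \<le> Suc q" for m
  proof -
    have "complex_of_real ((deriv ^^ m) (pressure q) 0) = of_real ((deriv ^^ m) h 0 + (if m = Suc q then real (q + 1) / 2 ^ q else 0))"
      unfolding derivs[symmetric] of_real_add using L(5) that by simp
    thus ?thesis by (simp only: of_real_eq_iff)
  qed
  thus "m \<le> Suc q \<Longrightarrow> (deriv ^^ m) (pressure q) 0 = (deriv ^^ m) h 0 + (if m = Suc q then real (q + 1) / 2 ^ q else 0)" .
  have low: "(deriv ^^ m) h 0 = (if m = 2 then 1 / 2 else 0)" if m: "m \<le> 2" for m
  proof -
    obtain K where K: "\<forall>(\<theta>::real) (x::real). \<bar>\<theta>\<bar> \<le> 1 \<longrightarrow> \<bar>ln (mgf q 1 \<theta>) - \<theta>\<^sup>2 / 4\<bar> \<le> K * \<bar>\<theta>\<bar> ^ 3"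
      using ln_mgf_1_expansion[of q, unfolded unif_O_def] ..
    have hol: "(\<lambda>z. 1 / 4 * z\<^sup>2) holomorphic_on ?S" by (intro holomorphic_intros)
    have "(deriv ^^ m) (\<lambda>z. L z - 1 / 4 * z\<^sup>2) 0 = 0"
    proof (rule higher_deriv_eq_0_if_bounded[OF o z0(1) _ zero_less_one _ m])
      show "(\<lambda>z. L z - 1 / 4 * z\<^sup>2) holomorphic_on ?S" by (intro holomorphic_intros L)
      fix \<theta> :: real assume t: "\<bar>\<theta>\<bar> < 1"
      have "L (of_real \<theta>) - 1 / 4 * (of_real \<theta>)\<^sup>2 = of_real (ln (mgf q 1 \<theta>) - \<theta>\<^sup>2 / 4)" using L(2) by simp
      moreover have "\<bar>ln (mgf q 1 \<theta>) - \<theta>\<^sup>2 / 4\<bar> \<le> K * \<bar>\<theta>\<bar> ^ Suc 2" using K t by (simp add: eval_nat_numeral)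
      ultimately show "cmod (L (of_real \<theta>) - 1 / 4 * (of_real \<theta>)\<^sup>2) \<le> K * \<bar>\<theta>\<bar> ^ Suc 2" by (simp only: norm_of_real)
    qed
    hence "(deriv ^^ m) L 0 = (if m = 2 then 1 / 4 * fact 2 else 0)"
      using higher_deriv_diff[OF L(1) hol o z0(1), of m] higher_deriv_cmult_power_0[OF m, of "1 / 4"] by simp
    hence "complex_of_real ((deriv ^^ m) h 0) = of_real (if m = 2 then 1 / 2 else 0)"
      unfolding derivs by simp
    thus ?thesis by (simp only: of_real_eq_iff)
  qed
  have h12: "deriv h 0 = 0" "deriv (deriv h) 0 = 1 / 2"
    using low[of 1] low[of 2] by (simp_all add: numeral_2_eq_2)
  have f12: "deriv (pressure q) 0 = 0" "deriv (deriv (pressure q)) 0 = 1 / 2"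
    using deriv_eq[of 1] deriv_eq[of 2] h12 q by (simp_all add: numeral_2_eq_2)
  have conv_h: "convex_on UNIV h"
    using convex_ln_mgf[of q 1] h by (metis (no_types, lifting) ext)
  \<comment> \<open>Vanishing derivatives up to order q are turned back into the bound
    O(\<theta>^(q+1)), the form in which the Legendre transforms can be compared.\<close>
  have "(deriv ^^ m) (\<lambda>z. \<Lambda> z - L z) 0 = 0" if "m \<le> q" for m
    using higher_deriv_diff[OF L(3,1) o z0(1), of m] L(5) that by simp
  then obtain r K where r: "0 < r" "\<forall>z. cmod z < r \<longrightarrow> cmod (\<Lambda> z - L z) \<le> K * cmod z ^ Suc q"
    using bounded_if_higher_deriv_eq_0[OF o z0(1) holomorphic_on_diff[OF L(3,1)], of q] by blast
  have bound: "\<bar>pressure q \<theta> - h \<theta>\<bar> \<le> K * \<bar>\<theta>\<bar> ^ Suc q" if "\<bar>\<theta>\<bar> < r" for \<theta>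
  proof -
    have "cmod (\<Lambda> (of_real \<theta>) - L (of_real \<theta>)) \<le> K * cmod (of_real \<theta>) ^ Suc q"
      using r(2)[rule_format, of "of_real \<theta>"] that by (simp only: norm_of_real)
    moreover have "\<Lambda> (of_real \<theta>) - L (of_real \<theta>) = of_real (pressure q \<theta> - h \<theta>)" by (simp add: Lh \<Lambda>f)
    ultimately show ?thesis by (simp only: norm_of_real)
  qed
  have ex: "\<forall>x. complex_of_real x \<in> ?S \<longrightarrow> \<Lambda> (of_real x) = of_real (pressure q x)"
    "\<forall>x. complex_of_real x \<in> ?S \<longrightarrow> L (of_real x) = of_real (h x)" using Lh \<Lambda>f by auto
  have pos: "0 < deriv (deriv (pressure q)) 0" "0 < deriv (deriv h) 0" using f12 h12 by simp_all
  note agree = legendre_transform_Taylor_agree[OF convex_pressure[OF q] o z0(1) L(3) ex(1) f12(1) pos(1)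
    conv_h o z0(1) L(1) ex(2) h12(1) pos(2) r(1) bound]
  show "ereal_times_differentiable_at m (legendre_transform (pressure q)) 0" by (rule agree(1))
  show "ereal_times_differentiable_at m (legendre_transform h) 0" by (rule agree(2))
  show "m \<le> q \<Longrightarrow> (deriv ^^ m) (\<lambda>x. real_of_ereal (legendre_transform (pressure q) x)) 0 =
      (deriv ^^ m) (\<lambda>x. real_of_ereal (legendre_transform h x)) 0" by (rule agree(3))
qed

section \<open>Return to the random variables\<close>

lemma complex_convergence:
  assumes U: "uniform_rv M U" and q: "2 \<le> q"
  shows "\<exists>D \<Lambda>. open D \<and> \<real> \<subseteq> D \<and>
           (\<forall>\<theta>::real. \<Lambda> (complex_of_real \<theta>) = complex_of_real (pressure q \<theta>)) \<and>
           (\<forall>K. compact K \<and> K \<subseteq> D \<longrightarrow>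
              (\<exists>V L N. open V \<and> connected V \<and> V \<inter> \<real> \<noteq> {} \<and> K \<subseteq> V \<and> V \<subseteq> D \<and>
                 (\<forall>n\<ge>N. real_log_branch_on V (complex_mgf M (lacunary_sum U q n)) (L n)) \<and>
                 uniform_limit K (\<lambda>n \<theta>. L n \<theta> / of_nat n) \<Lambda> sequentially))"
proof -
  have q0: "0 < q" using q by simp
  obtain L \<Lambda> where L:
    "\<And>n. L n holomorphic_on zero_free_strip" "\<And>n z. z \<in> zero_free_strip \<Longrightarrow> exp (L n z) = mgf q n z"
    "\<And>n x. L n (complex_of_real x) = of_real (ln (mgf q n x))"
    "\<Lambda> holomorphic_on zero_free_strip" "\<And>x. \<Lambda> (complex_of_real x) = of_real (pressure q x)"
    "\<And>K. compact K \<Longrightarrow> K \<subseteq> zero_free_strip \<Longrightarrow> uniform_limit K (\<lambda>n z. L n z / of_nat n) \<Lambda> sequentially"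
    by (rule complex_pressure[OF q]) (rule that)
  have real: "\<real> \<subseteq> zero_free_strip" using of_real_in_zero_free_strip by (auto simp: Reals_def)
  have branch: "real_log_branch_on zero_free_strip (complex_mgf M (lacunary_sum U q n)) (L n)" for n
    unfolding real_log_branch_on_def
  proof (intro conjI ballI)
    show "L n holomorphic_on zero_free_strip" by (rule L(1))
    show "exp (L n z) = complex_mgf M (lacunary_sum U q n) z" if "z \<in> zero_free_strip" for z
      using L(2)[OF that] complex_mgf_lacunary_sum[OF U q0] by simp
    show "L n z \<in> \<real>" if "z \<in> zero_free_strip \<inter> \<real>" for z
      using that L(3) by (auto elim!: Reals_cases)
  qed
  show ?thesis
  \<comment> \<open>The branches exist on the whole strip for every n, so V = D and N = 0 serve all
    compact sets K.\<close>
  proof (rule exI[of _ zero_free_strip], rule exI[of _ \<Lambda>], intro conjI allI impI)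
    fix K assume K: "compact K \<and> K \<subseteq> zero_free_strip"
    have "zero_free_strip \<inter> \<real> \<noteq> {}" using real Reals_0 by blast
    thus "\<exists>V L N. open V \<and> connected V \<and> V \<inter> \<real> \<noteq> {} \<and> K \<subseteq> V \<and> V \<subseteq> zero_free_strip \<and>
                 (\<forall>n\<ge>N. real_log_branch_on V (complex_mgf M (lacunary_sum U q n)) (L n)) \<and>
                 uniform_limit K (\<lambda>n \<theta>. L n \<theta> / of_nat n) \<Lambda> sequentially"
      using K branch L(6)[of K] open_zero_free_strip connected_zero_free_strip
      by (intro exI[of _ zero_free_strip] exI[of _ L] exI[of _ "0::nat"]) auto
  qed (use open_zero_free_strip real L(5) in auto)
qed

theorem theoremB:
  fixes M :: "'a measure" and U :: "'a \<Rightarrow> real"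
  assumes "prob_space M"
    and "uniform_rv M U"
  shows
    "(\<forall>q::nat. 2 \<le> q \<longrightarrow>
        (\<forall>\<theta>::real. (\<lambda>n. cgf M (lacunary_sum U q n) \<theta> / real n) \<longlonglongrightarrow> Lambda_q M U q \<theta>) \<and>
        (\<exists>D \<Lambda>. open D \<and> \<real> \<subseteq> D \<and>
           (\<forall>\<theta>::real. \<Lambda> (complex_of_real \<theta>) = complex_of_real (Lambda_q M U q \<theta>)) \<and>
           (\<forall>K. compact K \<and> K \<subseteq> D \<longrightarrow>
              (\<exists>V L N. open V \<and> connected V \<and> V \<inter> \<real> \<noteq> {} \<and> K \<subseteq> V \<and> V \<subseteq> D \<and>
                 (\<forall>n\<ge>N. real_log_branch_on V (complex_mgf M (lacunary_sum U q n)) (L n)) \<and>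
                 uniform_limit K (\<lambda>n \<theta>. L n \<theta> / of_nat n) \<Lambda> sequentially))) \<and>
        satisfies_LDP M (\<lambda>n \<omega>. lacunary_sum U q n \<omega> / real n) (\<lambda>n. real n) (I_q M U q) \<and>
        (\<forall>x. x \<noteq> 0 \<longrightarrow> I_q M U q x > 0) \<and>
        (\<forall>x. x \<notin> {-1..1} \<longrightarrow> I_q M U q x = \<infinity>))
     \<and>
     (\<forall>q::nat. 2 \<le> q \<longrightarrow>
        I_q M U q 1 \<le> I_tilde M U 1 \<and>
        (\<forall>x\<in>{0<..<1}. I_q M U q x < I_tilde M U x) \<and>
        I_q M U q \<noteq> I_tilde M U)
     \<and>
     (\<forall>K. compact K \<and> K \<subseteq> {-1<..<1} \<longrightarrow>
        (\<forall>\<epsilon>>0. \<forall>\<^sub>F q in sequentially. \<forall>x\<in>K. \<bar>I_q M U q x - I_tilde M U x\<bar> < ereal \<epsilon>))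
     \<and>
     (\<forall>q::nat. 2 \<le> q \<longrightarrow>
        times_differentiable_at q (Lambda_q M U q) 0 \<and>
        times_differentiable_at q (Lambda_tilde M U) 0 \<and>
        (\<forall>m\<in>{1..q}.
           (deriv ^^ m) (Lambda_q M U q) 0 = (deriv ^^ m) (Lambda_tilde M U) 0 \<and>
           (deriv ^^ m) (Lambda_tilde M U) 0 = cumulant M (arcsine_rv U) m) \<and>
        ereal_times_differentiable_at q (I_q M U q) 0 \<and>
        ereal_times_differentiable_at q (I_tilde M U) 0 \<and>
        (\<forall>m\<in>{0..q}.
           (deriv ^^ m) (\<lambda>x. real_of_ereal (I_q M U q x)) 0
             = (deriv ^^ m) (\<lambda>x. real_of_ereal (I_tilde M U x)) 0))
     \<and>
     (\<forall>q::nat. 2 \<le> q \<longrightarrow>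
        times_differentiable_at (q + 1) (Lambda_q M U q) 0 \<and>
        times_differentiable_at (q + 1) (Lambda_tilde M U) 0 \<and>
        (deriv ^^ (q + 1)) (Lambda_q M U q) 0
          = (deriv ^^ (q + 1)) (Lambda_tilde M U) 0 + real (q + 1) / 2 ^ q \<and>
        (deriv ^^ (q + 1)) (Lambda_q M U q) 0 > (deriv ^^ (q + 1)) (Lambda_tilde M U) 0)"
proof -
  have h: "Lambda_tilde M U \<theta> = ln (mgf q 1 \<theta>)" for q \<theta>
    by (rule Lambda_tilde_eq[OF assms(2)])
  have cum: "(deriv ^^ m) (Lambda_tilde M U) 0 = cumulant M (arcsine_rv U) m" for m
    by (simp add: cumulant_def Lambda_tilde_def)
  have It: "I_tilde M U = legendre_transform (Lambda_tilde M U)" unfolding I_tilde_def by (rule refl)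
  have f: "Lambda_q M U q = pressure q" "I_q M U q = legendre_transform (pressure q)" if "2 \<le> q" for q
    unfolding I_q_def Lambda_q_eq_pressure[OF assms(2) that] by (rule refl)+
  have part0: "(\<forall>\<theta>::real. (\<lambda>n. cgf M (lacunary_sum U q n) \<theta> / real n) \<longlonglongrightarrow> pressure q \<theta>)"
    "satisfies_LDP M (\<lambda>n \<omega>. lacunary_sum U q n \<omega> / real n) (\<lambda>n. real n) (legendre_transform (pressure q))"
    "\<forall>x. x \<noteq> 0 \<longrightarrow> legendre_transform (pressure q) x > 0"
    "\<forall>x. x \<notin> {-1..1} \<longrightarrow> legendre_transform (pressure q) x = \<infinity>" if q: "2 \<le> q" for q
  proof -
    interpret gaertner_ellis M "lacunary_sum U q" "pressure q"
      by (rule gaertner_ellis_lacunary_sum[OF assms q])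
    show "\<forall>\<theta>::real. (\<lambda>n. cgf M (lacunary_sum U q n) \<theta> / real n) \<longlonglongrightarrow> pressure q \<theta>"
      using limit by blast
    show "satisfies_LDP M (\<lambda>n \<omega>. lacunary_sum U q n \<omega> / real n) (\<lambda>n. real n) (legendre_transform (pressure q))"
      by (rule LDP)
    show "\<forall>x. x \<noteq> 0 \<longrightarrow> legendre_transform (pressure q) x > 0"
      using legendre_transform_pos[of "pressure q"] pressure_differentiable(1)[OF q, of 0]
        pressure_differentiable(2)[OF q] at_0 by simp
    show "\<forall>x. x \<notin> {-1..1} \<longrightarrow> legendre_transform (pressure q) x = \<infinity>"
      using legendre_transform_eq_infinity[of "pressure q", OF pressure_simple_bounds(2)[OF q]] by blast
  qed
  have part1: "legendre_transform (pressure q) \<noteq> I_tilde M U" if q: "2 \<le> q" for q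
    using I_q_less_I_tilde[of q "Lambda_tilde M U" "1/2", OF q h] by (auto simp: It)
  have part2: "\<forall>\<^sub>F q in sequentially. \<forall>x\<in>K. \<bar>I_q M U q x - I_tilde M U x\<bar> < ereal \<epsilon>"
    if K: "compact K \<and> K \<subseteq> {-1<..<1}" and \<epsilon>: "\<epsilon> > 0" for K \<epsilon>
  proof -
    have "\<forall>\<^sub>F q in sequentially. \<forall>x\<in>K. \<bar>legendre_transform (pressure q) x - legendre_transform (Lambda_tilde M U) x\<bar> < ereal \<epsilon>"
      by (rule I_q_uniform_convergence[OF _ _ \<epsilon> h]) (use K in simp_all)
    thus ?thesis using eventually_ge_at_top[of 2]
      by eventually_elim (simp add: f It)
  qed
  note T = Taylor_at_0[of _ "Lambda_tilde M U", OF _ h]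
  show ?thesis
  proof (intro conjI allI impI ballI)
    fix q :: nat assume q: "2 \<le> q"
    show "(\<lambda>n. cgf M (lacunary_sum U q n) \<theta> / real n) \<longlonglongrightarrow> Lambda_q M U q \<theta>" for \<theta>
      using part0(1)[OF q] f[OF q] by simp
    show "\<exists>D \<Lambda>. open D \<and> \<real> \<subseteq> D \<and>
           (\<forall>\<theta>::real. \<Lambda> (complex_of_real \<theta>) = complex_of_real (Lambda_q M U q \<theta>)) \<and>
           (\<forall>K. compact K \<and> K \<subseteq> D \<longrightarrow>
              (\<exists>V L N. open V \<and> connected V \<and> V \<inter> \<real> \<noteq> {} \<and> K \<subseteq> V \<and> V \<subseteq> D \<and>
                 (\<forall>n\<ge>N. real_log_branch_on V (complex_mgf M (lacunary_sum U q n)) (L n)) \<and>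
                 uniform_limit K (\<lambda>n \<theta>. L n \<theta> / of_nat n) \<Lambda> sequentially))"
      unfolding f[OF q] by (rule complex_convergence[OF assms(2) q])
    show "satisfies_LDP M (\<lambda>n \<omega>. lacunary_sum U q n \<omega> / real n) (\<lambda>n. real n) (I_q M U q)"
      unfolding f[OF q] by (rule part0(2)[OF q])
    show "I_q M U q x > 0" if "x \<noteq> 0" for x using part0(3)[OF q] that f[OF q] by simp
    show "I_q M U q x = \<infinity>" if "x \<notin> {-1..1}" for x using part0(4)[OF q] that f[OF q] by simp
    show "I_q M U q 1 \<le> I_tilde M U 1"
      unfolding f[OF q] It by (rule I_q_1_le_I_tilde_1[OF q h])
    show "I_q M U q x < I_tilde M U x" if "x \<in> {0<..<1}" for x
      unfolding f[OF q] It by (rule I_q_less_I_tilde[OF q h that])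
    show "I_q M U q \<noteq> I_tilde M U" unfolding f[OF q] by (rule part1[OF q])
    show "times_differentiable_at q (Lambda_q M U q) 0" "times_differentiable_at (q + 1) (Lambda_q M U q) 0"
      unfolding f[OF q] by (rule T(1)[OF q])+
    show "times_differentiable_at q (Lambda_tilde M U) 0" "times_differentiable_at (q + 1) (Lambda_tilde M U) 0"
      by (rule T(2)[OF q])+
    show "(deriv ^^ m) (Lambda_q M U q) 0 = (deriv ^^ m) (Lambda_tilde M U) 0" if "m \<in> {1..q}" for m
      unfolding f[OF q] using T(3)[OF q, of m] that by simp
    show "(deriv ^^ m) (Lambda_tilde M U) 0 = cumulant M (arcsine_rv U) m" for m by (rule cum)
    show "ereal_times_differentiable_at q (I_q M U q) 0" unfolding f[OF q] by (rule T(4)[OF q])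
    show "ereal_times_differentiable_at q (I_tilde M U) 0" unfolding It by (rule T(5)[OF q])
    show "(deriv ^^ m) (\<lambda>x. real_of_ereal (I_q M U q x)) 0
             = (deriv ^^ m) (\<lambda>x. real_of_ereal (I_tilde M U x)) 0" if "m \<in> {0..q}" for m
      unfolding f[OF q] It by (rule T(6)[OF q]) (use that in simp)
    show eq: "(deriv ^^ (q + 1)) (Lambda_q M U q) 0
          = (deriv ^^ (q + 1)) (Lambda_tilde M U) 0 + real (q + 1) / 2 ^ q"
      unfolding f[OF q] using T(3)[OF q, of "q + 1"] by simp
    show "(deriv ^^ (q + 1)) (Lambda_q M U q) 0 > (deriv ^^ (q + 1)) (Lambda_tilde M U) 0"
      unfolding eq by simp
  qed (rule part2)
qed

end
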